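(* Let $(\mathcal J,\mathcal F_1,\dots,\mathcal F_r)$ be an $\mathcal{H}$-joints configuration of dimension $(k_1,\dots,k_r)$, where $\mathcal{H}=([d],E,c)$ is a uniformly edge-colored (multi-)hypergraph. Fix a weight function $w:E\rightarrow\mathbb{R}_{\geq 0}$ that covers $\mathcal{H}$ and let $(\bar{w}_1,\dots,\bar{w}_r)$ be its subtotal sequence. Then \[\sum_{p\in\mathcal J}\eta(p)\leq C_{\mathcal{H},w}|\mathcal F_1|^{\bar{w}_1}\dots|\mathcal F_r|^{\bar{w}_r}\] holds for the constant \[C_{\mathcal{H},w}=d!^{|w|-1}\prod_{i=1}^r \left(\frac{1}{k_i!}\right)^{\bar{w}_i}\prod_{e\in c^{-1}(i)}\left(\frac{w(e)}{\bar{w}_i}\right)^{w(e)}\] (with the convention $\left(\frac{w(e)}{\bar{w}_i}\right)^{w(e)}=1$ when $w(e)=0$). Moreover, the constant $C_{\mathcal{H},w}$ is the best possible constant if the weight $w$ satisfies $\sum_{e\ni j}w(e)= 1$ for all $j\in [d]$.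
   Context: $\mathbb{F}$ is a field. $\mathcal{H}=([d],E,c)$ is an edge-colored (multi-)hypergraph with vertex set $[d]$, edge multiset $E$, and coloring $c:E\to[r]$ which is $(d-k_1,\dots,d-k_r)$-uniform: each $c^{-1}(i)$ is a non-empty $(d-k_i)$-uniform simple hypergraph, $1\le k_i\le d-1$. A weight $w:E\to\mathbb{R}_{\ge0}$ covers $\mathcal{H}$ if $\sum_{e\ni j}w(e)\ge1$ for all $j\in[d]$; $|w|=\sum_{e}w(e)$; $\bar w_i=\sum_{e\in c^{-1}(i)}w(e)$. Each $\mathcal F_i$ is a multi-set of $k_i$-flats in $\mathbb{F}^d$. A point $p$ is an $\mathcal{H}$-joint if there are flats $(F_{p,e})_{e\in E}$, $F_{p,e}\in\mathcal F_{c(e)}$, and an invertible affine map $A:\mathbb{F}^d\to\mathbb{F}^d$ with $A(0)=p$ and $F_{p,e}=A(\operatorname{span}\{\vec e_j\mid j\notin e\})$; $\mathcal J$ is the set of $\mathcal{H}$-joints. For $p\in\mathcal J$, $\mathcal{T}_p$ is the set of tuples $(F_{p,e})_{e\in E}$ with $F_{p,e}\in\mathcal F_{c(e)}$ forming an $\mathcal{H}$-joint at $p$. Multiplicity $\eta(p)$: for each $i\in[r]$ let $e_i$ be chosen randomly and independently from $c^{-1}(i)$ with $\mathbb{P}(e_i=e)=w(e)/\bar w_i$; then $\log_2\eta(p)=\max\sum_{i=1}^r\bar w_i\left(H(F_{p,e_i})-H(e_i)\right)$, where $H$ is Shannon entropy and the maximum is over all distributions of a random tuple $(F_{p,e})_{e\in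 E}\in\mathcal{T}_p$ independent of $(e_i)_{i\in[r]}$.
   Formalization: "Best possible" is stated over every infinite field (so no smaller constant works for all fields); over a fixed finite field it can fail, e.g. d=2, lines, edges {1},{2} of one color, w=1. The inequality itself is stated over every field. *)

theory Defs
  imports "HOL-Probability.Probability"
begin

section \<open>Edge-coloured hypergraphs and covering weights\<close>

text \<open>
  The vertex set is the finite type \<open>'n\<close>, so \<open>d = CARD('n)\<close>. The edge multiset is encoded by edge
  labels of type \<open>'e\<close>: two labels may carry the same vertex set \<open>verts H e\<close>. Colours are \<open>{1..r}\<close>.
\<close>

record ('e, 'n) chypergraph =
  edges :: "'e set"
  verts :: "'e \<Rightarrow> 'n set"
  colour :: "'e \<Rightarrow> nat"
  ncolours :: nat

definition colour_class :: "('e, 'n) chypergraph \<Rightarrow> nat \<Rightarrow> 'e set" where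
  "colour_class H i = {e \<in> edges H. colour H e = i}"

text \<open>Injectivity of \<open>verts H\<close> on a colour class says that the class is a simple hypergraph.\<close>

definition uniform_chypergraph :: "('e, 'n::finite) chypergraph \<Rightarrow> (nat \<Rightarrow> nat) \<Rightarrow> bool" where
  "uniform_chypergraph H k \<longleftrightarrow>
     finite (edges H) \<and>
     colour H ` edges H \<subseteq> {1..ncolours H} \<and>
     (\<forall>i\<in>{1..ncolours H}.
        1 \<le> k i \<and> k i \<le> CARD('n) - 1 \<and>
        colour_class H i \<noteq> {} \<and>
        inj_on (verts H) (colour_class H i) \<and>
        (\<forall>e\<in>colour_class H i. card (verts H e) = CARD('n) - k i))"

definition covers :: "('e, 'n) chypergraph \<Rightarrow> ('e \<Rightarrow> real) \<Rightarrow> bool" where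
  "covers H w \<longleftrightarrow>
     (\<forall>e\<in>edges H. 0 \<le> w e) \<and> (\<forall>j. 1 \<le> (\<Sum>e | e \<in> edges H \<and> j \<in> verts H e. w e))"

definition total_weight :: "('e, 'n) chypergraph \<Rightarrow> ('e \<Rightarrow> real) \<Rightarrow> real" where
  "total_weight H w = (\<Sum>e\<in>edges H. w e)"

definition subtotal :: "('e, 'n) chypergraph \<Rightarrow> ('e \<Rightarrow> real) \<Rightarrow> nat \<Rightarrow> real" where
  "subtotal H w i = (\<Sum>e\<in>colour_class H i. w e)"


section \<open>Flats and joints\<close>

definition flat :: "nat \<Rightarrow> ('a::field ^ 'n) set \<Rightarrow> bool" where
  "flat m S \<longleftrightarrow> (\<exists>p U. vec.subspace U \<and> vec.dim U = m \<and> S = (\<lambda>u. p + u) ` U)"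

definition invertible_affine :: "('a::field ^ 'n \<Rightarrow> 'a ^ 'n) \<Rightarrow> bool" where
  "invertible_affine A \<longleftrightarrow> (\<exists>M b. invertible M \<and> A = (\<lambda>x. M *v x + b))"

definition flats_configuration ::
    "('e, 'n) chypergraph \<Rightarrow> (nat \<Rightarrow> nat) \<Rightarrow> (nat \<Rightarrow> ('a::field ^ 'n) set multiset) \<Rightarrow> bool" where
  "flats_configuration H k \<F> \<longleftrightarrow> (\<forall>i\<in>{1..ncolours H}. \<forall>S\<in>#\<F> i. flat (k i) S)"

text \<open>
  The members of a multiset, repeated copies being distinguished by an index: the pair \<open>(S, n)\<close> is
  the \<open>n\<close>-th copy of \<open>S\<close>. There are \<open>size M\<close> of them. Entropies of random members of \<open>\<F> i\<close> refer to
  these labelled copies, so that repeated flats do contribute to multiplicities.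
\<close>

definition members :: "'x multiset \<Rightarrow> ('x \<times> nat) set" where
  "members M = (SIGMA S:set_mset M. {..<count M S})"

text \<open>
  \<open>joint_tuples H \<F> p\<close> is the set of tuples of flats (as labelled members) forming a joint at \<open>p\<close>;
  tuples are functions on the edges, \<open>undefined\<close> elsewhere.
\<close>

definition joint_tuples ::
    "('e, 'n) chypergraph \<Rightarrow> (nat \<Rightarrow> ('a::field ^ 'n) set multiset) \<Rightarrow> 'a ^ 'n \<Rightarrow>
     ('e \<Rightarrow> ('a ^ 'n) set \<times> nat) set" where
  "joint_tuples H \<F> p =
     {T \<in> (\<Pi>\<^sub>E e\<in>edges H. members (\<F> (colour H e))).
        \<exists>A. invertible_affine A \<and> A 0 = p \<and>
            (\<forall>e\<in>edges H. fst (T e) = A ` vec.span {axis j 1 | j. j \<notin> verts H e})}"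

definition joints ::
    "('e, 'n) chypergraph \<Rightarrow> (nat \<Rightarrow> ('a::field ^ 'n) set multiset) \<Rightarrow> ('a ^ 'n) set" where
  "joints H \<F> = {p. joint_tuples H \<F> p \<noteq> {}}"


section \<open>Multiplicity of a joint\<close>

text \<open>Entropy, in bits, of the discrete random variable \<open>X\<close> on the probability space \<open>q\<close>.\<close>

definition shannon_entropy :: "'x pmf \<Rightarrow> ('x \<Rightarrow> 'y) \<Rightarrow> real" where
  "shannon_entropy q X = prob_space.entropy (measure_pmf q) 2 (count_space UNIV) X"

text \<open>
  The law of \<open>e\<^sub>i\<close>. If \<open>subtotal H w i = 0\<close> the function below is no probability mass function and
  the law is an unspecified one; its entropy terms are then multiplied by \<open>subtotal H w i = 0\<close>.
\<close>

definition edge_pmf :: "('e, 'n) chypergraph \<Rightarrow> ('e \<Rightarrow> real) \<Rightarrow> nat \<Rightarrow> 'e pmf" where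
  "edge_pmf H w i = embed_pmf (\<lambda>e. if e \<in> colour_class H i then w e / subtotal H w i else 0)"

text \<open>
  The joint law of a random tuple with law \<open>\<mu>\<close> and of the edges \<open>(e\<^sub>i)\<close>, all independent.
\<close>

definition tuple_edges_pmf ::
    "('e, 'n) chypergraph \<Rightarrow> ('e \<Rightarrow> real) \<Rightarrow> ('e \<Rightarrow> 'f) pmf \<Rightarrow> (('e \<Rightarrow> 'f) \<times> (nat \<Rightarrow> 'e)) pmf" where
  "tuple_edges_pmf H w \<mu> = pair_pmf \<mu> (Pi_pmf {1..ncolours H} undefined (edge_pmf H w))"

definition tuple_score ::
    "('e, 'n) chypergraph \<Rightarrow> ('e \<Rightarrow> real) \<Rightarrow> ('e \<Rightarrow> 'f) pmf \<Rightarrow> real" where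
  "tuple_score H w \<mu> =
     (\<Sum>i=1..ncolours H. subtotal H w i *
        (shannon_entropy (tuple_edges_pmf H w \<mu>) (\<lambda>(T, \<epsilon>). T (\<epsilon> i)) -
         shannon_entropy (tuple_edges_pmf H w \<mu>) (\<lambda>(T, \<epsilon>). \<epsilon> i)))"

text \<open>
  For a joint \<open>p\<close>, \<open>joint_tuples H \<F> p\<close> is finite and non-empty, so the supremum is over the
  continuous image of a compact simplex and is a maximum.
\<close>

definition multiplicity_at ::
    "('e, 'n) chypergraph \<Rightarrow> ('e \<Rightarrow> real) \<Rightarrow> (nat \<Rightarrow> ('a::field ^ 'n) set multiset) \<Rightarrow> 'a ^ 'n \<Rightarrow> real"
    where
  "multiplicity_at H w \<F> p =
     2 powr (SUP \<mu>\<in>{\<mu>. set_pmf \<mu> \<subseteq> joint_tuples H \<F> p}. tuple_score H w \<mu>)"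


section \<open>The constant\<close>

text \<open>Real powers of non-negative reals with \<open>x\<^sup>0 = 1\<close> also for \<open>x = 0\<close>, where \<open>0 powr 0 = 0\<close>.\<close>

definition rpow :: "real \<Rightarrow> real \<Rightarrow> real" where
  "rpow x a = (if a = 0 then 1 else x powr a)"

definition joints_constant ::
    "('e, 'n::finite) chypergraph \<Rightarrow> (nat \<Rightarrow> nat) \<Rightarrow> ('e \<Rightarrow> real) \<Rightarrow> real" where
  "joints_constant H k w =
     rpow (fact CARD('n)) (total_weight H w - 1) *
     (\<Prod>i=1..ncolours H.
        rpow (1 / fact (k i)) (subtotal H w i) *
        (\<Prod>e\<in>colour_class H i. rpow (w e / subtotal H w i) (w e)))"


section \<open>Consistency checks\<close>

lemma shannon_entropy_eq_sum:
  fixes q :: "'x pmf" and X :: "'x \<Rightarrow> 'y"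
  assumes "finite (set_pmf (map_pmf X q))"
  shows "shannon_entropy q X =
    - (\<Sum>y\<in>set_pmf (map_pmf X q). pmf (map_pmf X q) y * log 2 (pmf (map_pmf X q) y))"
proof -
  let ?P = "map_pmf X q" and ?C = "count_space (UNIV :: 'y set)"
  have distr: "distr (measure_pmf q) ?C X = measure_pmf ?P"
    by (simp add: map_pmf_rep_eq)
  have dens: "density ?C (\<lambda>y. ennreal (pmf ?P y)) = measure_pmf ?P"
    by (rule measure_pmf_eq_density[symmetric])
  have "density ?C (RN_deriv ?C (measure_pmf ?P)) = measure_pmf ?P"
    by (rule RN_derivI[OF _ dens]) simp
  moreover have "emeasure (density ?C f) {y} = f y" for f :: "'y \<Rightarrow> ennreal" and y
    by (subst emeasure_density) (auto simp: nn_integral_count_space_indicator[symmetric]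
        nn_integral_count_space_finite)
  ultimately have RN: "RN_deriv ?C (measure_pmf ?P) y = ennreal (pmf ?P y)" for y
    by (metis emeasure_pmf_single)
  have "KL_divergence 2 ?C (measure_pmf ?P) = (\<integral>y. log 2 (pmf ?P y) \<partial>measure_pmf ?P)"
    by (simp add: KL_divergence_def entropy_density_def comp_def RN del: integral_map_pmf)
  also have "\<dots> = (\<Sum>y\<in>set_pmf ?P. pmf ?P y * log 2 (pmf ?P y))"
    by (subst integral_measure_pmf[OF assms]) auto
  finally show ?thesis
    by (simp only: shannon_entropy_def prob_space.entropy_def[OF measure_pmf.prob_space_axioms] distr)
qed

lemma finite_members [simp]: "finite (members M)"
  by (simp add: members_def)

lemma card_members: "card (members M) = size M"
  by (simp add: members_def size_multiset_overloaded_eq)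

lemma joint_tuples_unique:
  fixes H :: "('e, 'n::finite) chypergraph" and p p' :: "'a::field ^ 'n"
  assumes "covers H w" "T \<in> joint_tuples H \<F> p" "T \<in> joint_tuples H \<F> p'"
  shows "p = p'"
proof -
  obtain A :: "'a ^ 'n \<Rightarrow> 'a ^ 'n" where A: "A 0 = p"
    "\<forall>e\<in>edges H. fst (T e) = A ` vec.span {axis j 1 | j. j \<notin> verts H e}"
    "invertible_affine A"
    using assms(2) unfolding joint_tuples_def by blast
  obtain B :: "'a ^ 'n \<Rightarrow> 'a ^ 'n" where B: "B 0 = p'"
    "\<forall>e\<in>edges H. fst (T e) = B ` vec.span {axis j 1 | j. j \<notin> verts H e}"
    using assms(3) unfolding joint_tuples_def by blast
  from A(3) obtain M b where M: "invertible M" "A = (\<lambda>x. M *v x + b)"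
    by (auto simp: invertible_affine_def)
  have injA: "x = y" if "A x = A y" for x y
  proof -
    obtain M' where "M' ** M = mat 1" using M(1) by (auto simp: invertible_def)
    moreover have "M *v x = M *v y" using that M(2) by simp
    ultimately show ?thesis
      by (metis matrix_vector_mul_assoc matrix_vector_mul_lid)
  qed
  have zero: "x $ j = 0"
    if "x \<in> vec.span {axis i 1 | i. i \<notin> S}" "j \<in> S" for x :: "'a ^ 'n" and j S
    using that(1)
  proof (induction rule: vec.span_induct)
    case base
    show ?case by (auto simp: vec.subspace_def)
  next
    case (step x)
    then show ?case using that(2) by (auto simp: axis_def)
  qed
  have mem: "p' \<in> A ` vec.span {axis j 1 | j. j \<notin> verts H e}" if "e \<in> edges H" for e
  proof -
    have "B 0 \<in> B ` vec.span {axis j 1 | j. j \<notin> verts H e}"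
      by (intro imageI vec.span_zero)
    then show ?thesis using bspec[OF A(2) that] bspec[OF B(2) that] B(1) by simp
  qed
  have cov: "\<exists>e\<in>edges H. j \<in> verts H e" for j
  proof (rule ccontr)
    assume "\<not> (\<exists>e\<in>edges H. j \<in> verts H e)"
    then have "{e. e \<in> edges H \<and> j \<in> verts H e} = {}" by auto
    moreover have "1 \<le> (\<Sum>e | e \<in> edges H \<and> j \<in> verts H e. w e)"
      using assms(1) by (simp only: covers_def)
    ultimately show False by (simp only: sum.empty)
  qed
  obtain e0 where "e0 \<in> edges H" using cov by blast
  then obtain x where x: "p' = A x" using mem[of e0] by blast
  have "x $ j = 0" for j
  proof -
    obtain e where e: "e \<in> edges H" "j \<in> verts H e" using cov by blast
    then obtain y where "p' = A y" "y \<in> vec.span {axis j 1 | j. j \<notin> verts H e}"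
      using mem[of e] by blast
    moreover have "x = y" by (rule injA) (use x \<open>p' = A y\<close> in simp)
    ultimately have "x \<in> vec.span {axis j 1 | j. j \<notin> verts H e}" by simp
    from zero[OF this e(2)] show ?thesis .
  qed
  then have "x = 0" by (simp add: vec_eq_iff)
  with x A(1) show ?thesis by simp
qed

lemma finite_joint_tuples:
  assumes "finite (edges H)"
  shows "finite (joint_tuples H \<F> p)"
proof (rule finite_subset)
  show "joint_tuples H \<F> p \<subseteq> (\<Pi>\<^sub>E e\<in>edges H. members (\<F> (colour H e)))"
    by (auto simp: joint_tuples_def)
qed (simp add: assms finite_PiE)

lemma finite_joints:
  fixes H :: "('e, 'n::finite) chypergraph"
  assumes "finite (edges H)" "covers H w"
  shows "finite (joints H \<F>)"
proof -
  let ?T = "\<Pi>\<^sub>E e\<in>edges H. members (\<F> (colour H e))"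
  let ?f = "\<lambda>p. SOME T. T \<in> joint_tuples H \<F> p"
  have f: "?f p \<in> joint_tuples H \<F> p" if "p \<in> joints H \<F>" for p
    using that by (auto simp: joints_def some_in_eq)
  have "inj_on ?f (joints H \<F>)"
  proof (rule inj_onI)
    fix p q assume "p \<in> joints H \<F>" "q \<in> joints H \<F>" "?f p = ?f q"
    then have "?f p \<in> joint_tuples H \<F> p" "?f p \<in> joint_tuples H \<F> q"
      using f[of p] f[of q] by simp_all
    then show "p = q" by (rule joint_tuples_unique[OF assms(2)])
  qed
  moreover have "?f ` joints H \<F> \<subseteq> ?T"
    using f by (fastforce simp: joint_tuples_def)
  moreover have "finite ?T" by (simp add: assms finite_PiE)
  ultimately show ?thesis using finite_imageD finite_subset by blast
qed

end

theory Submission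
  imports Defs "HOL-Library.Function_Algebras" "HOL-Computational_Algebra.Polynomial"
    "HOL-Computational_Algebra.Fraction_Field" "HOL-Real_Asymp.Real_Asymp"
begin

text \<open>
  Upper bound (polynomial method with delays). Polynomials of degree at most \<open>n\<close> are forced to vanish at the
  joints to higher and higher order, the joint \<open>p\<close> being delayed by \<open>\<beta> p\<close>. The successive losses of
  dimension distribute \<open>binom (n + d) d\<close> over the joints, and the delays can be chosen such that \<open>p\<close> receives
  at least the share \<open>\<eta> p / \<Sum> \<eta>\<close>. The same conditions on a flat distribute \<open>binom (n + k) k\<close> over the
  joints on it. In coordinates adapted to a tuple at \<open>p\<close>, the leading exponents counted at \<open>p\<close> project
  onto exponents counted at \<open>p\<close> on each flat of the tuple, because slicing a polynomial transversally to a
  flat lowers all orders of vanishing by at most the degree of the slice. Conditional entropy then bounds the share of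
  \<open>p\<close> by the weighted product of its shares on the flats. Averaging the logarithm over a random tuple,
  Gibbs' inequality (twice) and \<open>n \<longlongrightarrow> \<infinity>\<close> give the bound. As finite fields have too few points, the
  argument takes place over \<open>F(t)\<close>.

  Sharpness: all intersections of \<open>m\<close> hyperplanes in general position, with the uniform distribution on the
  assignments of the \<open>d\<close> hyperplanes through a joint to the vertices, and \<open>m \<longlongrightarrow> \<infinity>\<close>.
\<close>

section \<open>Dimension counts in spaces of functions\<close>

text \<open>Origin of the constant: the dimension \<open>binom (n + d) d\<close>, about n^d / d!,
  contributes d!^(|w|-1); the dimensions on the flats contribute 1/k_i! once per unit of subtotal
  weight; the entropies of the edges e_i, which do not depend on the tuple, contribute the factors
  in w(e). The entropy inequality yields only the power |w| - 1 of the share of p. The missing power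
  comes from \<eta> itself, as \<eta> p is the share times the total. Only then does the exponent
  equal the sum of the subtotals, and the entropy of the shares cancels in the second use of Gibbs'
  inequality. Losses of dimension at points treated at the same time are all measured against the
  same space. This makes them comparable between the ambient space and the flats without ordering
  the points. The price is that on a flat the degree rises from n to n + |J|, which is invisible in
  the limit. Delays enter only through truncated differences of orders, which slicing shifts
  consistently.\<close>

definition fscale :: "'k::field \<Rightarrow> ('x \<Rightarrow> 'k) \<Rightarrow> 'x \<Rightarrow> 'k" where
  "fscale c f = (\<lambda>x. c * f x)"

lemma fscale_apply: "fscale c f x = c * f x"
  by (simp add: fscale_def)

global_interpretation fs: vector_space "fscale :: 'k::field \<Rightarrow> ('x \<Rightarrow> 'k) \<Rightarrow> 'x \<Rightarrow> 'k"
  by unfold_locales (auto simp: fscale_apply fun_eq_iff algebra_simps)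

text \<open>All spaces live inside one function type, which is infinite-dimensional for an infinite
  domain; finite dimension is therefore carried by each subspace.\<close>

definition findim :: "('x \<Rightarrow> 'k::field) set \<Rightarrow> bool" where
  "findim V \<longleftrightarrow> (\<exists>B. finite B \<and> V \<subseteq> fs.span B)"

lemma findim_subset: "findim V \<Longrightarrow> U \<subseteq> V \<Longrightarrow> findim U"
  by (auto simp: findim_def)

lemma findim_basis:
  assumes "findim V" "fs.subspace V"
  obtains B where "finite B" "B \<subseteq> V" "fs.independent B" "fs.span B = V" "card B = fs.dim V"
proof -
  obtain B where B: "B \<subseteq> V" "fs.independent B" "V \<subseteq> fs.span B" "card B = fs.dim V"
    using fs.basis_exists by blast
  obtain D where D: "finite D" "V \<subseteq> fs.span D" using assms(1) by (auto simp: findim_def)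
  have "finite B" using fs.independent_span_bound[OF D(1) B(2)] B(1) D(2) by blast
  moreover have "fs.span B = V" using B(1,3) assms(2) by (simp add: fs.span_minimal subset_antisym)
  ultimately show ?thesis using that B by blast
qed

lemma dim_mono_findim:
  assumes "findim V" "fs.subspace V" "U \<subseteq> V" "fs.subspace U"
  shows "fs.dim U \<le> fs.dim V"
proof -
  obtain B where B: "finite B" "B \<subseteq> V" "fs.independent B" "fs.span B = V" "card B = fs.dim V"
    using findim_basis[OF assms(1,2)] by blast
  have "findim U" using assms findim_subset by blast
  then obtain C where C: "finite C" "C \<subseteq> U" "fs.independent C" "fs.span C = U" "card C = fs.dim U"
    using findim_basis[OF _ assms(4)] by blast
  have "card C \<le> card B" using fs.independent_span_bound[OF B(1) C(3)] C(2) assms(3) B(4) by auto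
  then show ?thesis using B C by simp
qed

text \<open>Rank-nullity for one functional. Linearity is asked for on V only, because the
  coefficients of a function in a chart are known to be linear only on polynomial functions.\<close>

lemma dim_kernel:
  assumes fin: "findim V" and V: "fs.subspace V"
    and add: "\<And>f g. f \<in> V \<Longrightarrow> g \<in> V \<Longrightarrow> \<phi> (f + g) = \<phi> f + \<phi> g"
    and scale: "\<And>c f. f \<in> V \<Longrightarrow> \<phi> (fscale c f) = c * \<phi> f"
  shows "fs.subspace {f \<in> V. \<phi> f = 0}"
    and "fs.dim V = fs.dim {f \<in> V. \<phi> f = 0} + (if \<exists>f\<in>V. \<phi> f \<noteq> 0 then 1 else 0)"
proof -
  let ?U = "{f \<in> V. \<phi> f = 0}"
  have "\<phi> 0 = 0" using scale[of 0 0] V by (auto simp: fs.subspace_def)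
  then show U: "fs.subspace ?U" using V add scale by (auto simp: fs.subspace_def)
  show "fs.dim V = fs.dim ?U + (if \<exists>f\<in>V. \<phi> f \<noteq> 0 then 1 else 0)"
  proof (cases "\<exists>f\<in>V. \<phi> f \<noteq> 0")
    case False
    then have "?U = V" by auto
    then show ?thesis using False by simp
  next
    case True
    then obtain f where f: "f \<in> V" "\<phi> f \<noteq> 0" by blast
    have "findim ?U" using fin by (rule findim_subset) auto
    then obtain B where B: "finite B" "B \<subseteq> ?U" "fs.independent B" "fs.span B = ?U" "card B = fs.dim ?U"
      using findim_basis[OF _ U] by blast
    have nin: "f \<notin> fs.span B" using f B(4) by auto
    then have "f \<notin> B" using fs.span_base by blast
    have ind: "fs.independent (insert f B)"
      using nin B(3) by (rule fs.independent_insertI)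
    have sp: "V \<subseteq> fs.span (insert f B)"
    proof
      fix g assume g: "g \<in> V"
      let ?c = "\<phi> g / \<phi> f"
      have "g + fscale (- ?c) f \<in> V"
        using V g f by (intro fs.subspace_add fs.subspace_scale)
      moreover have "\<phi> (g + fscale (- ?c) f) = 0"
      proof -
        have "fscale (- ?c) f \<in> V" using V f by (intro fs.subspace_scale)
        then show ?thesis using g f by (simp only: add scale) simp
      qed
      ultimately have *: "g + fscale (- ?c) f \<in> fs.span B" using B(4) by auto
      have *: "g + fscale (- ?c) f \<in> fs.span (insert f B)"
        using * fs.span_mono[OF subset_insertI, of B f] by (rule subsetD[rotated])
      have "g = (g + fscale (- ?c) f) + fscale ?c f" by (auto simp: fscale_apply fun_eq_iff)
      moreover have "\<dots> \<in> fs.span (insert f B)"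
        by (intro fs.span_add[OF *] fs.span_scale fs.span_base) simp
      ultimately show "g \<in> fs.span (insert f B)" by simp
    qed
    have "card (insert f B) = fs.dim V"
      using fs.basis_card_eq_dim[OF _ sp ind] B(2) f(1) by auto
    then show ?thesis using True B \<open>f \<notin> B\<close> by simp
  qed
qed

text \<open>Gaussian elimination: eliminating the functionals in increasing order, each one that occurs as
  a leading functional lowers the dimension by one.\<close>

lemma dim_leading:
  fixes \<phi> :: "'i \<Rightarrow> ('x \<Rightarrow> 'k::field) \<Rightarrow> 'k" and key :: "'i \<Rightarrow> nat"
  assumes fin: "findim V" and V: "fs.subspace V"
    and add: "\<And>i f g. i \<in> I \<Longrightarrow> f \<in> V \<Longrightarrow> g \<in> V \<Longrightarrow> \<phi> i (f + g) = \<phi> i f + \<phi> i g"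
    and scale: "\<And>i c f. i \<in> I \<Longrightarrow> f \<in> V \<Longrightarrow> \<phi> i (fscale c f) = c * \<phi> i f"
    and I: "finite I" and inj: "inj_on key I"
  shows "fs.dim V = fs.dim {f \<in> V. \<forall>i\<in>I. \<phi> i f = 0} +
    card {i \<in> I. \<exists>f\<in>V. \<phi> i f \<noteq> 0 \<and> (\<forall>i'\<in>I. key i' < key i \<longrightarrow> \<phi> i' f = 0)}"
proof -
  \<comment> \<open>The elimination runs over all natural numbers n; across a value that is the key
    of no index the space \<open>U n\<close> stays the same.\<close>
  define U where "U = (\<lambda>n. {f \<in> V. \<forall>i\<in>I. key i < n \<longrightarrow> \<phi> i f = 0})"
  define L where "L = {i \<in> I. \<exists>f\<in>V. \<phi> i f \<noteq> 0 \<and> (\<forall>i'\<in>I. key i' < key i \<longrightarrow> \<phi> i' f = 0)}"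
  have zero: "\<phi> i 0 = 0" if "i \<in> I" for i
    using scale[OF that, of 0 0] V by (auto simp: fs.subspace_def)
  have U: "fs.subspace (U n)" for n
    using V add scale zero unfolding U_def fs.subspace_def by (auto simp del: zero_fun_apply)
  have step: "fs.dim V = fs.dim (U n) + card {i \<in> L. key i < n}" for n
  proof (induction n)
    case 0
    then show ?case by (simp add: U_def)
  next
    case (Suc n)
    show ?case
    proof (cases "\<exists>i\<in>I. key i = n")
      case False
      then have "U (Suc n) = U n" "{i \<in> L. key i < Suc n} = {i \<in> L. key i < n}"
        using less_Suc_eq by (auto simp: U_def L_def)
      then show ?thesis using Suc by simp
    next
      case True
      then obtain i where i: "i \<in> I" "key i = n" by blast
      have uniq: "j = i" if "j \<in> I" "key j = n" for j using inj i that by (auto simp: inj_on_def)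
      have sub: "U n \<subseteq> V" by (auto simp: U_def)
      have eq: "U (Suc n) = {f \<in> U n. \<phi> i f = 0}"
      proof -
        have "(\<forall>j\<in>I. key j < Suc n \<longrightarrow> \<phi> j f = 0) \<longleftrightarrow> (\<forall>j\<in>I. key j < n \<longrightarrow> \<phi> j f = 0) \<and> \<phi> i f = 0" for f
          using i uniq less_Suc_eq by metis
        then show ?thesis by (auto simp: U_def)
      qed
      have "fs.dim (U n) = fs.dim (U (Suc n)) + (if \<exists>f\<in>U n. \<phi> i f \<noteq> 0 then 1 else 0)"
        unfolding eq
      proof (rule dim_kernel(2)[OF findim_subset[OF fin sub] U])
        show "\<phi> i (f + g) = \<phi> i f + \<phi> i g" if "f \<in> U n" "g \<in> U n" for f g
          using that sub i by (intro add) auto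
        show "\<phi> i (fscale c f) = c * \<phi> i f" if "f \<in> U n" for c f
          using that sub i by (intro scale) auto
      qed
      moreover have "(\<exists>f\<in>U n. \<phi> i f \<noteq> 0) \<longleftrightarrow> i \<in> L"
        using i by (auto simp: U_def L_def)
      moreover have "{j \<in> L. key j < Suc n} = (if i \<in> L then insert i {j \<in> L. key j < n} else {j \<in> L. key j < n})"
      proof (intro set_eqI)
        fix j
        have "j \<in> L \<Longrightarrow> key j = n \<Longrightarrow> j = i" using uniq by (simp add: L_def)
        then show "j \<in> {j \<in> L. key j < Suc n} \<longleftrightarrow>
          j \<in> (if i \<in> L then insert i {j \<in> L. key j < n} else {j \<in> L. key j < n})"
          using i less_Suc_eq by (cases "i \<in> L") auto
      qed
      moreover have "finite {j \<in> L. key j < n}" "i \<notin> {j \<in> L. key j < n}"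
        using I i by (auto simp: L_def)
      ultimately show ?thesis using Suc by auto
    qed
  qed
  define n where "n = Suc (Max (insert 0 (key ` I)))"
  have n: "key i < n" if "i \<in> I" for i
    using that I Max_ge[of "insert 0 (key ` I)" "key i"] unfolding n_def by (auto simp: less_Suc_eq_le)
  have "U n = {f \<in> V. \<forall>i\<in>I. \<phi> i f = 0}" "{i \<in> L. key i < n} = L"
    using n by (auto simp: U_def L_def)
  then show ?thesis using step[of n] by (simp add: L_def)
qed

section \<open>Polynomial functions\<close>

definition xpow :: "('n::finite \<Rightarrow> nat) \<Rightarrow> 'k::field ^ 'n \<Rightarrow> 'k" where
  "xpow a x = (\<Prod>j\<in>UNIV. x $ j ^ a j)"

definition deg :: "('n::finite \<Rightarrow> nat) \<Rightarrow> nat" where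
  "deg a = (\<Sum>j\<in>UNIV. a j)"

definition Exps :: "'n::finite set \<Rightarrow> nat \<Rightarrow> ('n \<Rightarrow> nat) set" where
  "Exps S n = {a. (\<forall>j. j \<notin> S \<longrightarrow> a j = 0) \<and> deg a \<le> n}"

definition coords :: "'n::finite set \<Rightarrow> ('k::field ^ 'n) set" where
  "coords S = {x. \<forall>j. j \<notin> S \<longrightarrow> x $ j = 0}"

text \<open>Polynomials of degree at most n are kept as functions, which makes restriction to flats
  and change of chart mere composition. Over infinite fields \<open>Exps_coeff_zero\<close> recovers
  the coefficients.\<close>

definition polys :: "nat \<Rightarrow> ('k::field ^ 'n::finite \<Rightarrow> 'k) set" where
  "polys n = {f. \<exists>c. \<forall>x. f x = (\<Sum>a\<in>Exps UNIV n. c a * xpow a x)}"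

lemma deg_component_le: "a j \<le> deg a"
  unfolding deg_def by (rule member_le_sum) auto

lemma deg_add [simp]: "deg (\<lambda>j. a j + b j) = deg a + deg b"
  by (simp add: deg_def sum.distrib)

lemma xpow_add: "xpow (\<lambda>j. a j + b j) x = xpow a x * xpow b x"
  by (simp add: xpow_def power_add prod.distrib)

lemma xpow_scale: "xpow a (t *s x) = t ^ deg a * xpow a x"
  by (simp add: xpow_def deg_def power_mult_distrib prod.distrib power_sum)

lemma xpow_zero [simp]: "xpow (\<lambda>j. 0) x = 1"
  by (simp add: xpow_def)

lemma finite_Exps [simp]: "finite (Exps S n)"
proof (rule finite_subset)
  show "Exps S n \<subseteq> (\<Pi>\<^sub>E j\<in>UNIV. {..n})"
    using deg_component_le order_trans by (fastforce simp: Exps_def PiE_def extensional_def)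
qed (simp add: finite_PiE)

lemma xpow_coords_eq_0:
  assumes "x \<in> coords S" "a j \<noteq> 0" "j \<notin> S"
  shows "xpow a x = 0"
  unfolding xpow_def by (rule prod_zero) (use assms in \<open>auto simp: coords_def intro!: bexI[of _ j]\<close>)

text \<open>Fixing the value v of one coordinate leaves exponents of degree at most n - v, and the
  hockey-stick identity sums their numbers.\<close>

lemma card_Exps: "card (Exps S n) = (n + card S) choose card S"
proof (induction "card S" arbitrary: S n)
  case 0
  then have "S = {}" by simp
  then have "Exps S n = {\<lambda>j. 0}" by (auto simp: Exps_def deg_def)
  then show ?case using 0 by simp
next
  case (Suc k)
  then obtain i S' where S: "S = insert i S'" "i \<notin> S'" "card S' = k"
    by (metis card_Suc_eq)
  have deg: "deg (a(i := v)) = deg a - a i + v" for a :: "'a \<Rightarrow> nat" and v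
    unfolding deg_def by (subst (1 2) sum.remove[of _ i]) (auto intro!: sum.cong)
  have "bij_betw (\<lambda>(v, a). a(i := v)) (SIGMA v:{..n}. Exps S' (n - v)) (Exps S n)"
  proof (rule bij_betwI[where g = "\<lambda>a. (a i, a(i := 0))"])
    show "(\<lambda>(v, a). a(i := v)) \<in> (SIGMA v:{..n}. Exps S' (n - v)) \<rightarrow> Exps S n"
      using S by (auto simp: Exps_def deg)
    show "(\<lambda>a. (a i, a(i := 0))) \<in> Exps S n \<rightarrow> (SIGMA v:{..n}. Exps S' (n - v))"
      using S deg_component_le[of _ i] order_trans by (fastforce simp: Exps_def deg)
  qed (use S in \<open>auto simp: Exps_def fun_eq_iff\<close>)
  then have "card (Exps S n) = (\<Sum>v\<le>n. card (Exps S' (n - v)))"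
    by (subst bij_betw_same_card[symmetric]) (auto simp: card_SigmaI)
  also have "\<dots> = (\<Sum>v\<le>n. (n - v + k) choose k)"
    using Suc(1)[of S'] S by simp
  also have "\<dots> = (\<Sum>v\<le>n. (v + k) choose k)"
    using sum.nat_diff_reindex[of "\<lambda>v. (v + k) choose k" "Suc n"] by (simp add: lessThan_Suc_atMost)
  also have "\<dots> = (n + Suc k) choose Suc k"
    using sum_choose_upper[of k "n + k"] choose_rising_sum(1)[of k n] by (simp add: add.commute)
  finally show ?case using Suc by simp
qed

lemma polysI: "(\<And>x. f x = (\<Sum>a\<in>Exps UNIV n. c a * xpow a x)) \<Longrightarrow> f \<in> polys n"
  by (auto simp: polys_def)

lemma polys_subspace: "fs.subspace (polys n)"
  unfolding fs.subspace_def
proof (intro conjI ballI allI)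
  show "0 \<in> polys n" by (rule polysI[of _ "\<lambda>_. 0"]) simp
next
  fix f g :: "'a ^ 'b \<Rightarrow> 'a" assume "f \<in> polys n" "g \<in> polys n"
  then obtain c d where "\<And>x. f x = (\<Sum>a\<in>Exps UNIV n. c a * xpow a x)"
    "\<And>x. g x = (\<Sum>a\<in>Exps UNIV n. d a * xpow a x)" by (auto simp: polys_def)
  then show "f + g \<in> polys n"
    by (intro polysI[of _ "\<lambda>a. c a + d a"]) (simp add: sum.distrib algebra_simps)
next
  fix r and f :: "'a ^ 'b \<Rightarrow> 'a" assume "f \<in> polys n"
  then obtain c where "\<And>x. f x = (\<Sum>a\<in>Exps UNIV n. c a * xpow a x)" by (auto simp: polys_def)
  then show "fscale r f \<in> polys n"
    by (intro polysI[of _ "\<lambda>a. r * c a"]) (simp add: fscale_apply sum_distrib_left algebra_simps)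
qed

lemma polys_add: "f \<in> polys n \<Longrightarrow> g \<in> polys n \<Longrightarrow> (\<lambda>x. f x + g x) \<in> polys n"
  using fs.subspace_add[OF polys_subspace, of f n g] by (simp add: plus_fun_def)

lemma polys_scale: "f \<in> polys n \<Longrightarrow> (\<lambda>x. r * f x) \<in> polys n"
  using fs.subspace_scale[OF polys_subspace, of f n r] by (simp add: fscale_def)

lemma polys_sum: "(\<And>i. i \<in> I \<Longrightarrow> f i \<in> polys n) \<Longrightarrow> (\<lambda>x. \<Sum>i\<in>I. f i x) \<in> polys n"
proof (induction I rule: infinite_finite_induct)
  case (insert i I)
  then show ?case using polys_add[of "f i" n "\<lambda>x. \<Sum>i\<in>I. f i x"] by simp
qed (use fs.subspace_0[OF polys_subspace] in \<open>simp_all add: zero_fun_def\<close>)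

lemma xpow_in_polys: "deg a \<le> n \<Longrightarrow> xpow a \<in> polys n"
proof (rule polysI[of _ "\<lambda>b. if b = a then 1 else 0"])
  fix x assume "deg a \<le> n"
  then have "a \<in> Exps UNIV n" by (simp add: Exps_def)
  then show "xpow a x = (\<Sum>b\<in>Exps UNIV n. (if b = a then 1 else 0) * xpow b x)"
    by (simp add: if_distrib[of "\<lambda>u. u * _"] cong: if_cong)
qed

lemma polys_mono: 
  assumes "m \<le> n" shows "polys m \<subseteq> polys n"
proof
  fix f :: "'a ^ 'b \<Rightarrow> 'a" assume "f \<in> polys m"
  then obtain c where "\<And>x. f x = (\<Sum>a\<in>Exps UNIV m. c a * xpow a x)" by (auto simp: polys_def)
  then have "f = (\<lambda>x. \<Sum>a\<in>Exps UNIV m. c a * xpow a x)" by auto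
  also have "\<dots> \<in> polys n"
    by (intro polys_sum polys_scale xpow_in_polys) (use assms in \<open>auto simp: Exps_def\<close>)
  finally show "f \<in> polys n" .
qed

lemma polys_mult:
  assumes "f \<in> polys m" "g \<in> polys n"
  shows "(\<lambda>x. f x * g x) \<in> polys (m + n)"
proof -
  obtain c d where c: "\<And>x. f x = (\<Sum>a\<in>Exps UNIV m. c a * xpow a x)"
    and d: "\<And>x. g x = (\<Sum>b\<in>Exps UNIV n. d b * xpow b x)" using assms by (auto simp: polys_def)
  have "(\<lambda>x. f x * g x) = (\<lambda>x. \<Sum>a\<in>Exps UNIV m. \<Sum>b\<in>Exps UNIV n. (c a * d b) * xpow (\<lambda>j. a j + b j) x)"
    by (simp add: c d sum_product xpow_add algebra_simps)
  also have "\<dots> \<in> polys (m + n)"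
    by (intro polys_sum polys_scale xpow_in_polys) (auto simp: Exps_def)
  finally show ?thesis .
qed

lemma polys_const: "(\<lambda>x. r) \<in> polys n"
  using polys_scale[OF xpow_in_polys[of "\<lambda>j. 0" n], of r] by (simp add: deg_def)

lemma polys_coord: "(\<lambda>x :: 'k::field ^ 'n::finite. x $ j) \<in> polys 1"
proof -
  have "xpow (\<lambda>i. if i = j then 1 else 0) = (\<lambda>x :: 'k ^ 'n. x $ j)"
    by (simp add: fun_eq_iff xpow_def if_distrib[of "power _"] cong: if_cong)
  moreover have "xpow (\<lambda>i. if i = j then 1 else 0) \<in> (polys 1 :: ('k ^ 'n \<Rightarrow> 'k) set)"
    by (rule xpow_in_polys) (simp add: deg_def)
  ultimately show ?thesis by simp
qed

lemma polys_power: "f \<in> polys m \<Longrightarrow> (\<lambda>x. f x ^ k) \<in> polys (m * k)"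
proof (induction k)
  case 0 then show ?case using polys_const[of 1] by simp
next
  case (Suc k) then show ?case using polys_mult[of f m "\<lambda>x. f x ^ k"] by simp
qed

lemma polys_prod: "finite I \<Longrightarrow> (\<And>i. i \<in> I \<Longrightarrow> f i \<in> polys (m i)) \<Longrightarrow> (\<lambda>x. \<Prod>i\<in>I. f i x) \<in> polys (\<Sum>i\<in>I. m i)"
proof (induction I rule: finite_induct)
  case (insert i I)
  then show ?case using polys_mult[of "f i" "m i" "\<lambda>x. \<Prod>i\<in>I. f i x"] by simp
qed (simp add: polys_const)

lemma polys_affine_comp:
  fixes M :: "'k::field ^ 'n::finite ^ 'n"
  assumes "f \<in> polys n"
  shows "(\<lambda>x. f (M *v x + b)) \<in> polys n"
proof -
  obtain c where c: "\<And>x. f x = (\<Sum>a\<in>Exps UNIV n. c a * xpow a x)" using assms by (auto simp: polys_def)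
  have lin: "(\<lambda>x. (M *v x + b) $ j) \<in> polys 1" for j
  proof -
    have "(\<lambda>x. (\<Sum>i\<in>UNIV. M $ j $ i * x $ i) + b $ j) \<in> polys 1"
      by (intro polys_add polys_sum polys_scale polys_coord polys_const)
    then show ?thesis by (simp add: matrix_vector_mult_def)
  qed
  have "(\<lambda>x. xpow a (M *v x + b)) \<in> polys n" if "a \<in> Exps UNIV n" for a
  proof -
    have "(\<lambda>x. \<Prod>j\<in>UNIV. ((M *v x + b) $ j) ^ a j) \<in> polys (\<Sum>j\<in>UNIV. 1 * a j)"
      by (intro polys_prod polys_power lin) simp
    then show ?thesis using that polys_mono[of "deg a" n]
      by (auto simp: xpow_def deg_def Exps_def)
  qed
  then have "(\<lambda>x. \<Sum>a\<in>Exps UNIV n. c a * xpow a (M *v x + b)) \<in> polys n"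
    by (intro polys_sum polys_scale)
  then show ?thesis by (simp add: c)
qed

text \<open>Kronecker substitution: writing the exponents in base \<open>N + 1\<close> turns a polynomial of degree at
  most \<open>N\<close> into a univariate one and orders its monomials compatibly with multiplication.\<close>

definition index :: "'n::finite \<Rightarrow> nat" where
  "index = (SOME f. bij_betw f UNIV {..<CARD('n)})"

lemma bij_index: "bij_betw (index :: 'n::finite \<Rightarrow> nat) UNIV {..<CARD('n)}"
proof -
  have "\<exists>f. bij_betw f (UNIV :: 'n set) {..<CARD('n)}"
    by (rule finite_same_card_bij) simp_all
  then show ?thesis unfolding index_def by (rule someI_ex)
qed

lemma inj_index: "inj (index :: 'n::finite \<Rightarrow> nat)"
  using bij_index bij_betw_imp_inj_on by blast

definition key :: "nat \<Rightarrow> ('n::finite \<Rightarrow> nat) \<Rightarrow> nat" where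
  "key N a = (\<Sum>j\<in>UNIV. a j * (N + 1) ^ index j)"

lemma key_add: "key N (\<lambda>j. a j + b j) = key N a + key N b"
  by (simp add: key_def sum.distrib algebra_simps)

lemma digits_unique:
  fixes a b :: "nat \<Rightarrow> nat"
  assumes "\<And>i. a i < B" "\<And>i. b i < B" "(\<Sum>i<m. a i * B ^ i) = (\<Sum>i<m. b i * B ^ i)" "i < m"
  shows "a i = b i"
  using assms
proof (induction m arbitrary: a b i)
  case (Suc m)
  have eq: "(\<Sum>i<Suc m. c i * B ^ i) = c 0 + B * (\<Sum>i<m. c (Suc i) * B ^ i)" for c
    by (subst sum.lessThan_Suc_shift) (simp add: sum_distrib_left algebra_simps)
  have h: "a 0 + B * (\<Sum>i<m. a (Suc i) * B ^ i) = b 0 + B * (\<Sum>i<m. b (Suc i) * B ^ i)"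
    using Suc.prems(3) eq by simp
  then have "(a 0 + B * (\<Sum>i<m. a (Suc i) * B ^ i)) mod B = (b 0 + B * (\<Sum>i<m. b (Suc i) * B ^ i)) mod B"
    by (rule arg_cong)
  then have "a 0 mod B = b 0 mod B" by (simp only: mod_mult_self2)
  then have 0: "a 0 = b 0" using Suc.prems(1,2) by simp
  moreover have "B > 0" using Suc.prems(1)[of 0] by linarith
  ultimately have "(\<Sum>i<m. a (Suc i) * B ^ i) = (\<Sum>i<m. b (Suc i) * B ^ i)" using h by simp
  then have "a (Suc i) = b (Suc i)" if "i < m" for i
    using Suc.IH[of "\<lambda>i. a (Suc i)" "\<lambda>i. b (Suc i)" i] Suc.prems(1,2) that by blast
  then show ?case using 0 Suc.prems(4) by (cases i) auto
qed simp

lemma inj_on_key: "inj_on (key N) (Exps S N :: ('n::finite \<Rightarrow> nat) set)"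
proof (rule inj_onI)
  fix a b :: "'n \<Rightarrow> nat" assume ab: "a \<in> Exps S N" "b \<in> Exps S N" "key N a = key N b"
  obtain m where m: "index j < m" for j :: 'n
    using finite_nat_set_iff_bounded[of "range (index :: 'n \<Rightarrow> nat)"] by auto
  define d where "d = (\<lambda>(a :: 'n \<Rightarrow> nat) i. if i \<in> range (index :: 'n \<Rightarrow> nat) then a (inv index i) else 0)"
  have sum: "(\<Sum>i<m. d a i * (N + 1) ^ i) = key N a" for a
  proof -
    have "(\<Sum>i<m. d a i * (N + 1) ^ i) = (\<Sum>i\<in>range (index :: 'n \<Rightarrow> nat). d a i * (N + 1) ^ i)"
      using m by (intro sum.mono_neutral_right) (auto simp: d_def)
    also have "\<dots> = key N a"
      using inj_index by (subst sum.reindex) (auto simp: key_def d_def)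
    finally show ?thesis .
  qed
  have lt: "d a i < N + 1" if "a \<in> Exps S N" for a i
    using that deg_component_le[of a] order_trans by (fastforce simp: d_def Exps_def less_Suc_eq_le)
  show "a = b"
  proof
    fix j :: 'n
    have "d a (index j) = d b (index j)"
    proof (rule digits_unique[where a = "d a" and b = "d b" and B = "N + 1" and m = m])
      show "d a i < N + 1" for i by (rule lt[OF ab(1)])
      show "d b i < N + 1" for i by (rule lt[OF ab(2)])
      show "(\<Sum>i<m. d a i * (N + 1) ^ i) = (\<Sum>i<m. d b i * (N + 1) ^ i)"
        unfolding sum by (rule ab(3))
    qed (rule m)
    then show "a j = b j" by (simp add: d_def inv_f_f[OF inj_index])
  qed
qed

section \<open>Coefficients of polynomial functions over an infinite field\<close>

lemma poly_all_zero:
  fixes p :: "'k::field poly"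
  assumes "infinite (UNIV :: 'k set)" "\<And>t. poly p t = 0"
  shows "p = 0"
  using poly_roots_finite[of p] assms by auto

lemma poly_all_eq:
  fixes p q :: "'k::field poly"
  assumes "infinite (UNIV :: 'k set)" "\<And>t. poly p t = poly q t"
  shows "p = q"
  using poly_all_zero[of "p - q"] assms by simp

text \<open>Substituting t^((n+1)^index j) for the coordinates j in S sends the monomial a to t^(key
  n a). Distinct exponents have distinct keys, so nothing can cancel in the resulting univariate
  polynomial, which vanishes on an infinite field.\<close>

lemma Exps_coeff_zero:
  fixes c :: "('n::finite \<Rightarrow> nat) \<Rightarrow> 'k::field"
  assumes inf: "infinite (UNIV :: 'k set)"
    and zero: "\<And>x. x \<in> coords S \<Longrightarrow> (\<Sum>a\<in>Exps S n. c a * xpow a x) = 0" and a: "a \<in> Exps S n"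
  shows "c a = 0"
proof -
  define p where "p = (\<Sum>a\<in>Exps S n. monom (c a) (key n a))"
  have "poly p t = 0" for t
  proof -
    define x :: "'k ^ 'n" where "x = (\<chi> j. if j \<in> S then t ^ ((n + 1) ^ index j) else 0)"
    have x: "x \<in> coords S" by (auto simp: x_def coords_def)
    have "xpow b x = t ^ key n b" if "b \<in> Exps S n" for b
    proof -
      have "xpow b x = (\<Prod>j\<in>UNIV. t ^ (b j * (n + 1) ^ index j))"
        unfolding xpow_def using that
        by (intro prod.cong) (auto simp: x_def Exps_def power_mult[symmetric] mult.commute)
      then show ?thesis by (simp add: key_def power_sum)
    qed
    then show ?thesis using zero[OF x] by (simp add: p_def poly_sum poly_monom)
  qed
  then have "p = 0" using inf by (rule poly_all_zero[rotated])
  then have "0 = coeff p (key n a)" by simp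
  also have "\<dots> = (\<Sum>b\<in>Exps S n. if b = a then c b else 0)"
    unfolding p_def coeff_sum using inj_on_key[of n S] a
    by (intro sum.cong) (auto simp: inj_on_def)
  finally show ?thesis using a by (simp add: sum.delta)
qed

section \<open>Vanishing orders on flats\<close>

text \<open>A chart at p that straightens F. Another coordinate set S can be used with the same A,
  so one joint tuple provides charts of the ambient space and of all its flats at once.\<close>

definition frame :: "('k::field ^ 'n::finite \<Rightarrow> 'k ^ 'n) \<Rightarrow> 'k ^ 'n \<Rightarrow> 'n set \<Rightarrow> ('k ^ 'n) set \<Rightarrow> bool" where
  "frame A p S F \<longleftrightarrow> invertible_affine A \<and> A 0 = p \<and> F = A ` coords S"

text \<open>Extension by zero: functions on different flats stay in one vector space, and equality
  on F becomes equality of functions.\<close>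

definition restr :: "'x set \<Rightarrow> ('x \<Rightarrow> 'k::zero) \<Rightarrow> 'x \<Rightarrow> 'k" where
  "restr F f = (\<lambda>x. if x \<in> F then f x else 0)"

definition flat_polys :: "('k::field ^ 'n::finite) set \<Rightarrow> nat \<Rightarrow> ('k ^ 'n \<Rightarrow> 'k) set" where
  "flat_polys F n = restr F ` polys n"

text \<open>The order of vanishing is tested on the lines through \<open>p\<close>, so that it does not refer to
  coordinates on the flat.\<close>

definition vanishes :: "('k::field ^ 'n::finite) set \<Rightarrow> 'k ^ 'n \<Rightarrow> nat \<Rightarrow> ('k ^ 'n \<Rightarrow> 'k) \<Rightarrow> bool" where
  "vanishes F p m g \<longleftrightarrow>
     (\<forall>v. p + v \<in> F \<longrightarrow> (\<exists>G. (\<forall>t. g (p + t *s v) = poly G t) \<and> monom 1 m dvd G))"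

text \<open>Over an infinite field the coefficients are unique (\<open>coef_unique\<close>). The
  value 0 outside \<open>Exps S n\<close> lets \<open>slice\<close> add exponents without checking
  that the degree stays at most n.\<close>

definition coef :: "('k::field ^ 'n::finite \<Rightarrow> 'k ^ 'n) \<Rightarrow> 'n set \<Rightarrow> nat \<Rightarrow> ('k ^ 'n \<Rightarrow> 'k) \<Rightarrow> ('n \<Rightarrow> nat) \<Rightarrow> 'k" where
  "coef A S n g = (SOME c. (\<forall>x\<in>coords S. g (A x) = (\<Sum>a\<in>Exps S n. c a * xpow a x)) \<and>
     (\<forall>a. a \<notin> Exps S n \<longrightarrow> c a = 0))"

text \<open>The pivots of Gaussian elimination on the coefficients of degree r, in the order of
  \<open>key\<close>. If V vanishes to order r at the centre of the chart, they count what order r +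
  1 costs.\<close>

definition lead :: "('k::field ^ 'n::finite \<Rightarrow> 'k ^ 'n) \<Rightarrow> 'n set \<Rightarrow> nat \<Rightarrow> ('k ^ 'n \<Rightarrow> 'k) set \<Rightarrow> nat \<Rightarrow> ('n \<Rightarrow> nat) set" where
  "lead A S n V r = {a \<in> {a \<in> Exps S n. deg a = r}. \<exists>g\<in>V. coef A S n g a \<noteq> 0 \<and>
     (\<forall>b\<in>{a \<in> Exps S n. deg a = r}. key n b < key n a \<longrightarrow> coef A S n g b = 0)}"

lemma coords_0 [simp]: "0 \<in> coords S"
  by (simp add: coords_def)

lemma coords_add: "x \<in> coords S \<Longrightarrow> y \<in> coords S \<Longrightarrow> x + y \<in> coords S"
  by (simp add: coords_def)

lemma coords_diff: "x \<in> coords S \<Longrightarrow> y \<in> coords S \<Longrightarrow> x - y \<in> coords S"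
  by (simp add: coords_def)

lemma coords_scale: "x \<in> coords S \<Longrightarrow> t *s x \<in> coords S"
  by (simp add: coords_def)

lemma coords_UNIV [simp]: "coords UNIV = UNIV"
  by (simp add: coords_def)

lemma matrix_vector_mult_scale: "M *v (t *s x) = t *s (M *v x)" for M :: "'k::field ^ 'n ^ 'm"
  by (simp add: vec_eq_iff matrix_vector_mult_def sum_distrib_left algebra_simps)

lemma frameE:
  fixes A :: "'k::field ^ 'n::finite \<Rightarrow> 'k ^ 'n"
  assumes "frame A p S F"
  obtains M M' where "\<And>x. A x = M *v x + p" "\<And>x. M' *v (M *v x) = x" "\<And>x. M *v (M' *v x) = x"
    "F = A ` coords S" "p \<in> F"
proof -
  obtain M b where M: "invertible M" "A = (\<lambda>x. M *v x + b)"
    using assms by (auto simp: frame_def invertible_affine_def)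
  obtain M' where "M ** M' = mat 1" "M' ** M = mat 1" using M(1) by (auto simp: invertible_def)
  then have "M' *v (M *v x) = x" "M *v (M' *v x) = x" for x
    by (simp_all add: matrix_vector_mul_assoc)
  moreover have "b = p" using assms M(2) by (simp add: frame_def)
  moreover have "p \<in> F" "F = A ` coords S" using assms by (auto simp: frame_def)
  ultimately show ?thesis using that[of M M'] M(2) by auto
qed

lemma frame_at:
  fixes A :: "'k::field ^ 'n::finite \<Rightarrow> 'k ^ 'n"
  assumes "frame A p S F" "q \<in> F"
  shows "\<exists>B. frame B q S F"
proof -
  obtain M M' where A: "\<And>x. A x = M *v x + p" "F = A ` coords S"
    using frameE[OF assms(1)] by metis
  obtain y where y: "y \<in> coords S" "q = A y" using assms(2) A(2) by auto
  let ?B = "\<lambda>x. A (x + y)"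
  have "A ` coords S = ?B ` coords S"
  proof -
    have "(\<lambda>x. x + y) ` coords S = coords S"
    proof (intro subset_antisym subsetI)
      fix x :: "'k ^ 'n" assume "x \<in> coords S"
      then show "x \<in> (\<lambda>x. x + y) ` coords S"
        using coords_diff[OF _ y(1), of x] by (intro image_eqI[of _ _ "x - y"]) auto
    qed (use coords_add y in auto)
    then show ?thesis by (metis image_image)
  qed
  moreover have "invertible_affine ?B"
  proof -
    obtain M b where "invertible M" "A = (\<lambda>x. M *v x + b)"
      using assms by (auto simp: frame_def invertible_affine_def)
    then have "?B = (\<lambda>x. M *v x + (M *v y + b))" by (simp add: matrix_vector_right_distrib algebra_simps)
    then show ?thesis using \<open>invertible M\<close> unfolding invertible_affine_def by blast
  qed
  ultimately have "frame ?B q S F" using A y by (simp add: frame_def)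
  then show ?thesis by blast
qed

lemma frame_line:
  assumes "frame A p S F" "p + v \<in> F"
  shows "p + t *s v \<in> F"
proof -
  obtain M M' where A: "\<And>x. A x = M *v x + p" "F = A ` coords S"
    using frameE[OF assms(1)] by metis
  obtain x where x: "x \<in> coords S" "p + v = A x" using assms A by auto
  then have "v = M *v x" using A by (simp add: add.commute)
  then have "p + t *s v = A (t *s x)" using A by (simp add: matrix_vector_mult_scale add.commute)
  then show ?thesis using A x coords_scale by blast
qed

lemma frame_affine:
  fixes A :: "'k::field ^ 'n::finite \<Rightarrow> 'k ^ 'n"
  assumes "invertible_affine A"
  shows "frame A (A 0) UNIV UNIV"
proof -
  obtain M b where "invertible M" and A: "A = (\<lambda>x. M *v x + b)"
    using assms by (auto simp: invertible_affine_def)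
  then obtain M' where "M ** M' = mat 1" by (auto simp: invertible_def)
  then have "A (M' *v (x - b)) = x" for x
    using A by (simp add: matrix_vector_mul_assoc)
  then have "surj A" by (rule surjI)
  then show ?thesis using assms by (simp add: frame_def)
qed

lemma frame_UNIV: "frame (\<lambda>x. x + p) p UNIV UNIV"
proof -
  have "invertible_affine (\<lambda>x. x + p)"
    unfolding invertible_affine_def
    by (intro exI[of _ "mat 1"] exI[of _ p]) (simp add: invertible_def exI[of _ "mat 1"])
  then show ?thesis using frame_affine[of "\<lambda>x. x + p"] by simp
qed

section \<open>Restriction to lines and orders of vanishing\<close>

lemma polys_line:
  assumes "f \<in> polys n"
  obtains G where "\<And>t. f (p + t *s v) = poly G t"
proof -
  obtain c where c: "\<And>x. f x = (\<Sum>a\<in>Exps UNIV n. c a * xpow a x)" using assms by (auto simp: polys_def)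
  show ?thesis
    by (rule that[of "\<Sum>a\<in>Exps UNIV n. smult (c a) (\<Prod>j\<in>UNIV. [:p $ j, v $ j:] ^ a j)"])
      (simp add: c xpow_def poly_sum poly_prod poly_power)
qed

lemma vanishes_mono: "vanishes F p m g \<Longrightarrow> m' \<le> m \<Longrightarrow> vanishes F p m' g"
  unfolding vanishes_def monom_1_dvd_iff' by (meson order_less_le_trans)

lemma vanishes_add: 
  assumes "vanishes F p m f" "vanishes F p m g" shows "vanishes F p m (f + g)"
  unfolding vanishes_def
proof (intro allI impI)
  fix v assume v: "p + v \<in> F"
  obtain G H where "\<forall>t. f (p + t *s v) = poly G t" "monom 1 m dvd G" "\<forall>t. g (p + t *s v) = poly H t" "monom 1 m dvd H"
    using assms v unfolding vanishes_def by metis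
  then show "\<exists>G. (\<forall>t. (f + g) (p + t *s v) = poly G t) \<and> monom 1 m dvd G"
    by (intro exI[of _ "G + H"]) simp
qed

lemma vanishes_mult: 
  assumes "vanishes F p m f" "vanishes F p m' g" shows "vanishes F p (m + m') (\<lambda>x. f x * g x)"
  unfolding vanishes_def
proof (intro allI impI)
  fix v assume v: "p + v \<in> F"
  obtain G H where "\<forall>t. f (p + t *s v) = poly G t" "monom 1 m dvd G" "\<forall>t. g (p + t *s v) = poly H t" "monom 1 m' dvd H"
    using assms v unfolding vanishes_def by metis
  moreover have "monom 1 (m + m') = monom 1 m * (monom 1 m' :: 'a poly)" by (simp add: mult_monom)
  ultimately show "\<exists>G. (\<forall>t. f (p + t *s v) * g (p + t *s v) = poly G t) \<and> monom 1 (m + m') dvd G"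
    by (intro exI[of _ "G * H"]) (simp add: mult_dvd_mono)
qed

lemma vanishes_polys_0:
  assumes "f \<in> polys n" shows "vanishes F p 0 f"
  unfolding vanishes_def
proof (intro allI impI)
  fix v
  obtain G where "\<And>t. f (p + t *s v) = poly G t" using polys_line[OF assms] by blast
  then show "\<exists>G. (\<forall>t. f (p + t *s v) = poly G t) \<and> monom 1 0 dvd G"
    by (intro exI[of _ G]) (simp add: monom_1_dvd_iff')
qed

lemma vanishes_scale: "vanishes F p m f \<Longrightarrow> vanishes F p m (fscale c f)"
  using vanishes_mult[OF vanishes_polys_0[OF polys_const]] by (simp add: fscale_def)

lemma vanishes_polys_1:
  assumes "f \<in> polys n" "f p = 0" shows "vanishes F p 1 f"
  unfolding vanishes_def
proof (intro allI impI)
  fix v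
  obtain G where G: "\<And>t. f (p + t *s v) = poly G t" using polys_line[OF assms(1)] by blast
  have "coeff G 0 = 0" using G[of 0] assms(2) by (simp add: poly_0_coeff_0)
  then show "\<exists>G. (\<forall>t. f (p + t *s v) = poly G t) \<and> monom 1 1 dvd G"
    using G by (intro exI[of _ G]) (simp add: monom_1_dvd_iff')
qed

lemma vanishes_cong:
  assumes "frame A p S F" "\<And>x. x \<in> F \<Longrightarrow> f x = g x"
  shows "vanishes F p m f \<longleftrightarrow> vanishes F p m g"
  unfolding vanishes_def using assms(2) frame_line[OF assms(1)] by simp

lemma flat_polys_subspace: "fs.subspace (flat_polys F n)"
  unfolding fs.subspace_def
proof (intro conjI ballI allI)
  have "0 = restr F (0 :: 'a ^ 'b \<Rightarrow> 'a)" by (auto simp: restr_def fun_eq_iff)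
  then show "0 \<in> flat_polys F n"
    using fs.subspace_0[OF polys_subspace] unfolding flat_polys_def by blast
next
  fix f g assume "f \<in> flat_polys F n" "g \<in> flat_polys F n"
  then obtain f' g' where "f = restr F f'" "g = restr F g'" "f' \<in> polys n" "g' \<in> polys n"
    by (auto simp: flat_polys_def)
  moreover have "restr F f' + restr F g' = restr F (f' + g')" by (auto simp: restr_def fun_eq_iff)
  ultimately show "f + g \<in> flat_polys F n"
    using fs.subspace_add[OF polys_subspace] by (auto simp: flat_polys_def)
next
  fix c f assume "f \<in> flat_polys F n"
  then obtain f' where "f = restr F f'" "f' \<in> polys n" by (auto simp: flat_polys_def)
  moreover have "fscale c (restr F f') = restr F (fscale c f')" by (auto simp: restr_def fun_eq_iff fscale_apply)
  ultimately show "fscale c f \<in> flat_polys F n"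
    using fs.subspace_scale[OF polys_subspace] by (auto simp: flat_polys_def)
qed

lemma flat_polys_mono: "m \<le> n \<Longrightarrow> flat_polys F m \<subseteq> flat_polys F n"
  using polys_mono by (auto simp: flat_polys_def)

lemma findim_flat_polys: "findim (flat_polys F n)"
proof -
  have "flat_polys F n \<subseteq> fs.span ((\<lambda>a. restr F (xpow a)) ` Exps UNIV n)"
  proof
    fix g :: "'a ^ 'b \<Rightarrow> 'a" assume "g \<in> flat_polys F n"
    then obtain f c where "g = restr F f" "\<And>x. f x = (\<Sum>a\<in>Exps UNIV n. c a * xpow a x)"
      by (auto simp: flat_polys_def polys_def)
    then have *: "g = restr F (\<lambda>x. \<Sum>a\<in>Exps UNIV n. c a * xpow a x)" by (auto simp: restr_def fun_eq_iff)
    then have "g = (\<Sum>a\<in>Exps UNIV n. fscale (c a) (restr F (xpow a)))"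
    proof -
      have "(\<Sum>a\<in>I. fscale (c a) (restr F (xpow a))) = restr F (\<lambda>x. \<Sum>a\<in>I. c a * xpow a x)" if "finite I" for I
        using that by (induction I rule: finite_induct) (auto simp: restr_def fun_eq_iff fscale_apply)
      then show ?thesis using * by simp
    qed
    also have "\<dots> \<in> fs.span ((\<lambda>a. restr F (xpow a)) ` Exps UNIV n)"
      by (intro fs.span_sum fs.span_scale fs.span_base) auto
    finally show "g \<in> fs.span ((\<lambda>a. restr F (xpow a)) ` Exps UNIV n)" .
  qed
  then show ?thesis unfolding findim_def by (intro exI[of _ "(\<lambda>a. restr F (xpow a)) ` Exps UNIV n"]) simp
qed

section \<open>Coefficients and leading exponents in a chart\<close>

lemma coef_exists:
  fixes A :: "'k::field ^ 'n::finite \<Rightarrow> 'k ^ 'n"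
  assumes fr: "frame A p S F" and g: "g \<in> flat_polys F n"
  shows "\<exists>c. (\<forall>x\<in>coords S. g (A x) = (\<Sum>a\<in>Exps S n. c a * xpow a x)) \<and> (\<forall>a. a \<notin> Exps S n \<longrightarrow> c a = 0)"
proof -
  obtain M M' where A: "\<And>x. A x = M *v x + p" "F = A ` coords S"
    using frameE[OF fr] by metis
  obtain f where f: "g = restr F f" "f \<in> polys n" using g by (auto simp: flat_polys_def)
  have "(\<lambda>x. f (A x)) \<in> polys n" using polys_affine_comp[OF f(2)] A(1) by simp
  then obtain c where c: "\<And>x. f (A x) = (\<Sum>a\<in>Exps UNIV n. c a * xpow a x)" by (auto simp: polys_def)
  have "g (A x) = (\<Sum>a\<in>Exps S n. (if a \<in> Exps S n then c a else 0) * xpow a x)" if x: "x \<in> coords S" for x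
  proof -
    have "g (A x) = (\<Sum>a\<in>Exps UNIV n. c a * xpow a x)" using f x A(2) c by (simp add: restr_def)
    also have "\<dots> = (\<Sum>a\<in>Exps S n. c a * xpow a x)"
      using xpow_coords_eq_0[OF x] by (intro sum.mono_neutral_right) (simp, force simp: Exps_def, force simp: Exps_def)
    finally show ?thesis by simp
  qed
  then show ?thesis by (intro exI[of _ "\<lambda>a. if a \<in> Exps S n then c a else 0"]) auto
qed

lemma coef:
  assumes "frame A p S F" and "g \<in> flat_polys F n"
  shows "x \<in> coords S \<Longrightarrow> g (A x) = (\<Sum>a\<in>Exps S n. coef A S n g a * xpow a x)"
    and "a \<notin> Exps S n \<Longrightarrow> coef A S n g a = 0"
  using someI_ex[OF coef_exists[OF assms]] unfolding coef_def by blast+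

context
  assumes inf: "infinite (UNIV :: 'k::field set)"
begin

lemma coef_unique:
  fixes A :: "'k ^ 'n::finite \<Rightarrow> 'k ^ 'n"
  assumes "frame A p S F" "g \<in> flat_polys F n"
    and "\<And>x. x \<in> coords S \<Longrightarrow> g (A x) = (\<Sum>a\<in>Exps S n. c a * xpow a x)" and "a \<in> Exps S n"
  shows "coef A S n g a = c a"
proof -
  have "coef A S n g a - c a = 0"
    by (rule Exps_coeff_zero[OF inf _ assms(4), of "\<lambda>a. coef A S n g a - c a"])
      (use coef(1)[OF assms(1,2)] assms(3) in \<open>simp add: left_diff_distrib sum_subtractf\<close>)
  then show ?thesis by simp
qed

lemma coef_add:
  fixes A :: "'k ^ 'n::finite \<Rightarrow> 'k ^ 'n"
  assumes "frame A p S F" "f \<in> flat_polys F n" "g \<in> flat_polys F n"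
  shows "coef A S n (f + g) a = coef A S n f a + coef A S n g a"
proof (cases "a \<in> Exps S n")
  case True
  show ?thesis
    by (rule coef_unique[OF assms(1) fs.subspace_add[OF flat_polys_subspace assms(2,3)] _ True,
        where c = "\<lambda>a. coef A S n f a + coef A S n g a"])
      (simp add: coef(1)[OF assms(1,2)] coef(1)[OF assms(1,3)] sum.distrib distrib_right)
qed (use assms coef(2) fs.subspace_add[OF flat_polys_subspace] in \<open>metis add_0\<close>)

lemma coef_scale:
  fixes A :: "'k ^ 'n::finite \<Rightarrow> 'k ^ 'n"
  assumes "frame A p S F" "f \<in> flat_polys F n"
  shows "coef A S n (fscale r f) a = r * coef A S n f a"
proof (cases "a \<in> Exps S n")
  case True
  show ?thesis
    by (rule coef_unique[OF assms(1) fs.subspace_scale[OF flat_polys_subspace assms(2)] _ True,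
        where c = "\<lambda>a. r * coef A S n f a"])
      (simp add: coef(1)[OF assms(1,2)] fscale_apply sum_distrib_left mult.assoc)
qed (use assms coef(2) fs.subspace_scale[OF flat_polys_subspace] in \<open>metis mult_zero_right\<close>)

text \<open>On the line in direction M x the coefficient of t^r is the homogeneous part of degree r
  evaluated at x. It vanishes for all x in \<open>coords S\<close> exactly if all coefficients of
  degree r are 0.\<close>

lemma vanishes_iff_coef:
  fixes A :: "'k ^ 'n::finite \<Rightarrow> 'k ^ 'n"
  assumes fr: "frame A p S F" and g: "g \<in> flat_polys F n"
  shows "vanishes F p m g \<longleftrightarrow> (\<forall>a\<in>Exps S n. deg a < m \<longrightarrow> coef A S n g a = 0)"
proof -
  obtain M M' where A: "\<And>x. A x = M *v x + p" "F = A ` coords S"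
    using frameE[OF fr] by metis
  define G where "G = (\<lambda>x. \<Sum>a\<in>Exps S n. monom (coef A S n g a * xpow a x) (deg a))"
  have G: "g (p + t *s (M *v x)) = poly (G x) t" if "x \<in> coords S" for x t
  proof -
    have "p + t *s (M *v x) = A (t *s x)" by (simp add: A matrix_vector_mult_scale add.commute)
    then show ?thesis using coef(1)[OF fr g coords_scale[OF that]]
      by (simp add: G_def poly_sum poly_monom xpow_scale algebra_simps)
  qed
  have dir: "p + v \<in> F \<longleftrightarrow> (\<exists>x\<in>coords S. v = M *v x)" for v
    using A by (auto simp: add.commute)
  have "vanishes F p m g \<longleftrightarrow> (\<forall>x\<in>coords S. monom 1 m dvd G x)"
  proof
    assume v: "vanishes F p m g"
    show "\<forall>x\<in>coords S. monom 1 m dvd G x"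
    proof
      fix x :: "'k ^ 'n" assume x: "x \<in> coords S"
      then obtain H where H: "\<forall>t. g (p + t *s (M *v x)) = poly H t" "monom 1 m dvd H"
        using v dir unfolding vanishes_def by blast
      have "H = G x" using H(1) G[OF x] by (intro poly_all_eq[OF inf]) simp
      then show "monom 1 m dvd G x" using H by simp
    qed
  next
    assume *: "\<forall>x\<in>coords S. monom 1 m dvd G x"
    show "vanishes F p m g" unfolding vanishes_def
    proof (intro allI impI)
      fix v assume "p + v \<in> F"
      then obtain x where "x \<in> coords S" "v = M *v x" using dir by blast
      then show "\<exists>G. (\<forall>t. g (p + t *s v) = poly G t) \<and> monom 1 m dvd G"
        using * G by (intro exI[of _ "G x"]) simp
    qed
  qed
  also have "\<dots> \<longleftrightarrow> (\<forall>a\<in>Exps S n. deg a < m \<longrightarrow> coef A S n g a = 0)"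
  proof
    assume dvd: "\<forall>x\<in>coords S. monom 1 m dvd G x"
    show "\<forall>a\<in>Exps S n. deg a < m \<longrightarrow> coef A S n g a = 0"
    proof (intro ballI impI)
      fix a :: "'n \<Rightarrow> nat" assume a: "a \<in> Exps S n" "deg a < m"
      have "(if deg a = deg a then coef A S n g a else 0) = 0"
      proof (rule Exps_coeff_zero[OF inf _ a(1), where c = "\<lambda>b. if deg b = deg a then coef A S n g b else 0"])
        fix x :: "'k ^ 'n" assume "x \<in> coords S"
        then have "coeff (G x) (deg a) = 0" using dvd a(2) by (simp add: monom_1_dvd_iff')
        then show "(\<Sum>b\<in>Exps S n. (if deg b = deg a then coef A S n g b else 0) * xpow b x) = 0"
          by (simp add: G_def coeff_sum if_distrib[of "\<lambda>u. u * _"] cong: if_cong)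
      qed
      then show "coef A S n g a = 0" by simp
    qed
  next
    assume *: "\<forall>a\<in>Exps S n. deg a < m \<longrightarrow> coef A S n g a = 0"
    show "\<forall>x\<in>coords S. monom 1 m dvd G x"
      unfolding G_def
    proof (intro ballI dvd_sum)
      fix x :: "'k ^ 'n" and a :: "'n \<Rightarrow> nat" assume "a \<in> Exps S n"
      then show "monom 1 m dvd monom (coef A S n g a * xpow a x) (deg a)"
        using * by (cases "deg a < m") (auto simp: monom_1_dvd_iff')
    qed
  qed
  finally show ?thesis .
qed

lemma dim_lead:
  fixes A :: "'k ^ 'n::finite \<Rightarrow> 'k ^ 'n"
  assumes fr: "frame A p S F" and V: "fs.subspace V" "V \<subseteq> flat_polys F n"
    and van: "\<And>g. g \<in> V \<Longrightarrow> vanishes F p r g"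
  shows "fs.dim V = fs.dim {g \<in> V. vanishes F p (Suc r) g} + card (lead A S n V r)"
proof -
  let ?I = "{a \<in> Exps S n. deg a = r}"
  have "{g \<in> V. vanishes F p (Suc r) g} = {g \<in> V. \<forall>a\<in>?I. coef A S n g a = 0}"
  proof (rule Collect_cong, rule conj_cong[OF refl])
    fix g assume g: "g \<in> V"
    have "\<forall>a\<in>Exps S n. deg a < r \<longrightarrow> coef A S n g a = 0"
      using van[OF g] vanishes_iff_coef[OF fr] g V(2) by blast
    then show "vanishes F p (Suc r) g \<longleftrightarrow> (\<forall>a\<in>?I. coef A S n g a = 0)"
      using vanishes_iff_coef[OF fr, of g n "Suc r"] g V(2) by (auto simp: less_Suc_eq)
  qed
  moreover have "inj_on (key n) ?I" by (rule inj_on_subset[OF inj_on_key]) auto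
  ultimately show ?thesis
    using dim_leading[OF findim_subset[OF findim_flat_polys V(2)] V(1), of ?I "\<lambda>a g. coef A S n g a" "key n"]
      coef_add[OF fr] coef_scale[OF fr] V(2)
    by (simp add: lead_def subset_iff)
qed

lemma flat_polys_coef_zero:
  fixes A :: "'k ^ 'n::finite \<Rightarrow> 'k ^ 'n"
  assumes fr: "frame A p S F" and g: "g \<in> flat_polys F n" and "\<And>a. a \<in> Exps S n \<Longrightarrow> coef A S n g a = 0"
  shows "g = 0"
proof
  fix x
  obtain M M' where A: "F = A ` coords S"
    using frameE[OF fr] by metis
  show "g x = 0 x"
  proof (cases "x \<in> F")
    case True
    then show ?thesis using coef(1)[OF fr g] assms(3) A by auto
  qed (use g in \<open>auto simp: flat_polys_def restr_def\<close>)
qed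

lemma dim_flat_polys_le:
  fixes A :: "'k ^ 'n::finite \<Rightarrow> 'k ^ 'n"
  assumes fr: "frame A p S F"
  shows "fs.dim (flat_polys F n) \<le> (n + card S) choose card S"
proof -
  let ?V = "flat_polys F n"
  have "{g \<in> ?V. \<forall>a\<in>Exps S n. coef A S n g a = 0} = {0}"
  proof -
    have "coef A S n (fscale 0 0) a = 0 * coef A S n 0 a" for a
      by (rule coef_scale[OF fr fs.subspace_0[OF flat_polys_subspace]])
    then have "coef A S n 0 a = 0" for a by simp
    then show ?thesis using flat_polys_coef_zero[OF fr] fs.subspace_0[OF flat_polys_subspace] by auto
  qed
  moreover have "fs.dim ({0} :: ('k ^ 'n \<Rightarrow> 'k) set) = 0"
    using fs.dim_le_card[of "{0}" "{}"] by simp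
  moreover have "card {a \<in> Exps S n. \<exists>g\<in>?V. coef A S n g a \<noteq> 0 \<and>
      (\<forall>b\<in>Exps S n. key n b < key n a \<longrightarrow> coef A S n g b = 0)} \<le> card (Exps S n)"
    by (intro card_mono) auto
  ultimately show ?thesis
    using dim_leading[OF findim_flat_polys[of F n] flat_polys_subspace, of "Exps S n" "\<lambda>a g. coef A S n g a" "key n",
        OF _ _ finite_Exps inj_on_key]
      coef_add[OF fr] coef_scale[OF fr] by (simp add: card_Exps)
qed

text \<open>Every exponent is a pivot, witnessed by its own monomial, so the upper bound is
  attained.\<close>

lemma dim_flat_polys_UNIV:
  "fs.dim (flat_polys UNIV n :: ('k ^ 'n::finite \<Rightarrow> 'k) set) = (n + CARD('n)) choose CARD('n)"
proof -
  let ?V = "flat_polys UNIV n :: ('k ^ 'n \<Rightarrow> 'k) set" and ?A = "\<lambda>x :: 'k ^ 'n. x + 0"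
  let ?L = "{a \<in> Exps UNIV n. \<exists>g\<in>?V. coef ?A UNIV n g a \<noteq> 0 \<and>
    (\<forall>b\<in>Exps UNIV n. key n b < key n a \<longrightarrow> coef ?A UNIV n g b = 0)}"
  have fr: "frame ?A 0 UNIV UNIV" by (rule frame_UNIV)
  have "coef ?A UNIV n (xpow a) b = (if b = a then 1 else 0)" "xpow a \<in> ?V" if "a \<in> Exps UNIV n" "b \<in> Exps UNIV n" for a b
  proof -
    have "restr UNIV (xpow a) = (xpow a :: 'k ^ 'n \<Rightarrow> 'k)" by (simp add: restr_def)
    moreover have "xpow a \<in> polys n" using that by (simp add: Exps_def xpow_in_polys)
    ultimately show *: "xpow a \<in> ?V" unfolding flat_polys_def by (metis image_eqI)
    show "coef ?A UNIV n (xpow a) b = (if b = a then 1 else 0)"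
      by (rule coef_unique[OF fr * _ that(2), where c = "\<lambda>b. if b = a then 1 else 0"])
        (use that in \<open>simp add: if_distrib[of "\<lambda>u. u * _"] cong: if_cong\<close>)
  qed
  then have L: "?L = Exps UNIV n" by (auto intro!: bexI[of _ "xpow _"])
  have "fs.dim ?V = fs.dim {g \<in> ?V. \<forall>a\<in>Exps UNIV n. coef ?A UNIV n g a = 0} + card ?L"
    by (rule dim_leading[OF findim_flat_polys flat_polys_subspace])
      (use coef_add[OF fr] coef_scale[OF fr] inj_on_key in auto)
  then have "fs.dim ?V \<ge> (n + CARD('n)) choose CARD('n)" unfolding L by (simp add: card_Exps)
  with dim_flat_polys_le[OF fr, of n] show ?thesis by simp
qed

end

section \<open>Distributing the dimension over the points\<close>

definition van_space :: "('k::field ^ 'n::finite) set \<Rightarrow> nat \<Rightarrow> ('k ^ 'n) set \<Rightarrow> ('k ^ 'n \<Rightarrow> nat) \<Rightarrow> ('k ^ 'n \<Rightarrow> 'k) set" where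
  "van_space F n J m = {g \<in> flat_polys F n. \<forall>q\<in>J \<inter> F. vanishes F q (m q) g}"

definition jump :: "('k::field ^ 'n::finite) set \<Rightarrow> nat \<Rightarrow> ('k ^ 'n) set \<Rightarrow> ('k ^ 'n \<Rightarrow> nat) \<Rightarrow> 'k ^ 'n \<Rightarrow> nat" where
  "jump F n J m p = fs.dim (van_space F n J m) - fs.dim (van_space F n J (m(p := Suc (m p))))"

text \<open>Vanishing conditions are imposed in the order of \<open>r + \<beta> p\<close>, where \<open>r\<close> is the order of vanishing
  and \<open>\<beta> p\<close> a delay of the point \<open>p\<close>; \<open>r + \<beta> p - \<beta> q\<close> is a truncated difference.\<close>

definition mass :: "('k::field ^ 'n::finite) set \<Rightarrow> nat \<Rightarrow> ('k ^ 'n) set \<Rightarrow> ('k ^ 'n \<Rightarrow> nat) \<Rightarrow> 'k ^ 'n \<Rightarrow> nat" where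
  "mass F n J \<beta> p = (\<Sum>r\<le>n. jump F n J (\<lambda>q. r + \<beta> p - \<beta> q) p)"

text \<open>The leading exponents that \<open>mass\<close> counts, with the degree of the exponent
  in the role of r. The set depends on the chart; its size, \<open>mass\<close>, does not.\<close>

definition lead_set :: "('k::field ^ 'n::finite \<Rightarrow> 'k ^ 'n) \<Rightarrow> 'n set \<Rightarrow> nat \<Rightarrow> ('k ^ 'n) set \<Rightarrow> ('k ^ 'n \<Rightarrow> nat) \<Rightarrow> 'k ^ 'n \<Rightarrow> ('n \<Rightarrow> nat) set" where
  "lead_set A S n J \<beta> p = {a \<in> Exps S n.
     a \<in> lead A S n (van_space (A ` coords S) n J (\<lambda>q. deg a + \<beta> p - \<beta> q)) (deg a)}"

definition proj :: "'n set \<Rightarrow> ('n \<Rightarrow> nat) \<Rightarrow> 'n \<Rightarrow> nat" where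
  "proj T a = (\<lambda>j. if j \<in> T then a j else 0)"

lemma van_space_subset: "van_space F n J m \<subseteq> flat_polys F n"
  by (auto simp: van_space_def)

lemma vanishes_zero: "vanishes F p m 0"
  unfolding vanishes_def by (auto intro!: exI[of _ 0])

lemma van_space_subspace: "fs.subspace (van_space F n J m)"
  using flat_polys_subspace[of F n] vanishes_add vanishes_scale vanishes_zero
  unfolding van_space_def fs.subspace_def by blast

lemma findim_van_space: "findim (van_space F n J m)"
  by (rule findim_subset[OF findim_flat_polys van_space_subset])

lemma van_space_antimono:
  assumes "\<And>q. q \<in> J \<inter> F \<Longrightarrow> m q \<le> m' q"
  shows "van_space F n J m' \<subseteq> van_space F n J m"
  using assms vanishes_mono unfolding van_space_def by blast

lemma van_space_step:
  assumes "p \<in> J \<inter> F"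
  shows "van_space F n J (m(p := Suc (m p))) = {g \<in> van_space F n J m. vanishes F p (Suc (m p)) g}"
  using assms vanishes_mono[of F p "Suc (m p)" _ "m p"] by (auto simp: van_space_def)

lemma van_space_0:
  assumes "frame A p S F"
  shows "van_space F n J (\<lambda>_. 0) = flat_polys F n"
proof -
  have "vanishes F q 0 g" if q: "q \<in> F" and g: "g \<in> flat_polys F n" for q g
  proof -
    obtain f where f: "g = restr F f" "f \<in> polys n" using g by (auto simp: flat_polys_def)
    obtain B where "frame B q S F" using frame_at[OF assms q] by blast
    from vanishes_cong[OF this, of g f 0] show ?thesis
      using vanishes_polys_0[OF f(2)] f(1) by (simp add: restr_def)
  qed
  then show ?thesis by (auto simp: van_space_def)
qed

section \<open>Slices transversal to a flat and projection of leading exponents\<close>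

lemma xpow_disjoint_add:
  assumes "u \<in> coords S" "z \<in> coords (- S)" "\<And>j. j \<notin> S \<Longrightarrow> s j = 0" "\<And>j. j \<in> S \<Longrightarrow> b j = 0"
  shows "xpow (\<lambda>j. b j + s j) (u + z) = xpow b z * xpow s u"
  unfolding xpow_def prod.distrib[symmetric]
proof (rule prod.cong[OF refl])
  fix j
  show "(u + z) $ j ^ (b j + s j) = z $ j ^ b j * u $ j ^ s j"
    using assms by (cases "j \<in> S") (auto simp: coords_def)
qed

lemma sum_Exps_split:
  fixes c :: "('n::finite \<Rightarrow> nat) \<Rightarrow> 'k::field"
  assumes "u \<in> coords S" "z \<in> coords (- S)" "\<And>a. a \<notin> Exps UNIV n \<Longrightarrow> c a = 0"
  shows "(\<Sum>a\<in>Exps UNIV n. c a * xpow a (u + z)) =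
    (\<Sum>b\<in>Exps (- S) n. xpow b z * (\<Sum>s\<in>Exps S n. c (\<lambda>j. b j + s j) * xpow s u))"
proof -
  let ?P = "{(b, s). b \<in> Exps (- S) n \<and> s \<in> Exps S n}"
  let ?Q = "{(b, s). b \<in> Exps (- S) n \<and> s \<in> Exps S n \<and> (\<lambda>j. b j + s j) \<in> Exps UNIV n}"
  have fin: "finite ?P" by (rule finite_subset[of _ "Exps (- S) n \<times> Exps S n"]) auto
  have "(\<Sum>b\<in>Exps (- S) n. xpow b z * (\<Sum>s\<in>Exps S n. c (\<lambda>j. b j + s j) * xpow s u)) =
    (\<Sum>(b, s)\<in>?P. c (\<lambda>j. b j + s j) * (xpow b z * xpow s u))"
  proof -
    have "?P = Exps (- S) n \<times> Exps S n" by auto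
    then show ?thesis
      by (simp add: sum_distrib_left sum.cartesian_product algebra_simps)
  qed
  also have "\<dots> = (\<Sum>(b, s)\<in>?Q. c (\<lambda>j. b j + s j) * (xpow b z * xpow s u))"
    by (rule sum.mono_neutral_right[OF fin]) (auto, metis assms(3))
  also have "\<dots> = (\<Sum>a\<in>Exps UNIV n. c a * xpow a (u + z))"
  proof (rule sum.reindex_bij_witness[where i = "\<lambda>a. (\<lambda>j. if j \<in> S then 0 else a j, \<lambda>j. if j \<in> S then a j else 0)"
        and j = "\<lambda>(b, s) j. b j + s j"], goal_cases)
    case (4 a)
    have "deg (\<lambda>j. if j \<in> S then 0 else a j) \<le> deg a" "deg (\<lambda>j. if j \<in> S then a j else 0) \<le> deg a"
      unfolding deg_def by (intro sum_mono; simp)+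
    moreover have "(\<lambda>j. (if j \<in> S then 0 else a j) + (if j \<in> S then a j else 0)) = a" by auto
    ultimately show ?case using 4 by (auto simp: Exps_def simp del: deg_add)
  next
    case (5 x)
    then show ?case using xpow_disjoint_add[OF assms(1,2)] by (auto simp: Exps_def)
  qed (auto simp: Exps_def fun_eq_iff)
  finally show ?thesis by simp
qed

context
  assumes inf: "infinite (UNIV :: 'k::field set)"
begin

text \<open>Exponents are ordered by \<open>key N\<close> with N possibly larger than the degree n,
  so that pivots of spaces of different degrees can be compared.\<close>

lemma dim_van_space_step:
  fixes A :: "'k ^ 'n::finite \<Rightarrow> 'k ^ 'n"
  assumes "frame A p S F" "p \<in> J" "n \<le> N"
  shows "fs.dim (van_space F n J m) = fs.dim (van_space F n J (m(p := Suc (m p)))) +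
    card (lead A S N (van_space F n J m) (m p))"
proof -
  have "p \<in> J \<inter> F" using assms(1,2) by (auto elim: frameE)
  moreover have "van_space F n J m \<subseteq> flat_polys F N"
    using van_space_subset flat_polys_mono[OF assms(3)] by blast
  ultimately show ?thesis
    using dim_lead[OF inf assms(1) van_space_subspace[of F n J m], of N "m p"] van_space_step[of p J F n m]
    by (simp add: van_space_def)
qed

lemma jump_eq_card_lead:
  fixes A :: "'k ^ 'n::finite \<Rightarrow> 'k ^ 'n"
  assumes "frame A p S F" "p \<in> J" "n \<le> N"
  shows "jump F n J m p = card (lead A S N (van_space F n J m) (m p))"
  using dim_van_space_step[OF assms, of m] by (simp add: jump_def)

lemma card_lead_set:
  fixes A :: "'k ^ 'n::finite \<Rightarrow> 'k ^ 'n"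
  assumes "frame A p S F" "p \<in> J"
  shows "card (lead_set A S n J \<beta> p) = mass F n J \<beta> p"
proof -
  have F: "A ` coords S = F" using assms(1) by (simp add: frame_def)
  define L where "L = (\<lambda>r. lead A S n (van_space F n J (\<lambda>q. r + \<beta> p - \<beta> q)) r)"
  have "lead_set A S n J \<beta> p = (\<Union>r\<le>n. L r)"
    unfolding lead_set_def F L_def by (auto simp: lead_def Exps_def)
  moreover have "card (\<Union>r\<le>n. L r) = (\<Sum>r\<le>n. card (L r))"
  proof (rule card_UN_disjoint)
    show "\<forall>i\<in>{..n}. finite (L i)"
      by (auto simp: L_def lead_def)
  qed (auto simp: L_def lead_def)
  moreover have "card (L r) = jump F n J (\<lambda>q. r + \<beta> p - \<beta> q) p" for r
    using jump_eq_card_lead[OF assms, of n n] by (simp add: L_def)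
  ultimately show ?thesis by (simp add: mass_def)
qed

text \<open>In the chart, f is the sum over b of z^b h_b(u), with u along the flat and z transversal
  to it; g is h_b for the chosen b. On a line through q in direction y' + z this becomes the sum of
  t^(deg b) z^b h_b(y + t y'). Each coefficient in t below m is a polynomial in z that vanishes
  identically, and its coefficient at z^b isolates h_b with a loss of deg b orders.\<close>

lemma slice:
  fixes A :: "'k ^ 'n::finite \<Rightarrow> 'k ^ 'n"
  assumes fr: "frame A p UNIV UNIV" and f: "f \<in> flat_polys UNIV n" and F: "F = A ` coords S" and b: "b \<in> Exps (- S) n"
  obtains g where "g \<in> flat_polys F n"
    "\<And>s. s \<in> Exps S n \<Longrightarrow> coef A S n g s = coef A UNIV n f (\<lambda>j. b j + s j)"
    "\<And>q m. q \<in> F \<Longrightarrow> vanishes UNIV q m f \<Longrightarrow> vanishes F q (m - deg b) g"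
proof -
  obtain M M' where A: "\<And>x. A x = M *v x + p" "\<And>x. M' *v (M *v x) = x" "\<And>x. M *v (M' *v x) = x"
    using frameE[OF fr] by metis
  have frS: "frame A p S F" using fr F by (simp add: frame_def)
  define c where "c = coef A UNIV n f"
  define h where "h = (\<lambda>b u. \<Sum>s\<in>Exps S n. c (\<lambda>j. b j + s j) * xpow s u)"
  have h_polys: "h b' \<in> polys n" for b'
    unfolding h_def by (intro polys_sum polys_scale xpow_in_polys) (simp add: Exps_def)
  define g where "g = restr F (\<lambda>y. h b (M' *v y + - (M' *v p)))"
  have g: "g \<in> flat_polys F n"
    unfolding g_def flat_polys_def by (intro imageI polys_affine_comp h_polys)
  have gA: "g (A u) = h b u" if "u \<in> coords S" for u
    using that A by (simp add: g_def restr_def F matrix_vector_right_distrib)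
  have coef_g: "coef A S n g s = c (\<lambda>j. b j + s j)" if "s \<in> Exps S n" for s
    by (rule coef_unique[OF inf frS g _ that]) (simp add: gA h_def)
  have "vanishes F q (m - deg b) g" if q: "q \<in> F" and van: "vanishes UNIV q m f" for q m
    unfolding vanishes_def
  proof (intro allI impI)
    fix v assume v: "q + v \<in> F"
    obtain y y2 where y: "y \<in> coords S" "q = A y" "y2 \<in> coords S" "q + v = A y2" using q v F by auto
    define y' where "y' = y2 - y"
    have y': "y' \<in> coords S" "v = M *v y'"
      using y A by (auto simp: y'_def coords_diff matrix_vector_mult_diff_distrib algebra_simps)
    have line: "\<exists>G. \<forall>t. h b' (y + t *s y') = poly G t" for b'
      using polys_line[OF h_polys] by metis
    then obtain G where G: "\<And>b' t. h b' (y + t *s y') = poly (G b') t" by metis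
    let ?Q = "\<lambda>z. \<Sum>b'\<in>Exps (- S) n. monom (xpow b' z) (deg b') * G b'"
    have dvd: "monom 1 m dvd ?Q z" if z: "z \<in> coords (- S)" for z
    proof -
      obtain Q where Q: "\<And>t. f (q + t *s (M *v (y' + z))) = poly Q t" "monom 1 m dvd Q"
        using van unfolding vanishes_def by auto
      have "poly Q t = poly (?Q z) t" for t
      proof -
        have "q + t *s (M *v (y' + z)) = A ((y + t *s y') + t *s z)"
          using y A by (simp add: matrix_vector_right_distrib matrix_vector_mult_scale vec.scale_right_distrib algebra_simps)
        then have "poly Q t = f (A ((y + t *s y') + t *s z))" using Q(1)[of t] by simp
        also have "\<dots> = (\<Sum>a\<in>Exps UNIV n. c a * xpow a ((y + t *s y') + t *s z))"
          unfolding c_def by (rule coef(1)[OF fr f]) simp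
        also have "\<dots> = (\<Sum>b'\<in>Exps (- S) n. xpow b' (t *s z) * h b' (y + t *s y'))"
          unfolding h_def using coef(2)[OF fr f]
          by (intro sum_Exps_split) (auto simp: c_def intro: coords_add coords_scale y y' z)
        also have "\<dots> = poly (?Q z) t"
          by (simp add: poly_sum poly_monom xpow_scale G algebra_simps)
        finally show ?thesis .
      qed
      then have "Q = ?Q z"
        by (rule poly_all_eq[OF inf])
      then show ?thesis using Q(2) by simp
    qed
    have "coeff (G b) i = 0" if i: "i < m - deg b" for i
    proof -
      define l where "l = i + deg b"
      have l: "l < m" using i by (simp add: l_def)
      have "(if deg b \<le> l then coeff (G b) (l - deg b) else 0) = 0"
      proof (rule Exps_coeff_zero[OF inf _ b, where c = "\<lambda>b. if deg b \<le> l then coeff (G b) (l - deg b) else 0"])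
        fix z :: "'k ^ 'n" assume z: "z \<in> coords (- S)"
        have "0 = coeff (?Q z) l"
          using dvd[OF z] l by (simp add: monom_1_dvd_iff')
        also have "\<dots> = (\<Sum>b'\<in>Exps (- S) n. (if deg b' \<le> l then coeff (G b') (l - deg b') else 0) * xpow b' z)"
          unfolding coeff_sum by (intro sum.cong) (auto simp: coeff_monom_mult not_le)
        finally show "(\<Sum>b'\<in>Exps (- S) n. (if deg b' \<le> l then coeff (G b') (l - deg b') else 0) * xpow b' z) = 0"
          by simp
      qed
      then show ?thesis by (simp add: l_def)
    qed
    then have "monom 1 (m - deg b) dvd G b" by (simp add: monom_1_dvd_iff')
    moreover have "g (q + t *s v) = poly (G b) t" for t
    proof -
      have "q + t *s v = A (y + t *s y')"
        using y y' A by (simp add: matrix_vector_right_distrib matrix_vector_mult_scale algebra_simps)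
      moreover have "y + t *s y' \<in> coords S" by (intro coords_add coords_scale y y')
      ultimately show ?thesis using gA G by simp
    qed
    ultimately show "\<exists>G. (\<forall>t. g (q + t *s v) = poly G t) \<and> monom 1 (m - deg b) dvd G" by blast
  qed
  then show ?thesis using that[OF g] coef_g by (auto simp: c_def)
qed

text \<open>Slicing a witness f at the transversal part b of a gives the coefficients of f at b + s.
  As \<open>key\<close> is additive and b is fixed, the s are ordered like the b + s, so the slice
  has the part of a on S as leading exponent.\<close>

lemma lead_set_proj:
  fixes A :: "'k ^ 'n::finite \<Rightarrow> 'k ^ 'n"
  assumes fr: "frame A p UNIV UNIV" and a: "a \<in> lead_set A UNIV n J \<beta> p"
  shows "proj S a \<in> lead_set A S n J \<beta> p"
proof -
  let ?F = "A ` coords S"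
  define s where "s = (\<lambda>j. if j \<in> S then a j else 0)"
  define b where "b = (\<lambda>j. if j \<in> S then 0 else a j)"
  have a_eq: "a = (\<lambda>j. b j + s j)" by (auto simp: s_def b_def)
  then have deg_a: "deg a = deg b + deg s" by simp
  have A: "A ` coords UNIV = UNIV" using fr by (simp add: frame_def)
  obtain f where f: "f \<in> van_space UNIV n J (\<lambda>q. deg a + \<beta> p - \<beta> q)" "coef A UNIV n f a \<noteq> 0"
    "\<And>b. b \<in> Exps UNIV n \<Longrightarrow> deg b = deg a \<Longrightarrow> key n b < key n a \<Longrightarrow> coef A UNIV n f b = 0"
    and a_Exps: "a \<in> Exps UNIV n"
    using a unfolding lead_set_def lead_def A by auto
  have s: "s \<in> Exps S n" and b: "b \<in> Exps (- S) n"
    using a_Exps deg_a by (auto simp: Exps_def s_def b_def)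
  obtain g where g: "g \<in> flat_polys ?F n"
    "\<And>s. s \<in> Exps S n \<Longrightarrow> coef A S n g s = coef A UNIV n f (\<lambda>j. b j + s j)"
    "\<And>q m. q \<in> ?F \<Longrightarrow> vanishes UNIV q m f \<Longrightarrow> vanishes ?F q (m - deg b) g"
    using slice[OF fr _ refl b] f(1) van_space_subset by blast
  have "g \<in> van_space ?F n J (\<lambda>q. deg s + \<beta> p - \<beta> q)"
  proof -
    have "vanishes ?F q (deg s + \<beta> p - \<beta> q) g" if "q \<in> J \<inter> ?F" for q
    proof -
      have "vanishes UNIV q (deg a + \<beta> p - \<beta> q) f" using f(1) that by (simp add: van_space_def)
      then have "vanishes ?F q (deg a + \<beta> p - \<beta> q - deg b) g" using g(3) that by blast
      \<comment> \<open>The loss deg b is exactly the difference of the degrees of a and s, and this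
        remains correct where the truncated differences are cut off at 0.\<close>
      moreover have "deg a + \<beta> p - \<beta> q - deg b = deg s + \<beta> p - \<beta> q" unfolding deg_a by linarith
      ultimately show ?thesis by simp
    qed
    then show ?thesis using g(1) by (simp add: van_space_def)
  qed
  moreover have "coef A S n g s \<noteq> 0" using g(2)[OF s] f(2) a_eq by simp
  moreover have "coef A S n g s' = 0" if s': "s' \<in> Exps S n" "deg s' = deg s" "key n s' < key n s" for s'
  proof -
    have "coef A UNIV n f (\<lambda>j. b j + s' j) = 0"
    proof (rule f(3))
      show deg: "deg (\<lambda>j. b j + s' j) = deg a" using deg_a s' by simp
      then show "(\<lambda>j. b j + s' j) \<in> Exps UNIV n" using a_Exps by (simp add: Exps_def)
      show "key n (\<lambda>j. b j + s' j) < key n a" unfolding a_eq key_add using s' by simp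
    qed
    then show ?thesis using g(2)[OF s'(1)] by simp
  qed
  ultimately have "s \<in> lead_set A S n J \<beta> p"
    using s unfolding lead_set_def lead_def by blast
  then show ?thesis by (simp add: s_def proj_def)
qed

end

lemma van_space_cong:
  assumes "\<And>q. q \<in> J \<inter> F \<Longrightarrow> m q = m' q"
  shows "van_space F n J m = van_space F n J m'"
  using assms by (auto simp: van_space_def)

section \<open>Conditions at different points and the total mass on a flat\<close>

lemma separating_poly:
  fixes p :: "'k::field ^ 'n::finite"
  assumes "finite J" "p \<in> J"
  obtains h where "h \<in> polys (card J)" "h p = 1" "\<And>q. q \<in> J \<Longrightarrow> q \<noteq> p \<Longrightarrow> h q = 0"
proof -
  define i where "i = (\<lambda>q. SOME j. p $ j \<noteq> q $ j)"
  have i: "p $ i q \<noteq> q $ i q" if "q \<noteq> p" for q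
    unfolding i_def by (rule someI_ex) (use that in \<open>metis vec_eq_iff\<close>)
  define l where "l = (\<lambda>q x. (1 / (p $ i q - q $ i q)) * (x $ i q + (- q $ i q)))"
  have l: "l q \<in> polys 1" for q
    unfolding l_def by (intro polys_scale polys_add polys_coord polys_const)
  define h where "h = (\<lambda>x. \<Prod>q\<in>J - {p}. l q x)"
  have "h \<in> polys (\<Sum>q\<in>J - {p}. 1)"
    unfolding h_def by (rule polys_prod) (use assms l in auto)
  then have "h \<in> polys (card J)"
    using polys_mono[of "card (J - {p})" "card J"] assms by (auto simp: card_Diff_subset)
  moreover have "h p = 1" unfolding h_def
    by (rule prod.neutral) (use i in \<open>auto simp: l_def\<close>)
  moreover have "h q = 0" if "q \<in> J" "q \<noteq> p" for q
    unfolding h_def by (rule prod_zero) (use assms that in \<open>auto simp: l_def\<close>)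
  ultimately show ?thesis using that by blast
qed

lemma flat_polys_mult:
  assumes "h \<in> polys s" "g \<in> flat_polys F n"
  shows "(\<lambda>x. h x * g x) \<in> flat_polys F (n + s)"
proof -
  obtain f where f: "g = restr F f" "f \<in> polys n" using assms(2) by (auto simp: flat_polys_def)
  have "(\<lambda>x. h x * g x) = restr F (\<lambda>x. f x * h x)" using f by (auto simp: restr_def)
  then show ?thesis using polys_mult[OF f(2) assms(1)] by (auto simp: flat_polys_def)
qed

context
  assumes inf: "infinite (UNIV :: 'k::field set)"
begin

text \<open>Multiplication by a polynomial that is 1 at \<open>p\<close> and 0 at the other points does not change leading
  exponents at \<open>p\<close>.\<close>

lemma lead_subset_lead:
  fixes A :: "'k ^ 'n::finite \<Rightarrow> 'k ^ 'n"
  assumes fr: "frame A p S F" and J: "finite J" "p \<in> J" and Q: "p \<notin> Q"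
  shows "lead A S (n + card J) (van_space F n J m) (m p) \<subseteq>
    lead A S (n + card J) (van_space F (n + card J) J (\<lambda>q. m q + of_bool (q \<in> Q))) (m p)"
proof
  let ?N = "n + card J"
  fix a assume a: "a \<in> lead A S ?N (van_space F n J m) (m p)"
  then obtain g where g: "g \<in> van_space F n J m" "coef A S ?N g a \<noteq> 0"
    "\<forall>b\<in>{a \<in> Exps S ?N. deg a = m p}. key ?N b < key ?N a \<longrightarrow> coef A S ?N g b = 0"
    by (auto simp: lead_def)
  obtain h where h: "h \<in> polys (card J)" "h p = 1" "\<And>q. q \<in> J \<Longrightarrow> q \<noteq> p \<Longrightarrow> h q = 0"
    using separating_poly[OF J] by blast
  define g' where "g' = (\<lambda>x. h x * g x)"
  define e where "e = (\<lambda>x. (h x + (- 1)) * g x)"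
  have h1: "(\<lambda>x. h x + (- 1)) \<in> polys (card J)" by (intro polys_add h polys_const)
  have p: "p \<in> J \<inter> F" using fr J by (auto elim: frameE)
  have g_flat: "g \<in> flat_polys F n" using g(1) by (simp add: van_space_def)
  then have g_N: "g \<in> flat_polys F ?N" using flat_polys_mono[of n ?N F] by auto
  have e: "e \<in> flat_polys F ?N" unfolding e_def by (rule flat_polys_mult[OF h1 g_flat])
  have g': "g' \<in> flat_polys F ?N" unfolding g'_def by (rule flat_polys_mult[OF h(1) g_flat])
  have eq: "g' = g + e" by (auto simp: g'_def e_def fun_eq_iff algebra_simps)
  \<comment> \<open>The error e = (h - 1) g vanishes at p to one order more than is known of g, so
    it has no coefficients of degree m p.\<close>
  have "vanishes F p (1 + m p) e"
    unfolding e_def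
  proof (rule vanishes_mult)
    show "vanishes F p 1 (\<lambda>x. h x + - 1)" using h1 by (rule vanishes_polys_1) (use h in simp)
    show "vanishes F p (m p) g" using g(1) p by (simp add: van_space_def)
  qed
  then have "coef A S ?N e b = 0" if "b \<in> Exps S ?N" "deg b = m p" for b
    using vanishes_iff_coef[OF inf fr e] that by auto
  then have coef_eq: "coef A S ?N g' b = coef A S ?N g b" if "b \<in> Exps S ?N" "deg b = m p" for b
    unfolding eq using coef_add[OF inf fr g_N e] that by simp
  have "g' \<in> van_space F ?N J (\<lambda>q. m q + of_bool (q \<in> Q))"
    unfolding van_space_def
  proof (intro CollectI conjI ballI g')
    fix q assume q: "q \<in> J \<inter> F"
    have vg: "vanishes F q (m q) g" using g(1) q by (simp add: van_space_def)
    show "vanishes F q (m q + of_bool (q \<in> Q)) g'"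
    proof (cases "q = p")
      case True
      then show ?thesis unfolding g'_def
        using vanishes_mult[OF vanishes_polys_0[OF h(1)] vg] Q by simp
    next
      case False
      \<comment> \<open>At the other points the zero of h supplies the additional order demanded on
        Q.\<close>
      then have "vanishes F q 1 h" using h q vanishes_polys_1[OF h(1)] by blast
      from vanishes_mult[OF this vg] show ?thesis
        unfolding g'_def by (rule vanishes_mono) simp
    qed
  qed
  moreover have aI: "a \<in> {a \<in> Exps S ?N. deg a = m p}" using a by (simp add: lead_def)
  moreover have "coef A S ?N g' a \<noteq> 0" using coef_eq[of a] aI g(2) by simp
  moreover have "\<forall>b\<in>{a \<in> Exps S ?N. deg a = m p}. key ?N b < key ?N a \<longrightarrow> coef A S ?N g' b = 0"
    using coef_eq g(3) by simp
  ultimately show "a \<in> lead A S ?N (van_space F ?N J (\<lambda>q. m q + of_bool (q \<in> Q))) (m p)"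
    unfolding lead_def by blast
qed

text \<open>The conditions at the points of Q are imposed one after another. A pivot at p in degree
  n survives, in degree n + |J|, the conditions already imposed at the other points, so the losses
  add up.\<close>

lemma sum_jump_le:
  fixes A :: "'k ^ 'n::finite \<Rightarrow> 'k ^ 'n"
  assumes fr: "frame A p0 S F" and J: "finite J" and Q: "Q \<subseteq> J \<inter> F"
  shows "fs.dim (van_space F (n + card J) J (\<lambda>q. m q + of_bool (q \<in> Q))) + (\<Sum>p\<in>Q. jump F n J m p)
    \<le> fs.dim (van_space F (n + card J) J m)"
proof -
  have "finite Q" using Q J finite_subset by auto
  then show ?thesis using Q
  proof (induction Q rule: finite_induct)
    case (insert p Q)
    let ?N = "n + card J" and ?m = "\<lambda>q. m q + of_bool (q \<in> Q)"
    have p: "p \<in> J" "p \<in> F" using insert by auto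
    obtain B where B: "frame B p S F" using frame_at[OF fr p(2)] by blast
    have "jump F n J m p = card (lead B S ?N (van_space F n J m) (m p))"
      using jump_eq_card_lead[OF inf B p(1), of n ?N] by simp
    also have "\<dots> \<le> card (lead B S ?N (van_space F ?N J ?m) (?m p))"
      using lead_subset_lead[OF B J p(1), of Q n m] insert
      by (intro card_mono) (auto simp: lead_def)
    finally have "jump F n J m p + fs.dim (van_space F ?N J (?m(p := Suc (?m p)))) \<le> fs.dim (van_space F ?N J ?m)"
      using dim_van_space_step[OF inf B p(1) order_refl, of ?N ?m] by simp
    moreover have "?m(p := Suc (?m p)) = (\<lambda>q. m q + of_bool (q \<in> insert p Q))"
      using insert by auto
    ultimately show ?case using insert by simp
  qed simp
qed

text \<open>The time t = r + \<beta> p is common to all points. \<open>D\<close> runs through the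
  spaces at successive times, and the step from t to t + 1 pays for the jumps at all points with
  \<beta> p \<le> t.\<close>

lemma sum_mass_le:
  fixes A :: "'k ^ 'n::finite \<Rightarrow> 'k ^ 'n"
  assumes fr: "frame A p0 S F" and J: "finite J"
  shows "(\<Sum>p\<in>J \<inter> F. mass F n J \<beta> p) \<le> (n + card J + card S) choose card S"
proof -
  let ?N = "n + card J"
  define D where "D = (\<lambda>t. fs.dim (van_space F ?N J (\<lambda>q. t - \<beta> q)))"
  define Q where "Q = (\<lambda>t. {p \<in> J \<inter> F. \<beta> p \<le> t})"
  define j where "j = (\<lambda>t p. jump F n J (\<lambda>q. t - \<beta> q) p)"
  have step: "D (Suc t) + (\<Sum>p\<in>Q t. j t p) \<le> D t" for t
  proof -
    have "van_space F ?N J (\<lambda>q. (t - \<beta> q) + of_bool (q \<in> Q t)) = van_space F ?N J (\<lambda>q. Suc t - \<beta> q)"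
      by (rule van_space_cong) (auto simp: Q_def)
    then show ?thesis using sum_jump_le[OF fr J, of "Q t" n "\<lambda>q. t - \<beta> q"]
      by (auto simp: D_def j_def Q_def)
  qed
  have chain: "D (Suc T) + (\<Sum>t\<le>T. \<Sum>p\<in>Q t. j t p) \<le> D 0" for T
  proof (induction T)
    case (Suc T)
    then show ?case using step[of "Suc T"] by simp
  qed (use step in simp)
  \<comment> \<open>By this time every point has passed through the orders 0 to n.\<close>
  define T where "T = n + Max (insert 0 (\<beta> ` J))"
  have T: "n + \<beta> p \<le> T" if "p \<in> J" for p
    using that J Max_ge[of "insert 0 (\<beta> ` J)" "\<beta> p"] by (simp add: T_def)
  have "(\<Sum>p\<in>J \<inter> F. mass F n J \<beta> p) = (\<Sum>p\<in>J \<inter> F. \<Sum>t\<in>{\<beta> p..\<beta> p + n}. j t p)"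
  proof (rule sum.cong[OF refl])
    fix p
    show "mass F n J \<beta> p = (\<Sum>t\<in>{\<beta> p..\<beta> p + n}. j t p)"
      unfolding mass_def j_def
      by (rule sum.reindex_bij_witness[where i = "\<lambda>t. t - \<beta> p" and j = "\<lambda>r. r + \<beta> p"]) auto
  qed
  also have "\<dots> \<le> (\<Sum>p\<in>J \<inter> F. \<Sum>t\<in>{\<beta> p..T}. j t p)"
    using T by (intro sum_mono sum_mono2) (auto simp: add.commute)
  also have "\<dots> = (\<Sum>p\<in>J \<inter> F. \<Sum>t\<in>{..T}. if \<beta> p \<le> t then j t p else 0)"
    by (intro sum.cong[OF refl] sum.mono_neutral_cong_left) auto
  also have "\<dots> = (\<Sum>t\<le>T. \<Sum>p\<in>J \<inter> F. if \<beta> p \<le> t then j t p else 0)"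
    by (rule sum.swap)
  also have "\<dots> = (\<Sum>t\<le>T. \<Sum>p\<in>Q t. j t p)"
    unfolding Q_def using J by (intro sum.cong refl sum.inter_filter[symmetric]) simp
  also have "\<dots> \<le> D 0" using chain[of T] by simp
  also have "D 0 = fs.dim (flat_polys F ?N)"
    using van_space_0[OF fr, of ?N J] by (simp add: D_def)
  also have "\<dots> \<le> (?N + card S) choose card S" by (rule dim_flat_polys_le[OF inf fr])
  finally show ?thesis .
qed

section \<open>Existence of balanced delays\<close>

lemma van_space_trivial:
  fixes q :: "'k ^ 'n::finite"
  assumes "q \<in> J" "n < m q"
  shows "fs.dim (van_space UNIV n J m) = 0"
proof -
  have "van_space UNIV n J m \<subseteq> {0}"
  proof
    fix g assume g: "g \<in> van_space UNIV n J m"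
    then have *: "g \<in> flat_polys UNIV n" "vanishes UNIV q (m q) g" using assms by (auto simp: van_space_def)
    have "g = 0"
      by (rule flat_polys_coef_zero[OF inf frame_UNIV[of q] *(1)])
        (use * vanishes_iff_coef[OF inf frame_UNIV *(1)] assms(2) in \<open>auto simp: Exps_def\<close>)
    then show "g \<in> {0}" by simp
  qed
  then show ?thesis using fs.dim_le_card[of "van_space UNIV n J m" "{}"] by simp
qed

text \<open>The delays maximise the concave potential \<open>\<Sum>\<^sub>t dim (van_space (t - \<beta>)) - K \<Sum>\<^sub>p \<zeta> p \<beta> p\<close>: lowering
  \<open>\<beta> p\<close> by one lowers the first sum by \<open>mass p\<close>. Raising all \<open>\<beta> p\<close> by one changes nothing.\<close>

lemma balanced_delays:
  fixes J :: "('k ^ 'n::finite) set" and \<zeta> :: "'k ^ 'n \<Rightarrow> real"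
  assumes J: "finite J" and pos: "\<And>p. p \<in> J \<Longrightarrow> 0 < \<zeta> p" and sum1: "(\<Sum>p\<in>J. \<zeta> p) = 1"
  obtains \<beta> where "\<And>p. p \<in> J \<Longrightarrow> \<zeta> p * real ((n + CARD('n)) choose CARD('n)) \<le> real (mass UNIV n J \<beta> p)"
proof -
  define K where "K = real ((n + CARD('n)) choose CARD('n))"
  have K: "K > 0" unfolding K_def by (simp add: zero_less_binomial_iff)
  \<comment> \<open>With delays at most n + 1 all spaces at times t \<ge> 2 n + 2 are trivial, so
    cutting the sum at T loses nothing.\<close>
  define A where "A = n + 1"
  define T where "T = 2 * n + 2"
  define W where "W = (\<lambda>t \<beta>. real (fs.dim (van_space UNIV n J (\<lambda>q. t - \<beta> q))))"
  define \<Phi> where "\<Phi> = (\<lambda>\<beta>. \<Sum>t\<le>T. W t \<beta>)"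
  define G where "G = (\<lambda>\<beta>. \<Phi> \<beta> - K * (\<Sum>p\<in>J. \<zeta> p * real (\<beta> p)))"
  define Box where "Box = (\<Pi>\<^sub>E p\<in>J. {..A})"
  have W_cong: "W t \<beta> = W t \<beta>'" if "\<And>q. q \<in> J \<Longrightarrow> \<beta> q = \<beta>' q" for t \<beta> \<beta>'
  proof -
    have "van_space UNIV n J (\<lambda>q. t - \<beta> q) = van_space UNIV n J (\<lambda>q. t - \<beta>' q)"
      by (rule van_space_cong) (use that in simp)
    then show ?thesis by (simp add: W_def)
  qed
  \<comment> \<open>Lowering the delay of p by one demands one more order at p at every time t \<ge>
    \<beta> p; the losses are jumps that occur in the mass of p.\<close>
  have down: "\<Phi> \<beta> \<le> \<Phi> (\<beta>(p := \<beta> p - 1)) + real (mass UNIV n J \<beta> p)" if p: "p \<in> J" "\<beta> p \<ge> 1" for \<beta> p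
  proof -
    let ?\<beta> = "\<beta>(p := \<beta> p - 1)"
    define j where "j = (\<lambda>t. real (jump UNIV n J (\<lambda>q. t - \<beta> q) p))"
    have "W t \<beta> = W t ?\<beta> + (if t \<in> {\<beta> p..} then j t else 0)" for t
    proof (cases "\<beta> p \<le> t")
      case True
      let ?m = "\<lambda>q. t - \<beta> q"
      have "?m(p := Suc (?m p)) = (\<lambda>q. t - ?\<beta> q)" using True p by (auto simp: fun_eq_iff)
      moreover have "fs.dim (van_space UNIV n J (?m(p := Suc (?m p)))) \<le> fs.dim (van_space UNIV n J ?m)"
        by (intro dim_mono_findim findim_van_space van_space_subspace van_space_antimono) auto
      ultimately show ?thesis using True by (simp add: W_def j_def jump_def)
    next
      case False
      then have "(\<lambda>q. t - \<beta> q) = (\<lambda>q. t - ?\<beta> q)" using p by (auto simp: fun_eq_iff)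
      then show ?thesis using False by (simp add: W_def)
    qed
    then have \<Phi>_eq: "\<Phi> \<beta> = \<Phi> ?\<beta> + (\<Sum>t\<le>T. if t \<in> {\<beta> p..} then j t else 0)"
      by (simp add: \<Phi>_def sum.distrib)
    have "(\<Sum>t\<le>T. if t \<in> {\<beta> p..} then j t else 0) = (\<Sum>t\<in>{..T} \<inter> {\<beta> p..}. j t)"
      by (simp add: sum.inter_restrict)
    also have "\<dots> \<le> (\<Sum>t\<in>{\<beta> p..\<beta> p + n}. j t)"
    proof -
      have "j t = 0" if "t > \<beta> p + n" for t
      proof -
        have "fs.dim (van_space UNIV n J (\<lambda>q. t - \<beta> q)) = 0"
          by (rule van_space_trivial[OF p(1)]) (use that in linarith)
        then show ?thesis by (simp add: j_def jump_def)
      qed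
      then have "(\<Sum>t\<in>{..T} \<inter> {\<beta> p..}. j t) = (\<Sum>t\<in>{..T} \<inter> {\<beta> p..\<beta> p + n}. j t)"
        by (intro sum.mono_neutral_right) auto
      also have "\<dots> \<le> (\<Sum>t\<in>{\<beta> p..\<beta> p + n}. j t)"
        by (intro sum_mono2) (auto simp: j_def)
      finally show ?thesis .
    qed
    also have "(\<Sum>t\<in>{\<beta> p..\<beta> p + n}. j t) = real (mass UNIV n J \<beta> p)"
      unfolding mass_def j_def of_nat_sum
      by (rule sum.reindex_bij_witness[where j = "\<lambda>t. t - \<beta> p" and i = "\<lambda>r. r + \<beta> p"]) auto
    finally show ?thesis unfolding \<Phi>_eq by (rule add_left_mono)
  qed
  have fin: "finite Box" unfolding Box_def by (intro finite_PiE J) simp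
  have "(\<lambda>p\<in>J. 0) \<in> Box" by (auto simp: Box_def)
  then obtain \<beta> where \<beta>: "\<beta> \<in> Box" "\<And>\<gamma>. \<gamma> \<in> Box \<Longrightarrow> G \<gamma> \<le> G \<beta>"
    using finite_imageI[OF fin, of G] Max_in[of "G ` Box"] Max_ge[of "G ` Box"]
    by (metis (no_types, lifting) empty_iff imageE image_eqI image_is_empty)
  \<comment> \<open>At a maximum, lowering \<gamma> p cannot increase \<open>G\<close>: the gain K
    \<zeta> p in the linear term is at most the loss in \<open>\<Phi>\<close>, which is at most the
    mass.\<close>
  have good: "\<zeta> p * K \<le> real (mass UNIV n J \<gamma> p)"
    if \<gamma>: "\<gamma> \<in> Box" "G \<gamma> = G \<beta>" and p: "p \<in> J" "\<gamma> p \<ge> 1" for \<gamma> p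
  proof -
    let ?\<gamma> = "\<gamma>(p := \<gamma> p - 1)"
    have "?\<gamma> \<in> Box" using \<gamma>(1) p by (auto simp: Box_def PiE_iff extensional_def)
    then have "G ?\<gamma> \<le> G \<gamma>" using \<beta>(2) \<gamma>(2) by simp
    moreover have "(\<Sum>q\<in>J. \<zeta> q * real (?\<gamma> q)) = (\<Sum>q\<in>J. \<zeta> q * real (\<gamma> q)) - \<zeta> p"
    proof -
      have "(\<Sum>q\<in>J - {p}. \<zeta> q * real (?\<gamma> q)) = (\<Sum>q\<in>J - {p}. \<zeta> q * real (\<gamma> q))"
        by (rule sum.cong) auto
      then show ?thesis using J p by (simp add: sum.remove[of J p] of_nat_diff algebra_simps)
    qed
    ultimately have "\<Phi> ?\<gamma> + K * \<zeta> p \<le> \<Phi> \<gamma>" by (simp add: G_def right_diff_distrib)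
    moreover have "\<Phi> \<gamma> \<le> \<Phi> ?\<gamma> + real (mass UNIV n J \<gamma> p)" using p by (rule down)
    moreover have "\<zeta> p * K = K * \<zeta> p" by (rule mult.commute)
    ultimately show ?thesis by linarith
  qed
  show ?thesis
  proof (cases "\<forall>p\<in>J. \<beta> p \<ge> 1")
    case True
    then show ?thesis using that[of \<beta>] good[OF \<beta>(1) refl] by (simp add: K_def)
  next
    case False
    then obtain p where p: "p \<in> J" "\<beta> p = 0" by (auto simp: not_le)
    \<comment> \<open>If p has delay 0 and q has delay at least n + 1, then p has order above n
      whenever q is counted, so q would have mass 0.\<close>
    have "\<beta> q < A" if q: "q \<in> J" for q
    proof (rule ccontr)
      assume "\<not> \<beta> q < A"
      then have A: "A \<le> \<beta> q" by simp
      have "fs.dim (van_space UNIV n J (\<lambda>q'. r + \<beta> q - \<beta> q')) = 0" for r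
        by (rule van_space_trivial[OF p(1)]) (use p A in \<open>simp add: A_def\<close>)
      then have "mass UNIV n J \<beta> q = 0" by (simp add: mass_def jump_def)
      then have "\<zeta> q * K \<le> 0" using good[OF \<beta>(1) refl q] A by (simp add: A_def)
      then show False using pos[OF q] K by (simp add: mult_le_0_iff)
    qed
    note lt = this
    \<comment> \<open>The shift makes all delays positive. \<open>\<Phi>\<close> gains the full
      dimension K at time 0 and drops the trivial space at time T, while the linear term grows by K
      times the sum of the \<zeta>, which is 1.\<close>
    define \<gamma> where "\<gamma> = (\<lambda>q\<in>J. \<beta> q + 1)"
    have "\<gamma> \<in> Box" using lt by (auto simp: \<gamma>_def Box_def Suc_le_eq)
    moreover have "G \<gamma> = G \<beta>"
    proof -
      have W\<gamma>: "W t \<gamma> = W (t - 1) \<beta>" if "t \<ge> 1" for t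
        using that W_cong[of \<gamma> "\<lambda>q. \<beta> q + 1" t] by (simp add: \<gamma>_def W_def)
      have W0: "W 0 \<gamma> = K"
        using van_space_0[OF frame_UNIV, of n J] dim_flat_polys_UNIV[OF inf, of n]
        by (simp add: W_def K_def)
      have WT: "W T \<beta> = 0"
      proof -
        have "fs.dim (van_space UNIV n J (\<lambda>q. T - \<beta> q)) = 0"
          by (rule van_space_trivial[OF p(1)]) (simp add: p T_def)
        then show ?thesis by (simp add: W_def)
      qed
      obtain T' where T': "T = Suc T'" by (simp add: T_def)
      have "\<Phi> \<gamma> = W 0 \<gamma> + (\<Sum>t\<le>T'. W (Suc t) \<gamma>)"
        unfolding \<Phi>_def T' by (rule sum.atMost_Suc_shift)
      also have "\<dots> = K + \<Phi> \<beta>" using W0 WT W\<gamma> by (simp add: \<Phi>_def T')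
      finally have "\<Phi> \<gamma> = K + \<Phi> \<beta>" .
      moreover have "(\<Sum>p\<in>J. \<zeta> p * real (\<gamma> p)) = (\<Sum>p\<in>J. \<zeta> p * real (\<beta> p)) + 1"
        unfolding sum1[symmetric] sum.distrib[symmetric]
        by (intro sum.cong) (auto simp: \<gamma>_def algebra_simps)
      ultimately show ?thesis by (simp add: G_def algebra_simps)
    qed
    moreover have "\<gamma> p \<ge> 1" if "p \<in> J" for p using that by (simp add: \<gamma>_def)
    ultimately show ?thesis using that[of \<gamma>] good[of \<gamma>] by (simp add: K_def)
  qed
qed

end

section \<open>An entropy inequality for projections\<close>

text \<open>Nonnegativity of the relative entropy of P with respect to y divided by its sum.
  Positivity of y is demanded where P is positive because \<open>ln 0\<close> has the default value
  0.\<close>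

lemma gibbs_inequality:
  fixes P y :: "'x \<Rightarrow> real"
  assumes X: "finite X" and P: "\<And>x. x \<in> X \<Longrightarrow> 0 \<le> P x" "(\<Sum>x\<in>X. P x) = 1"
    and y: "\<And>x. x \<in> X \<Longrightarrow> 0 \<le> y x" "\<And>x. x \<in> X \<Longrightarrow> 0 < P x \<Longrightarrow> 0 < y x"
  shows "(\<Sum>x\<in>X. P x * ln (y x)) \<le> ln (\<Sum>x\<in>X. y x) + (\<Sum>x\<in>X. P x * ln (P x))"
proof -
  let ?Y = "\<Sum>x\<in>X. y x"
  have "\<exists>x\<in>X. 0 < P x"
  proof (rule ccontr)
    assume "\<not> ?thesis"
    then have "(\<Sum>x\<in>X. P x) \<le> 0" by (intro sum_nonpos) (auto simp: not_less)
    then show False using P(2) by simp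
  qed
  then obtain x0 where "x0 \<in> X" "0 < P x0" by blast
  then have Y: "?Y > 0" using y X by (intro sum_pos2[of _ x0]) auto
  have "P x * ln (y x) - P x * ln ?Y - P x * ln (P x) \<le> y x / ?Y - P x" if "x \<in> X" for x
  proof (cases "P x = 0")
    case False
    then have pos: "P x > 0" "y x > 0" using P(1)[OF that] y(2)[OF that] by auto
    have "ln (y x / (P x * ?Y)) \<le> y x / (P x * ?Y) - 1"
      using pos Y by (intro ln_le_minus_one) simp
    then have "P x * ln (y x / (P x * ?Y)) \<le> P x * (y x / (P x * ?Y) - 1)"
      using pos by (intro mult_left_mono) auto
    also have "\<dots> = y x / ?Y - P x" using pos Y by (simp add: field_simps)
    finally show ?thesis using pos Y by (simp add: ln_div ln_mult algebra_simps)
  qed (use y(1)[OF that] Y in simp)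
  then have "(\<Sum>x\<in>X. P x * ln (y x) - P x * ln ?Y - P x * ln (P x)) \<le> (\<Sum>x\<in>X. y x / ?Y - P x)"
    by (rule sum_mono)
  also have "\<dots> = 0" using Y P(2) by (simp add: sum_subtractf sum_divide_distrib[symmetric])
  finally have "(\<Sum>x\<in>X. P x * ln (y x)) - (\<Sum>x\<in>X. P x) * ln ?Y - (\<Sum>x\<in>X. P x * ln (P x)) \<le> 0"
    by (simp add: sum_subtractf sum_distrib_right)
  then show ?thesis using P(2) by simp
qed

definition fibre :: "('n \<Rightarrow> nat) set \<Rightarrow> 'n set \<Rightarrow> ('n \<Rightarrow> nat) \<Rightarrow> ('n \<Rightarrow> nat) set" where
  "fibre A T a = {b \<in> A. \<forall>j\<in>T. b j = a j}"

text \<open>The conditional entropy \<open>H(X | X\<^sub>T)\<close> of a uniformly distributed element \<open>X\<close> of \<open>A\<close>.\<close>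

definition cond_ent :: "('n \<Rightarrow> nat) set \<Rightarrow> 'n set \<Rightarrow> real" where
  "cond_ent A T = (\<Sum>a\<in>A. ln (card (fibre A T a))) / card A"

context
  fixes A :: "('n::finite \<Rightarrow> nat) set"
  assumes A: "finite A" "A \<noteq> {}"
begin

lemma finite_fibre [simp]: "finite (fibre A T a)"
  using A by (simp add: fibre_def)

lemma card_fibre_pos: "a \<in> A \<Longrightarrow> 0 < card (fibre A T a)"
  by (subst card_gt_0_iff) (auto simp: fibre_def A)

lemma cardA: "0 < real (card A)"
  using A by (simp add: card_gt_0_iff)

lemma fibre_cong: "b \<in> fibre A T a \<Longrightarrow> fibre A T b = fibre A T a"
  by (auto simp: fibre_def)

text \<open>B lies in a single fibre, along which the fibre size is constant.\<close>

lemma sum_inverse_fibre: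
  assumes "B \<subseteq> A" "\<And>a b. a \<in> B \<Longrightarrow> b \<in> B \<Longrightarrow> b \<in> fibre A T a"
  shows "(\<Sum>a\<in>B. 1 / real (card (fibre A T a))) \<le> 1"
proof (cases "B = {}")
  case False
  then obtain a where a: "a \<in> B" by blast
  have "B \<subseteq> fibre A T a" using assms(2)[OF a] by blast
  then have "card B \<le> card (fibre A T a)" by (intro card_mono) auto
  moreover have "card (fibre A T b) = card (fibre A T a)" if "b \<in> B" for b
    using fibre_cong assms(2)[OF a that] by simp
  ultimately have "(\<Sum>b\<in>B. 1 / real (card (fibre A T b))) = real (card B) / real (card (fibre A T a))"
    and "card B \<le> card (fibre A T a)" by simp_all
  then show ?thesis using card_fibre_pos[of a T] a assms(1) by (auto simp: divide_le_eq_1)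
qed simp

text \<open>The left side is H(X_j | X_T), and conditioning on fewer coordinates can only increase
  it. \<open>?r a\<close> is the ratio of the probabilities of a_j given a on T' and given a on T.
  As ln r \<le> r - 1, it suffices that these ratios add up to at most |A|.\<close>

lemma cond_ent_submodular:
  assumes "T' \<subseteq> T"
  shows "cond_ent A T - cond_ent A (insert j T) \<le> cond_ent A T' - cond_ent A (insert j T')"
proof -
  define N where "N = (\<lambda>T a. real (card (fibre A T a)))"
  have N: "0 < N T a" if "a \<in> A" for T a using card_fibre_pos[OF that] by (simp add: N_def)
  have N_sum: "N T a = (\<Sum>b\<in>A. of_bool (b \<in> fibre A T a))" for T a
  proof -
    have "{b \<in> A. b \<in> fibre A T a} = fibre A T a" by (auto simp: fibre_def)
    then show ?thesis using A(1) by (simp add: N_def of_bool_def sum.If_cases Int_def)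
  qed
  \<comment> \<open>Both factors of the numerator are written as counts, of b agreeing with a on T
    and of c agreeing with a on \<open>insert j T'\<close>, so that the sum over a can be taken
    first.\<close>
  define u where "u = (\<lambda>a b c. of_bool (b \<in> fibre A T a) * of_bool (c \<in> fibre A (insert j T') a) / (N (insert j T) a * N T' a))"
  let ?r = "\<lambda>a. N T a * N (insert j T') a / (N (insert j T) a * N T' a)"
  have "(\<Sum>a\<in>A. ?r a) = (\<Sum>a\<in>A. \<Sum>b\<in>A. \<Sum>c\<in>A. u a b c)"
    unfolding N_sum[of T] N_sum[of "insert j T'"]
    by (simp add: sum_product sum_divide_distrib u_def)
  also have "\<dots> = (\<Sum>a\<in>A. \<Sum>c\<in>A. \<Sum>b\<in>A. u a b c)"
    by (intro sum.cong refl sum.swap)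
  also have "\<dots> = (\<Sum>c\<in>A. \<Sum>a\<in>A. \<Sum>b\<in>A. u a b c)"
    by (rule sum.swap)
  also have "\<dots> = (\<Sum>c\<in>A. \<Sum>b\<in>A. \<Sum>a\<in>A. u a b c)"
    by (intro sum.cong refl sum.swap)
  also have "\<dots> \<le> (\<Sum>c\<in>A. \<Sum>b\<in>A. of_bool (b \<in> fibre A T' c) / N T' c)"
  proof (intro sum_mono)
    fix c b assume c: "c \<in> A" and b: "b \<in> A"
    \<comment> \<open>All a in \<open>?B\<close> agree on \<open>insert j T\<close> and hence lie in
      one fibre; over T' they share the fibre of c.\<close>
    let ?B = "{a \<in> A. b \<in> fibre A T a \<and> c \<in> fibre A (insert j T') a}"
    have "(\<Sum>a\<in>A. u a b c)
      = (\<Sum>a\<in>A. if b \<in> fibre A T a \<and> c \<in> fibre A (insert j T') a then 1 / (N (insert j T) a * N T' a) else 0)"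
      by (intro sum.cong) (auto simp: u_def)
    also have "\<dots> = (\<Sum>a\<in>?B. 1 / (N (insert j T) a * N T' a))"
      using A(1) by (simp add: sum.inter_filter)
    also have "\<dots> = (\<Sum>a\<in>?B. 1 / N (insert j T) a) / N T' c"
    proof -
      have "N T' a = N T' c" if "a \<in> ?B" for a
        using that fibre_cong[of c T' a] unfolding N_def by (auto simp: fibre_def)
      then show ?thesis by (simp add: sum_divide_distrib)
    qed
    also have "\<dots> \<le> of_bool (b \<in> fibre A T' c) / N T' c"
    proof (rule divide_right_mono)
      show "(\<Sum>a\<in>?B. 1 / N (insert j T) a) \<le> of_bool (b \<in> fibre A T' c)"
      proof (cases "?B = {}")
        case False
        then have "b \<in> fibre A T' c" using assms by (force simp: fibre_def)
        moreover have "(\<Sum>a\<in>?B. 1 / N (insert j T) a) \<le> 1"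
          unfolding N_def by (rule sum_inverse_fibre) (auto simp: fibre_def)
        ultimately show ?thesis by simp
      next
        case True
        show ?thesis unfolding True by simp
      qed
    qed (use N[OF c] in \<open>simp add: less_imp_le\<close>)
    finally show "(\<Sum>a\<in>A. u a b c)
      \<le> of_bool (b \<in> fibre A T' c) / N T' c" .
  qed
  also have "\<dots> = (\<Sum>c\<in>A. N T' c / N T' c)"
    by (simp add: N_sum[symmetric] sum_divide_distrib[symmetric])
  also have "\<dots> = (\<Sum>c\<in>A. 1)" by (intro sum.cong) (use N in \<open>auto simp: less_imp_neq[symmetric]\<close>)
  finally have le: "(\<Sum>a\<in>A. ?r a) \<le> card A" by simp
  have "(\<Sum>a\<in>A. ln (N T a) - ln (N (insert j T) a) - ln (N T' a) + ln (N (insert j T') a)) \<le> (\<Sum>a\<in>A. ?r a - 1)"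
  proof (rule sum_mono)
    fix a assume a: "a \<in> A"
    have "ln (?r a) \<le> ?r a - 1" using N[OF a] by (intro ln_le_minus_one) simp
    moreover have "ln (?r a) = ln (N T a) - ln (N (insert j T) a) - ln (N T' a) + ln (N (insert j T') a)"
    proof -
      have "N T a \<noteq> 0" "N T' a \<noteq> 0" "N (insert j T) a \<noteq> 0" "N (insert j T') a \<noteq> 0"
        using N[OF a] less_imp_neq by metis+
      then show ?thesis using N[OF a] by (simp add: ln_div ln_mult)
    qed
    ultimately show "ln (N T a) - ln (N (insert j T) a) - ln (N T' a) + ln (N (insert j T') a) \<le> ?r a - 1" by simp
  qed
  also have "\<dots> \<le> 0" using le by (simp add: sum_subtractf)
  finally have "((\<Sum>a\<in>A. ln (N T a)) - (\<Sum>a\<in>A. ln (N (insert j T) a))) / card A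
    \<le> ((\<Sum>a\<in>A. ln (N T' a)) - (\<Sum>a\<in>A. ln (N (insert j T') a))) / card A"
    by (intro divide_right_mono) (simp_all add: sum.distrib sum_subtractf)
  then show ?thesis by (simp add: cond_ent_def N_def diff_divide_distrib)
qed

lemma cond_ent_UNIV [simp]: "cond_ent A UNIV = 0"
proof -
  have "fibre A UNIV a = {a}" if "a \<in> A" for a using that by (auto simp: fibre_def)
  then show ?thesis by (simp add: cond_ent_def)
qed

lemma cond_ent_empty: "cond_ent A {} = ln (card A)"
proof -
  have "fibre A {} a = A" for a by (auto simp: fibre_def)
  then show ?thesis using cardA by (simp add: cond_ent_def)
qed

text \<open>The left side is the entropy of X_T, which is at most that of a uniform variable on its
  support. In terms of Gibbs' inequality: the reciprocals of the fibre sizes add up to the number of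
  fibres.\<close>

lemma card_projection_ge:
  "ln (card A) - cond_ent A T \<le> ln (card (proj T ` A))"
proof -
  let ?\<pi> = "proj T"
  have fib: "fibre A T a = {b \<in> A. ?\<pi> b = ?\<pi> a}" for a
    by (auto simp: fibre_def proj_def fun_eq_iff)
  have "(\<Sum>a\<in>A. 1 / real (card (fibre A T a))) = (\<Sum>u\<in>?\<pi> ` A. \<Sum>a\<in>{a \<in> A. ?\<pi> a = u}. 1 / real (card (fibre A T a)))"
    using A(1) by (rule sum.image_gen)
  also have "\<dots> = (\<Sum>u\<in>?\<pi> ` A. 1)"
  proof (rule sum.cong[OF refl])
    fix u assume "u \<in> ?\<pi> ` A"
    then obtain a where a: "a \<in> A" "u = ?\<pi> a" by blast
    have eq: "{b \<in> A. ?\<pi> b = u} = fibre A T a" using a fib by simp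
    have "(\<Sum>b\<in>fibre A T a. 1 / real (card (fibre A T b))) = (\<Sum>b\<in>fibre A T a. 1 / real (card (fibre A T a)))"
      by (intro sum.cong refl) (simp add: fibre_cong)
    also have "\<dots> = 1" using card_fibre_pos[OF a(1), of T] by (simp add: card_gt_0_iff)
    finally show "(\<Sum>b\<in>{b \<in> A. ?\<pi> b = u}. 1 / real (card (fibre A T b))) = 1" unfolding eq .
  qed
  finally have sum: "(\<Sum>a\<in>A. 1 / real (card (fibre A T a))) = card (?\<pi> ` A)" by simp
  have "(\<Sum>a\<in>A. 1 / real (card A) * ln (1 / real (card (fibre A T a))))
    \<le> ln (\<Sum>a\<in>A. 1 / real (card (fibre A T a))) + (\<Sum>a\<in>A. 1 / real (card A) * ln (1 / real (card A)))"
    using A card_fibre_pos by (intro gibbs_inequality) auto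
  also have "(\<Sum>a\<in>A. 1 / real (card A) * ln (1 / real (card (fibre A T a)))) = - cond_ent A T"
  proof -
    have "ln (1 / real (card (fibre A T a))) = - ln (real (card (fibre A T a)))" if "a \<in> A" for a
      using card_fibre_pos[OF that, of T] by (simp add: ln_div card_gt_0_iff)
    then show ?thesis by (simp add: cond_ent_def sum_negf sum_divide_distrib)
  qed
  also have "(\<Sum>a\<in>A. 1 / real (card A) * ln (1 / real (card A))) = - ln (card A)"
    using cardA by (simp add: ln_div)
  finally show ?thesis unfolding sum by simp
qed

text \<open>The chain rule along the enumeration \<open>index\<close> of the coordinates, with conditioning on fewer
  coordinates.\<close>

lemma projection_inequality:
  fixes E :: "'e set" and V :: "'e \<Rightarrow> 'n set" and w :: "'e \<Rightarrow> real" and n :: nat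
  assumes bound: "\<And>a j. a \<in> A \<Longrightarrow> a j \<le> n" and E: "finite E"
    and w: "\<And>e. e \<in> E \<Longrightarrow> 0 \<le> w e" and cov: "\<And>j. 1 \<le> (\<Sum>e | e \<in> E \<and> j \<in> V e. w e)"
  shows "((\<Sum>e\<in>E. w e) - 1) * ln (card A) \<le>
    ((\<Sum>e\<in>E. w e * card (V e)) - CARD('n)) * ln (real n + 1) +
    (\<Sum>e\<in>E. w e * ln (card (proj (- V e) ` A)))"
proof -
  define I where "I = (\<lambda>k. {j :: 'n. index j < k})"
  \<comment> \<open>\<open>D (index j)\<close> is the entropy of X_j given the coordinates that
    precede j.\<close>
  define D where "D = (\<lambda>k. cond_ent A (I k) - cond_ent A (I (Suc k)))"
  obtain m where m: "index j < m" for j :: 'n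
    using finite_nat_set_iff_bounded[of "range (index :: 'n \<Rightarrow> nat)"] by auto
  have I_Suc: "I (Suc (index j)) = insert j (I (index j))" for j
    using inj_index by (auto simp: I_def less_Suc_eq inj_def)
  have I_Suc': "I (Suc k) = I k" if "k \<notin> range (index :: 'n \<Rightarrow> nat)" for k
    using that by (auto simp: I_def less_Suc_eq)
  have Im: "I m = UNIV" "I 0 = {}" using m by (auto simp: I_def)
  have sumD: "(\<Sum>j\<in>UNIV. D (index (j :: 'n))) = ln (card A)"
  proof -
    have "(\<Sum>j\<in>UNIV. D (index (j :: 'n))) = (\<Sum>k\<in>range (index :: 'n \<Rightarrow> nat). D k)"
      by (simp add: sum.reindex[OF inj_index] o_def)
    also have "\<dots> = (\<Sum>k<m. D k)"
      using m I_Suc' by (intro sum.mono_neutral_left) (auto simp: D_def)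
    also have "\<dots> = cond_ent A (I 0) - cond_ent A (I m)"
      unfolding D_def by (rule sum_lessThan_telescope')
    finally show ?thesis by (simp add: Im cond_ent_empty)
  qed
  \<comment> \<open>A single coordinate has the values 0 to n only. This bound is spent on the
    excess c j - 1 of the covering, which is nonnegative.\<close>
  have D_le: "D (index j) \<le> ln (real n + 1)" for j :: 'n
  proof -
    have "D (index j) \<le> cond_ent A {} - cond_ent A {j}"
      unfolding D_def I_Suc by (rule cond_ent_submodular) simp
    also have "\<dots> \<le> ln (card (proj {j} ` A))"
      using card_projection_ge[of "{j}"] by (simp add: cond_ent_empty)
    also have "\<dots> \<le> ln (real n + 1)"
    proof -
      have "proj {j} ` A \<subseteq> (\<lambda>v i. if i \<in> {j} then v else (0 :: nat)) ` {..n}"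
        using bound by (fastforce simp: proj_def)
      then have "card (proj {j} ` A) \<le> card {..n}"
        by (meson card_image_le card_mono finite_atMost finite_imageI le_trans)
      moreover have "0 < card (proj {j} ` A)"
        using A by (simp add: card_gt_0_iff)
      ultimately show ?thesis by simp
    qed
    finally show ?thesis .
  qed
  \<comment> \<open>Given the coordinates outside V e, those in V e are revealed in order. Each is
    then conditioned on at least its predecessors, which bounds its entropy by
    \<open>D\<close>.\<close>
  have V_le: "ln (card A) - ln (card (proj (- V e) ` A)) \<le> (\<Sum>j\<in>V e. D (index j))" for e
  proof -
    have "cond_ent A (- V e) = (\<Sum>k<m. cond_ent A (- V e \<union> I k) - cond_ent A (- V e \<union> I (Suc k)))"
      by (subst sum_lessThan_telescope') (simp add: Im)
    also have "\<dots> \<le> (\<Sum>k<m. if k \<in> index ` V e then D k else 0)"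
    proof (rule sum_mono)
      fix k
      show "cond_ent A (- V e \<union> I k) - cond_ent A (- V e \<union> I (Suc k)) \<le> (if k \<in> index ` V e then D k else 0)"
      proof (cases "k \<in> index ` V e")
        case True
        then obtain j where j: "j \<in> V e" "k = index j" by blast
        have "cond_ent A (- V e \<union> I k) - cond_ent A (insert j (- V e \<union> I k)) \<le> D k"
          unfolding D_def j(2) I_Suc by (rule cond_ent_submodular) simp
        then show ?thesis using True j I_Suc by simp
      next
        case False
        have "- V e \<union> I (Suc k) = - V e \<union> I k"
        proof (cases "k \<in> range (index :: 'n \<Rightarrow> nat)")
          case True
          then obtain j where "k = index (j :: 'n)" by blast
          then show ?thesis using False I_Suc[of j] by auto
        qed (use I_Suc' in simp)
        then show ?thesis using False by simp
      qed
    qed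
    also have "\<dots> = (\<Sum>k\<in>{..<m} \<inter> index ` V e. D k)" by (simp add: sum.inter_restrict)
    also have "{..<m} \<inter> index ` V e = index ` V e" using m by auto
    also have "(\<Sum>k\<in>index ` V e. D k) = (\<Sum>j\<in>V e. D (index j))"
      using inj_index by (simp add: sum.reindex[OF inj_on_subset[OF inj_index]] o_def)
    finally show ?thesis using card_projection_ge[of "- V e"] by simp
  qed
  define c where "c = (\<lambda>j. \<Sum>e | e \<in> E \<and> j \<in> V e. w e)"
  have swap: "(\<Sum>e\<in>E. w e * (\<Sum>j\<in>V e. f j)) = (\<Sum>j\<in>UNIV. c j * f j)" for f :: "'n \<Rightarrow> real"
  proof -
    have "(\<Sum>e\<in>E. w e * (\<Sum>j\<in>V e. f j)) = (\<Sum>e\<in>E. \<Sum>j\<in>UNIV. if j \<in> V e then w e * f j else 0)"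
      by (simp add: sum_distrib_left sum.inter_restrict[symmetric])
    also have "\<dots> = (\<Sum>j\<in>UNIV. \<Sum>e\<in>E. if j \<in> V e then w e * f j else 0)" by (rule sum.swap)
    also have "\<dots> = (\<Sum>j\<in>UNIV. c j * f j)"
      unfolding c_def using E by (intro sum.cong refl) (simp add: sum.inter_filter[symmetric] sum_distrib_right)
    finally show ?thesis .
  qed
  have "(\<Sum>e\<in>E. w e * (ln (card A) - ln (card (proj (- V e) ` A))))
    \<le> (\<Sum>e\<in>E. w e * (\<Sum>j\<in>V e. D (index j)))"
    using w V_le by (intro sum_mono mult_left_mono) auto
  also have "\<dots> = (\<Sum>j\<in>UNIV. c j * D (index j))" by (rule swap)
  also have "\<dots> = ln (card A) + (\<Sum>j\<in>UNIV. (c j - 1) * D (index j))"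
    by (simp add: left_diff_distrib sum_subtractf sumD)
  also have "\<dots> \<le> ln (card A) + (\<Sum>j\<in>UNIV. (c j - 1) * ln (real n + 1))"
    using cov D_le by (intro add_left_mono sum_mono mult_left_mono) (auto simp: c_def)
  also have "(\<Sum>j\<in>UNIV. (c j - 1) * ln (real n + 1)) = ((\<Sum>j\<in>UNIV. c j * 1) - CARD('n)) * ln (real n + 1)"
    by (simp add: sum_distrib_right[symmetric] sum_subtractf)
  also have "(\<Sum>j\<in>UNIV. c j * 1) = (\<Sum>e\<in>E. w e * card (V e))"
    unfolding swap[symmetric] by simp
  finally show ?thesis
    by (simp add: right_diff_distrib sum_subtractf sum_distrib_right[symmetric] left_diff_distrib)
qed

end

section \<open>The weights of the points on the flats\<close>

text \<open>All that the geometry contributes to the upper bound, expressed by real weights on pairs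
  of a point and a flat so that it can be transported between fields. The weights take the flat as a
  set because several joints share it.\<close>

definition point_weights :: "('k::field ^ 'n::finite) set \<Rightarrow> ('k ^ 'n \<Rightarrow> real) \<Rightarrow> nat \<Rightarrow> 'e set \<Rightarrow> ('e \<Rightarrow> 'n set) \<Rightarrow>
    ('e \<Rightarrow> real) \<Rightarrow> ('k ^ 'n \<Rightarrow> ('k ^ 'n) set \<Rightarrow> real) \<Rightarrow> bool" where
  "point_weights J \<zeta> n E V w y \<longleftrightarrow>
     (\<forall>p F. 0 \<le> y p F) \<and>
     (\<forall>A S. invertible_affine A \<longrightarrow>
        (\<Sum>p\<in>J \<inter> A ` coords S. y p (A ` coords S)) \<le> real ((n + card J + card S) choose card S)) \<and>
     (\<forall>A. invertible_affine A \<and> A 0 \<in> J \<longrightarrow>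
        (\<forall>e\<in>E. 0 < y (A 0) (A ` coords (- V e))) \<and>
        ((\<Sum>e\<in>E. w e) - 1) * ln (\<zeta> (A 0) * real ((n + CARD('n)) choose CARD('n))) \<le>
        ((\<Sum>e\<in>E. w e * real (card (V e))) - real CARD('n)) * ln (real n + 1) +
        (\<Sum>e\<in>E. w e * ln (y (A 0) (A ` coords (- V e)))))"

text \<open>The weight is \<open>mass\<close>. At least \<zeta> p times the full dimension many
  leading exponents are counted at p, and their projections are leading exponents on the flats;
  \<open>projection_inequality\<close> compares these numbers.\<close>

lemma weights_infinite_field:
  fixes J :: "('k::field ^ 'n::finite) set" and \<zeta> :: "'k ^ 'n \<Rightarrow> real" and n :: nat
    and E :: "'e set" and V :: "'e \<Rightarrow> 'n set" and w :: "'e \<Rightarrow> real"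
  assumes inf: "infinite (UNIV :: 'k set)"
    and J: "finite J" "\<And>p. p \<in> J \<Longrightarrow> 0 < \<zeta> p" "(\<Sum>p\<in>J. \<zeta> p) = 1"
    and E: "finite E" and w: "\<And>e. e \<in> E \<Longrightarrow> 0 \<le> w e"
    and cov: "\<And>j. 1 \<le> (\<Sum>e | e \<in> E \<and> j \<in> V e. w e)"
  shows "\<exists>y. point_weights J \<zeta> n E V w y"
proof -
  let ?K = "real ((n + CARD('n)) choose CARD('n))"
  obtain \<beta> where \<beta>: "\<And>p. p \<in> J \<Longrightarrow> \<zeta> p * ?K \<le> real (mass UNIV n J \<beta> p)"
    using balanced_delays[OF inf J] by blast
  define y where "y = (\<lambda>p F. real (mass F n J \<beta> p))"
  have W: "1 \<le> (\<Sum>e\<in>E. w e)"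
  proof -
    fix j
    have "1 \<le> (\<Sum>e | e \<in> E \<and> j \<in> V e. w e)" by (rule cov)
    also have "\<dots> \<le> (\<Sum>e\<in>E. w e)" using E w by (intro sum_mono2) auto
    finally show ?thesis .
  qed
  have "point_weights J \<zeta> n E V w y"
    unfolding point_weights_def
  proof (intro conjI allI impI)
    fix A :: "'k ^ 'n \<Rightarrow> 'k ^ 'n" and S :: "'n set" assume "invertible_affine A"
    then have "frame A (A 0) S (A ` coords S)" by (simp add: frame_def)
    then show "(\<Sum>p\<in>J \<inter> A ` coords S. y p (A ` coords S)) \<le> real ((n + card J + card S) choose card S)"
      using sum_mass_le[OF inf _ J(1), of A "A 0" S "A ` coords S" n \<beta>] by (simp add: y_def flip: of_nat_sum)
  next
    fix A :: "'k ^ 'n \<Rightarrow> 'k ^ 'n" assume "invertible_affine A \<and> A 0 \<in> J"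
    then have A: "invertible_affine A" "A 0 \<in> J" by simp_all
    have fr: "frame A (A 0) UNIV UNIV" using A(1) by (rule frame_affine)
    let ?M = "lead_set A UNIV n J \<beta> (A 0)"
    have card_M: "\<zeta> (A 0) * ?K \<le> real (card ?M)"
      using \<beta>[OF A(2)] card_lead_set[OF inf fr A(2)] by simp
    have pos: "0 < \<zeta> (A 0) * ?K"
      using J(2)[OF A(2)] by (simp add: zero_less_binomial_iff)
    have "0 < card ?M" using card_M pos by linarith
    then have M: "finite ?M" "?M \<noteq> {}" by (simp_all add: card_gt_0_iff)
    have proj: "real (card (proj S ` ?M)) \<le> y (A 0) (A ` coords S)" "0 < card (proj S ` ?M)" for S
    proof -
      have "proj S ` ?M \<subseteq> lead_set A S n J \<beta> (A 0)"
        using lead_set_proj[OF inf fr] by auto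
      moreover have "finite (lead_set A S n J \<beta> (A 0))" by (simp add: lead_set_def)
      moreover have "frame A (A 0) S (A ` coords S)" using fr by (simp add: frame_def)
      ultimately show "real (card (proj S ` ?M)) \<le> y (A 0) (A ` coords S)"
        unfolding y_def using card_lead_set[OF inf _ A(2), of A S "A ` coords S" n \<beta>] card_mono by fastforce
      show "0 < card (proj S ` ?M)" using M by (simp add: card_gt_0_iff)
    qed
    show "\<forall>e\<in>E. 0 < y (A 0) (A ` coords (- V e))"
      using proj by (metis of_nat_0_less_iff order_less_le_trans)
    have "((\<Sum>e\<in>E. w e) - 1) * ln (\<zeta> (A 0) * ?K) \<le> ((\<Sum>e\<in>E. w e) - 1) * ln (card ?M)"
      using W card_M pos by (intro mult_left_mono ln_mono) auto
    also have "\<dots> \<le> ((\<Sum>e\<in>E. w e * real (card (V e))) - real CARD('n)) * ln (real n + 1) +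
      (\<Sum>e\<in>E. w e * ln (card (proj (- V e) ` ?M)))"
    proof (rule projection_inequality[OF M _ E w cov])
      show "a j \<le> n" if "a \<in> ?M" for a j
        using that deg_component_le[of a j] by (auto simp: lead_set_def Exps_def)
    qed
    also have "\<dots> \<le> ((\<Sum>e\<in>E. w e * real (card (V e))) - real CARD('n)) * ln (real n + 1) +
      (\<Sum>e\<in>E. w e * ln (y (A 0) (A ` coords (- V e))))"
      using proj by (intro add_left_mono sum_mono mult_left_mono w ln_mono) simp_all
    finally show "((\<Sum>e\<in>E. w e) - 1) * ln (\<zeta> (A 0) * ?K) \<le> \<dots>" .
  qed (simp add: y_def)
  then show ?thesis by blast
qed

section \<open>Extension of scalars to the field of rational functions\<close>

definition emb :: "'a::field \<Rightarrow> 'a poly fract" where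
  "emb a = Fract [:a:] 1"

lemma emb_0 [simp]: "emb 0 = 0" and emb_1 [simp]: "emb 1 = 1"
  by (simp_all add: emb_def Zero_fract_def One_fract_def one_pCons)

lemma emb_add: "emb (a + b) = emb a + emb b"
  by (simp add: emb_def)

lemma emb_mult: "emb (a * b) = emb a * emb b"
  by (simp add: emb_def mult.commute)

lemma emb_eq_iff [simp]: "emb a = emb b \<longleftrightarrow> a = b"
  by (simp add: emb_def eq_fract)

lemma emb_sum: "emb (\<Sum>i\<in>I. f i) = (\<Sum>i\<in>I. emb (f i))"
  by (induction I rule: infinite_finite_induct) (simp_all add: emb_add)

lemma infinite_fract: "infinite (UNIV :: 'a::field poly fract set)"
proof -
  have "inj (\<lambda>n :: nat. Fract (monom 1 n) (1 :: 'a poly))"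
    by (auto simp: inj_def eq_fract monom_eq_iff')
  then show ?thesis using finite_subset[OF subset_UNIV] range_inj_infinite by blast
qed

definition emb_vec :: "'a::field ^ 'n::finite \<Rightarrow> 'a poly fract ^ 'n" where
  "emb_vec x = (\<chi> i. emb (x $ i))"

definition emb_mat :: "'a::field ^ 'n::finite ^ 'n \<Rightarrow> 'a poly fract ^ 'n ^ 'n" where
  "emb_mat M = (\<chi> i. emb_vec (M $ i))"

text \<open>The points over F(t) satisfying every affine equation over F that holds on the flat.
  Thus the extension depends on the flat alone and not on a chart.\<close>

definition emb_flat :: "('a::field ^ 'n::finite) set \<Rightarrow> ('a poly fract ^ 'n) set" where
  "emb_flat F = {x. \<forall>a b. (\<forall>s\<in>F. (\<Sum>j\<in>UNIV. a $ j * s $ j) + b = 0) \<longrightarrow>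
     (\<Sum>j\<in>UNIV. emb (a $ j) * x $ j) + emb b = 0}"

lemma emb_vec_in_emb_flat: "p \<in> F \<Longrightarrow> emb_vec p \<in> emb_flat F"
  unfolding emb_flat_def emb_vec_def by (simp flip: emb_mult emb_sum emb_add)

lemma inj_emb_vec: "inj emb_vec"
  by (auto simp: inj_def emb_vec_def vec_eq_iff)

lemma emb_mat_mult: "emb_mat (M ** N) = emb_mat M ** emb_mat N"
  by (simp add: emb_mat_def emb_vec_def matrix_matrix_mult_def vec_eq_iff emb_sum emb_mult)

lemma emb_mat_1: "emb_mat (mat 1) = mat 1"
  by (simp add: emb_mat_def emb_vec_def mat_def vec_eq_iff)

text \<open>The matrix of A, read over F(t), gives the chart. For one inclusion the rows of the
  inverse matrix serve as equations of the flat. For the other, an equation of the flat is written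
  in the coordinates of A, where its constant and its coefficients on S vanish.\<close>

lemma emb_frame:
  fixes A :: "'a::field ^ 'n::finite \<Rightarrow> 'a ^ 'n"
  assumes "invertible_affine A" "A 0 = p"
  obtains B where "invertible_affine B" "B 0 = emb_vec p" "\<And>S. emb_flat (A ` coords S) = B ` coords S"
proof -
  obtain M where M: "invertible M" "\<And>x. A x = M *v x + p"
    using assms by (auto simp: invertible_affine_def)
  obtain M' where M': "M ** M' = mat 1" "M' ** M = mat 1" using M(1) by (auto simp: invertible_def)
  define B where "B = (\<lambda>x. emb_mat M *v x + emb_vec p)"
  have inv: "emb_mat M ** emb_mat M' = mat 1" "emb_mat M' ** emb_mat M = mat 1"
    using M' by (simp_all flip: emb_mat_mult add: emb_mat_1)
  then have "invertible (emb_mat M)" by (auto simp: invertible_def)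
  then have "invertible_affine B" unfolding invertible_affine_def B_def by blast
  moreover have "B 0 = emb_vec p" by (simp add: B_def)
  moreover have "emb_flat (A ` coords S) = B ` coords S" for S
  proof (intro subset_antisym subsetI)
    fix x assume x: "x \<in> emb_flat (A ` coords S)"
    define z where "z = emb_mat M' *v (x - emb_vec p)"
    have "B z = x" using inv by (simp add: B_def z_def matrix_vector_mul_assoc)
    moreover have "z \<in> coords S"
      unfolding coords_def
    proof (intro CollectI allI impI)
      fix j assume j: "j \<notin> S"
      define a where "a = M' $ j"
      define b where "b = - (M' *v p) $ j"
      have "(\<Sum>i\<in>UNIV. a $ i * s $ i) + b = 0" if "s \<in> A ` coords S" for s
      proof -
        obtain u where u: "u \<in> coords S" "s = A u" using \<open>s \<in> _\<close> by blast
        have "(M' *v s) $ j = (M' *v (M *v u)) $ j + (M' *v p) $ j"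
          by (simp add: u M(2) matrix_vector_right_distrib)
        also have "(M' *v (M *v u)) $ j = 0"
          using u j by (simp add: matrix_vector_mul_assoc M' coords_def)
        finally show ?thesis by (simp add: a_def b_def matrix_vector_mult_def)
      qed
      then have "(\<Sum>i\<in>UNIV. emb (a $ i) * x $ i) + emb b = 0" using x by (simp add: emb_flat_def)
      moreover have "emb b = - (emb_mat M' *v emb_vec p) $ j"
      proof -
        have "emb b + (emb_mat M' *v emb_vec p) $ j = emb (b + (M' *v p) $ j)"
          by (simp add: emb_add emb_mat_def emb_vec_def matrix_vector_mult_def emb_sum emb_mult)
        then show ?thesis by (simp add: b_def eq_neg_iff_add_eq_0)
      qed
      ultimately show "z $ j = 0"
        by (simp add: z_def matrix_vector_mult_diff_distrib a_def)
          (simp add: matrix_vector_mult_def emb_mat_def emb_vec_def)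
    qed
    ultimately show "x \<in> B ` coords S" by blast
  next
    fix x assume "x \<in> B ` coords S"
    then obtain z where z: "z \<in> coords S" "x = B z" by blast
    show "x \<in> emb_flat (A ` coords S)"
      unfolding emb_flat_def
    proof (intro CollectI allI impI)
      fix a :: "'a ^ 'n" and b :: 'a assume ab: "\<forall>s\<in>A ` coords S. (\<Sum>j\<in>UNIV. a $ j * s $ j) + b = 0"
      define c where "c = (\<lambda>i. \<Sum>j\<in>UNIV. a $ j * M $ j $ i)"
      define c0 where "c0 = (\<Sum>j\<in>UNIV. a $ j * p $ j) + b"
      have expand: "(\<Sum>j\<in>UNIV. a $ j * (A u) $ j) + b = (\<Sum>i\<in>UNIV. c i * u $ i) + c0" for u
      proof -
        have "(\<Sum>j\<in>UNIV. a $ j * (M *v u) $ j) = (\<Sum>j\<in>UNIV. \<Sum>i\<in>UNIV. a $ j * M $ j $ i * u $ i)"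
          by (simp add: matrix_vector_mult_def sum_distrib_left mult.assoc)
        also have "\<dots> = (\<Sum>i\<in>UNIV. c i * u $ i)"
          by (subst sum.swap) (simp add: c_def sum_distrib_right)
        finally show ?thesis by (simp add: M(2) c0_def algebra_simps sum.distrib)
      qed
      have "A 0 \<in> A ` coords S" by (rule imageI) simp
      then have c0: "c0 = 0" using ab expand[of 0] by simp
      have c: "c i = 0" if "i \<in> S" for i
      proof -
        have "axis i 1 \<in> (coords S :: ('a ^ 'n) set)" using that by (auto simp: coords_def axis_def)
        then have "(\<Sum>j\<in>UNIV. c j * axis i 1 $ j) + c0 = 0" using ab expand[of "axis i 1"] by auto
        then show ?thesis using c0 by (simp add: axis_def if_distrib[of "(*) _"] cong: if_cong)
      qed
      have "(\<Sum>j\<in>UNIV. emb (a $ j) * x $ j) + emb b = (\<Sum>i\<in>UNIV. emb (c i) * z $ i) + emb c0"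
      proof -
        have "(\<Sum>j\<in>UNIV. emb (a $ j) * (emb_mat M *v z) $ j) =
          (\<Sum>j\<in>UNIV. \<Sum>i\<in>UNIV. emb (a $ j * M $ j $ i) * z $ i)"
          by (simp add: matrix_vector_mult_def emb_mat_def emb_vec_def sum_distrib_left mult.assoc emb_mult)
        also have "\<dots> = (\<Sum>i\<in>UNIV. emb (c i) * z $ i)"
          by (subst sum.swap) (simp add: c_def sum_distrib_right emb_sum)
        moreover have "emb c0 = (\<Sum>j\<in>UNIV. emb (a $ j) * emb_vec p $ j) + emb b"
          by (simp add: c0_def emb_add emb_sum emb_mult emb_vec_def)
        ultimately show ?thesis by (simp add: z B_def algebra_simps sum.distrib)
      qed
      also have "\<dots> = 0"
      proof -
        have "emb (c i) * z $ i = 0" for i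
          using c[of i] z(1) by (cases "i \<in> S") (auto simp: coords_def)
        then have "(\<Sum>i\<in>UNIV. emb (c i) * z $ i) = 0" by (intro sum.neutral) blast
        then show ?thesis using c0 by simp
      qed
      finally show "(\<Sum>j\<in>UNIV. emb (a $ j) * x $ j) + emb b = 0" .
    qed
  qed
  ultimately show ?thesis using that by blast
qed

lemma weights_exist:
  fixes J :: "('a::field ^ 'n::finite) set" and \<zeta> :: "'a ^ 'n \<Rightarrow> real" and n :: nat
    and E :: "'e set" and V :: "'e \<Rightarrow> 'n set" and w :: "'e \<Rightarrow> real"
  assumes J: "finite J" "\<And>p. p \<in> J \<Longrightarrow> 0 < \<zeta> p" "(\<Sum>p\<in>J. \<zeta> p) = 1"
    and E: "finite E" and w: "\<And>e. e \<in> E \<Longrightarrow> 0 \<le> w e"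
    and cov: "\<And>j. 1 \<le> (\<Sum>e | e \<in> E \<and> j \<in> V e. w e)"
  shows "\<exists>y. point_weights J \<zeta> n E V w y"
proof -
  define \<zeta>' where "\<zeta>' = (\<lambda>q. \<zeta> (inv emb_vec q))"
  have inv [simp]: "inv emb_vec (emb_vec p) = p" for p :: "'a ^ 'n" by (simp add: inj_emb_vec)
  have injJ: "inj_on emb_vec B" for B :: "('a ^ 'n) set" using inj_emb_vec inj_on_subset by blast
  have J': "finite (emb_vec ` J)" "\<And>p. p \<in> emb_vec ` J \<Longrightarrow> 0 < \<zeta>' p" "(\<Sum>p\<in>emb_vec ` J. \<zeta>' p) = 1"
    using J by (auto simp: \<zeta>'_def sum.reindex[OF injJ])
  obtain y where y: "point_weights (emb_vec ` J) \<zeta>' n E V w y"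
    using weights_infinite_field[OF infinite_fract J' E w cov, of n] by blast
  define y' where "y' = (\<lambda>p F. y (emb_vec p) (emb_flat F))"
  have y_nonneg: "0 \<le> y p F" for p F using y by (simp add: point_weights_def)
  have "point_weights J \<zeta> n E V w y'"
    unfolding point_weights_def
  proof (intro conjI allI impI)
    fix A :: "'a ^ 'n \<Rightarrow> 'a ^ 'n" and S :: "'n set" assume "invertible_affine A"
    then obtain B where B: "invertible_affine B" "emb_flat (A ` coords S) = B ` coords S"
      using emb_frame[of A "A 0"] by metis
    let ?F = "A ` coords S"
    have "(\<Sum>p\<in>J \<inter> ?F. y' p ?F) = (\<Sum>q\<in>emb_vec ` (J \<inter> ?F). y q (emb_flat ?F))"
      by (simp add: sum.reindex[OF injJ] y'_def)
    also have "\<dots> \<le> (\<Sum>q\<in>emb_vec ` J \<inter> emb_flat ?F. y q (emb_flat ?F))"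
      using J(1) y_nonneg emb_vec_in_emb_flat[of _ ?F] by (intro sum_mono2) blast+
    also have "\<dots> \<le> real ((n + card J + card S) choose card S)"
      using y B by (simp add: point_weights_def card_image[OF injJ])
    finally show "(\<Sum>p\<in>J \<inter> ?F. y' p ?F) \<le> real ((n + card J + card S) choose card S)" .
  next
    fix A :: "'a ^ 'n \<Rightarrow> 'a ^ 'n" assume A: "invertible_affine A \<and> A 0 \<in> J"
    then obtain B where B: "invertible_affine B" "B 0 = emb_vec (A 0)" "\<And>S. emb_flat (A ` coords S) = B ` coords S"
      using emb_frame[of A "A 0"] by metis
    then have "B 0 \<in> emb_vec ` J" using A by simp
    then have *: "(\<forall>e\<in>E. 0 < y (B 0) (B ` coords (- V e))) \<and>
        ((\<Sum>e\<in>E. w e) - 1) * ln (\<zeta>' (B 0) * real ((n + CARD('n)) choose CARD('n))) \<le>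
        ((\<Sum>e\<in>E. w e * real (card (V e))) - real CARD('n)) * ln (real n + 1) +
        (\<Sum>e\<in>E. w e * ln (y (B 0) (B ` coords (- V e))))"
      using y B(1) unfolding point_weights_def by blast
    have y_eq: "y' (A 0) (A ` coords S) = y (B 0) (B ` coords S)" and \<zeta>_eq: "\<zeta> (A 0) = \<zeta>' (B 0)" for S
      by (simp_all add: y'_def B \<zeta>'_def)
    show "\<forall>e\<in>E. 0 < y' (A 0) (A ` coords (- V e))" unfolding y_eq using * by blast
    show "((\<Sum>e\<in>E. w e) - 1) * ln (\<zeta> (A 0) * real ((n + CARD('n)) choose CARD('n))) \<le>
        ((\<Sum>e\<in>E. w e * real (card (V e))) - real CARD('n)) * ln (real n + 1) +
        (\<Sum>e\<in>E. w e * ln (y' (A 0) (A ` coords (- V e))))"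
      unfolding y_eq \<zeta>_eq using * by blast
  qed (simp add: y'_def y_nonneg)
  then show ?thesis by blast
qed

section \<open>Entropies of random tuples\<close>

lemma rpow_eq_exp: "0 < x \<Longrightarrow> rpow x a = exp (a * ln x)"
  by (simp add: rpow_def powr_def)

text \<open>The logarithm of a binomial coefficient without its growth k ln (n + 1). The shift s
  absorbs the number of joints in the upper bound and the dimension k i in the sharpness proof, and
  does not influence the limit.\<close>

definition ln_defect :: "nat \<Rightarrow> nat \<Rightarrow> nat \<Rightarrow> real" where
  "ln_defect s k n = ln (real ((n + s + k) choose k)) - real k * ln (real n + 1)"

lemma ln_defect_limit: "ln_defect s k \<longlonglongrightarrow> - ln (fact k)"
proof (induction k)
  case (Suc k)
  have eq: "ln_defect s (Suc k) n = ln_defect s k n +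
      (ln ((real n + real (s + k + 1)) / (real n + 1)) - ln (real (Suc k)))" for n
  proof -
    let ?a = "real n + real (s + k + 1)" and ?b = "real ((n + s + k) choose k)"
    have "Suc k * ((n + s + Suc k) choose Suc k) = (n + s + k + 1) * ((n + s + k) choose k)"
      using Suc_times_binomial_eq[of "n + s + k" k] by (simp add: mult.commute)
    then have "real (Suc k) * real ((n + s + Suc k) choose Suc k) = ?a * ?b"
      by (metis (no_types, opaque_lifting) add.assoc of_nat_add of_nat_mult)
    then have step: "real ((n + s + Suc k) choose Suc k) = ?a * ?b / real (Suc k)"
      by (simp add: field_simps del: of_nat_Suc binomial_Suc_Suc)
    have pos: "?b > 0" "?a > 0" "real (Suc k) > 0" "real n + 1 > 0"
      by (simp_all add: zero_less_binomial_iff)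
    have "ln (?a * ?b / real (Suc k)) = ln ?a + ln ?b - ln (real (Suc k))"
      using pos by (subst ln_div, simp_all only: zero_less_mult_iff, simp_all add: ln_mult del: of_nat_Suc of_nat_add)
    moreover have "ln (?a / (real n + 1)) = ln ?a - ln (real n + 1)"
      using pos by (simp add: ln_div)
    moreover have "real (Suc k) * ln (real n + 1) = real k * ln (real n + 1) + ln (real n + 1)"
      by (simp add: algebra_simps)
    ultimately show ?thesis unfolding step ln_defect_def by linarith
  qed
  have "(\<lambda>n. ln ((real n + real (s + k + 1)) / (real n + 1))) \<longlonglongrightarrow> 0" by real_asymp
  then have "(\<lambda>n. ln_defect s k n +
      (ln ((real n + real (s + k + 1)) / (real n + 1)) - ln (real (Suc k)))) \<longlonglongrightarrow>
      - ln (fact k) + (0 - ln (real (Suc k)))"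
    by (intro tendsto_intros Suc)
  then show ?case unfolding eq[symmetric] by (simp add: ln_mult algebra_simps del: of_nat_Suc)
qed (simp add: ln_defect_def)

lemma span_axis_eq_coords:
  "vec.span {axis j 1 | j. j \<notin> S} = (coords (- S) :: ('a::field ^ 'n::finite) set)"
proof
  show "vec.span {axis j 1 | j. j \<notin> S} \<subseteq> (coords (- S) :: ('a ^ 'n) set)"
    by (rule vec.span_minimal) (auto simp: coords_def axis_def vec.subspace_def)
next
  show "(coords (- S) :: ('a ^ 'n) set) \<subseteq> vec.span {axis j 1 | j. j \<notin> S}"
  proof
    fix x :: "'a ^ 'n" assume x: "x \<in> coords (- S)"
    have "x = (\<Sum>j\<in>UNIV. x $ j *s axis j 1)"
      by (simp add: basis_expansion)
    also have "\<dots> = (\<Sum>j\<in>- S. x $ j *s axis j 1)"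
      using x by (intro sum.mono_neutral_right) (auto simp: coords_def)
    also have "\<dots> \<in> vec.span {axis j 1 | j. j \<notin> S}"
      by (intro vec.span_sum vec.span_scale vec.span_base) auto
    finally show "x \<in> vec.span {axis j 1 | j. j \<notin> S}" .
  qed
qed

section \<open>Laws and entropies attached to a weighted hypergraph\<close>

locale weighted_hypergraph =
  fixes H :: "('e, 'n::finite) chypergraph" and k :: "nat \<Rightarrow> nat" and w :: "'e \<Rightarrow> real"
  assumes unif: "uniform_chypergraph H k" and cov: "covers H w"
begin

abbreviation "I \<equiv> {1..ncolours H}"
abbreviation "C \<equiv> colour_class H"
abbreviation "W \<equiv> subtotal H w"

text \<open>\<open>- \<Sum>\<^sub>i W i H(e\<^sub>i)\<close> in nats.\<close>

definition "edge_term = (\<Sum>i\<in>I. \<Sum>e\<in>C i. w e * ln (w e / W i))"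

text \<open>The law of the flat at the random edge of colour i, for a tuple with law \<mu>. The
  edges of the other colours are left out.\<close>

definition label_pmf :: "('e \<Rightarrow> 'f) pmf \<Rightarrow> nat \<Rightarrow> 'f pmf" where
  "label_pmf \<mu> i = map_pmf (\<lambda>(T, e). T e) (pair_pmf \<mu> (edge_pmf H w i))"

lemma finite_edges: "finite (edges H)"
  using unif by (simp add: uniform_chypergraph_def)

lemma finite_C [simp]: "finite (C i)"
  using finite_edges by (simp add: colour_class_def)

lemma C_nonempty: "i \<in> I \<Longrightarrow> C i \<noteq> {}"
  using unif by (simp add: uniform_chypergraph_def)

lemma w_nonneg: "e \<in> edges H \<Longrightarrow> 0 \<le> w e"
  using cov by (simp add: covers_def)

lemma C_edges: "e \<in> C i \<Longrightarrow> e \<in> edges H"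
  by (simp add: colour_class_def)

lemma W_nonneg: "0 \<le> W i"
  unfolding subtotal_def using w_nonneg C_edges by (intro sum_nonneg) auto

lemma W_zero: "W i = 0 \<Longrightarrow> e \<in> C i \<Longrightarrow> w e = 0"
  unfolding subtotal_def using sum_nonneg_eq_0_iff[of "C i" w] w_nonneg C_edges by auto

lemma sum_edges: "(\<Sum>e\<in>edges H. f e) = (\<Sum>i\<in>I. \<Sum>e\<in>C i. f e)"
proof -
  have "edges H = (\<Union>i\<in>I. C i)"
    using unif by (auto simp: uniform_chypergraph_def colour_class_def)
  moreover have "(\<Sum>e\<in>(\<Union>i\<in>I. C i). f e) = (\<Sum>i\<in>I. \<Sum>e\<in>C i. f e)"
    by (rule sum.UNION_disjoint) (simp_all, auto simp: colour_class_def)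
  ultimately show ?thesis by simp
qed

lemma total_eq: "total_weight H w = (\<Sum>i\<in>I. W i)"
  by (simp add: total_weight_def subtotal_def sum_edges)

lemma pmf_edge_pmf:
  assumes "0 < W i"
  shows "pmf (edge_pmf H w i) e = (if e \<in> C i then w e / W i else 0)"
  unfolding edge_pmf_def
proof (rule pmf_embed_pmf)
  show "0 \<le> (if e \<in> C i then w e / W i else 0)" for e
    using w_nonneg C_edges W_nonneg by auto
  have "(\<integral>\<^sup>+e. ennreal (if e \<in> C i then w e / W i else 0) \<partial>count_space UNIV) =
      (\<integral>\<^sup>+e. ennreal (w e / W i) * indicator (C i) e \<partial>count_space UNIV)"
    by (intro nn_integral_cong) (auto simp: indicator_def)
  also have "\<dots> = (\<integral>\<^sup>+e. ennreal (w e / W i) \<partial>count_space (C i))"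
    by (simp add: nn_integral_count_space_indicator)
  also have "\<dots> = (\<Sum>e\<in>C i. ennreal (w e / W i))"
    by (rule nn_integral_count_space_finite) simp
  also have "\<dots> = ennreal (\<Sum>e\<in>C i. w e / W i)"
    using w_nonneg C_edges W_nonneg by (intro sum_ennreal) auto
  also have "(\<Sum>e\<in>C i. w e / W i) = 1"
    using assms by (simp add: sum_divide_distrib[symmetric] flip: subtotal_def)
  finally show "(\<integral>\<^sup>+e. ennreal (if e \<in> C i then w e / W i else 0) \<partial>count_space UNIV) = 1" by simp
qed

lemma set_edge_pmf: "0 < W i \<Longrightarrow> set_pmf (edge_pmf H w i) \<subseteq> C i"
  by (auto simp: set_pmf_eq pmf_edge_pmf)

lemma finite_set_label:
  assumes "finite (set_pmf \<mu>)" "0 < W i"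
  shows "finite (set_pmf (label_pmf \<mu> i))"
  using assms finite_subset[OF set_edge_pmf[OF assms(2)]] by (simp add: label_pmf_def)

lemma set_label_pmf:
  assumes "0 < W i" "x \<in> set_pmf (label_pmf \<mu> i)"
  obtains T e where "T \<in> set_pmf \<mu>" "e \<in> C i" "x = T e"
  using assms set_edge_pmf[OF assms(1)] by (auto simp: label_pmf_def)

text \<open>The factor W i clears the denominator in the law of e_i, so expectations over the random
  edge become sums weighted by w.\<close>

lemma sum_label_pmf:
  fixes f :: "'f \<Rightarrow> real"
  assumes fin: "finite (set_pmf \<mu>)" and W: "0 < W i"
    and X: "finite X" "set_pmf (label_pmf \<mu> i) \<subseteq> X"
  shows "W i * (\<Sum>x\<in>X. pmf (label_pmf \<mu> i) x * f x) =
    (\<Sum>T\<in>set_pmf \<mu>. pmf \<mu> T * (\<Sum>e\<in>C i. w e * f (T e)))"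
proof -
  have "(\<Sum>x\<in>X. pmf (label_pmf \<mu> i) x * f x) = measure_pmf.expectation (label_pmf \<mu> i) f"
    using X by (subst integral_measure_pmf[OF X(1)]) auto
  also have "\<dots> = measure_pmf.expectation (pair_pmf \<mu> (edge_pmf H w i)) (\<lambda>(T, e). f (T e))"
    unfolding label_pmf_def by (simp add: case_prod_unfold)
  also have "\<dots> = (\<Sum>(T, e)\<in>set_pmf \<mu> \<times> C i. pmf \<mu> T * (w e / W i) * f (T e))"
    using set_edge_pmf[OF W] fin
    by (subst integral_measure_pmf[of "set_pmf \<mu> \<times> C i"])
      (auto intro!: sum.cong simp: pmf_pair pmf_edge_pmf[OF W])
  also have "\<dots> = (\<Sum>T\<in>set_pmf \<mu>. pmf \<mu> T * (\<Sum>e\<in>C i. w e / W i * f (T e)))"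
    by (simp add: sum.cartesian_product[symmetric] sum_distrib_left mult.assoc)
  also have "\<dots> = (\<Sum>T\<in>set_pmf \<mu>. pmf \<mu> T * (\<Sum>e\<in>C i. w e * f (T e))) / W i"
    by (simp add: sum_divide_distrib sum_distrib_left)
  finally show ?thesis using W by simp
qed

lemma map_edge_pmf:
  assumes "i \<in> I"
  shows "map_pmf (\<lambda>(T, \<epsilon>). \<epsilon> i) (tuple_edges_pmf H w \<mu>) = edge_pmf H w i"
    and "map_pmf (\<lambda>(T, \<epsilon>). T (\<epsilon> i)) (tuple_edges_pmf H w \<mu>) = label_pmf \<mu> i"
proof -
  let ?P = "Pi_pmf I undefined (edge_pmf H w)"
  have comp: "map_pmf (\<lambda>\<epsilon>. \<epsilon> i) ?P = edge_pmf H w i"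
    using assms by (simp add: Pi_pmf_component)
  have "map_pmf (\<lambda>(T, \<epsilon>). \<epsilon> i) (tuple_edges_pmf H w \<mu>) = map_pmf (\<lambda>\<epsilon>. \<epsilon> i) (map_pmf snd (pair_pmf \<mu> ?P))"
    unfolding tuple_edges_pmf_def pmf.map_comp by (intro map_pmf_cong) auto
  then show "map_pmf (\<lambda>(T, \<epsilon>). \<epsilon> i) (tuple_edges_pmf H w \<mu>) = edge_pmf H w i"
    unfolding map_snd_pair_pmf comp .
  have "pair_pmf \<mu> (edge_pmf H w i) = map_pmf (\<lambda>(T, \<epsilon>). (T, \<epsilon> i)) (pair_pmf \<mu> ?P)"
    unfolding comp[symmetric] by (simp add: pair_map_pmf2 case_prod_beta apsnd_def map_prod_def)
  then show "map_pmf (\<lambda>(T, \<epsilon>). T (\<epsilon> i)) (tuple_edges_pmf H w \<mu>) = label_pmf \<mu> i"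
    unfolding label_pmf_def tuple_edges_pmf_def by (simp add: pmf.map_comp o_def case_prod_unfold)
qed

text \<open>The edge entropies do not depend on \<mu> and enter as \<open>edge_term\<close>; this is
  how the factors w(e) / W_i get into the constant.\<close>

lemma tuple_score_nats:
  assumes fin: "finite (set_pmf \<mu>)"
  shows "ln 2 * tuple_score H w \<mu> = edge_term -
    (\<Sum>i\<in>I. W i * (\<Sum>x\<in>set_pmf (label_pmf \<mu> i). pmf (label_pmf \<mu> i) x * ln (pmf (label_pmf \<mu> i) x)))"
proof -
  have "ln 2 * (W i * (shannon_entropy (tuple_edges_pmf H w \<mu>) (\<lambda>(T, \<epsilon>). T (\<epsilon> i)) -
         shannon_entropy (tuple_edges_pmf H w \<mu>) (\<lambda>(T, \<epsilon>). \<epsilon> i))) =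
    (\<Sum>e\<in>C i. w e * ln (w e / W i)) -
    W i * (\<Sum>x\<in>set_pmf (label_pmf \<mu> i). pmf (label_pmf \<mu> i) x * ln (pmf (label_pmf \<mu> i) x))"
    if i: "i \<in> I" for i
  proof (cases "W i = 0")
    \<comment> \<open>Here the law of e_i is unspecified, but its entropies are multiplied by W i =
      0.\<close>
    case True
    then show ?thesis using W_zero by simp
  next
    case False
    then have W: "0 < W i" using W_nonneg[of i] by simp
    have fin_e: "finite (set_pmf (edge_pmf H w i))" using finite_subset[OF set_edge_pmf[OF W]] by simp
    have 1: "shannon_entropy (tuple_edges_pmf H w \<mu>) (\<lambda>(T, \<epsilon>). T (\<epsilon> i)) =
      - (\<Sum>x\<in>set_pmf (label_pmf \<mu> i). pmf (label_pmf \<mu> i) x * log 2 (pmf (label_pmf \<mu> i) x))"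
      using shannon_entropy_eq_sum[of "\<lambda>(T, \<epsilon>). T (\<epsilon> i)" "tuple_edges_pmf H w \<mu>"]
        map_edge_pmf(2)[OF i, of \<mu>] finite_set_label[OF fin W] by simp
    have "shannon_entropy (tuple_edges_pmf H w \<mu>) (\<lambda>(T, \<epsilon>). \<epsilon> i) =
      - (\<Sum>e\<in>set_pmf (edge_pmf H w i). pmf (edge_pmf H w i) e * log 2 (pmf (edge_pmf H w i) e))"
      using shannon_entropy_eq_sum[of "\<lambda>(T, \<epsilon>). \<epsilon> i" "tuple_edges_pmf H w \<mu>"]
        map_edge_pmf(1)[OF i, of \<mu>] fin_e by simp
    also have "\<dots> = - (\<Sum>e\<in>C i. pmf (edge_pmf H w i) e * log 2 (pmf (edge_pmf H w i) e))"
      using set_edge_pmf[OF W] by (intro arg_cong[of _ _ uminus] sum.mono_neutral_left) (auto simp: set_pmf_eq)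
    also have "\<dots> = - (\<Sum>e\<in>C i. w e / W i * log 2 (w e / W i))"
      by (simp add: pmf_edge_pmf[OF W])
    finally have 2: "shannon_entropy (tuple_edges_pmf H w \<mu>) (\<lambda>(T, \<epsilon>). \<epsilon> i) = \<dots>" .
    show ?thesis unfolding 1 2 using W
      by (simp add: log_def sum_divide_distrib[symmetric] sum_distrib_left[symmetric] right_diff_distrib)
  qed
  then show ?thesis
    by (simp add: tuple_score_def edge_term_def sum_distrib_left sum_subtractf[symmetric])
qed

lemma joints_constant_eq_exp:
  "joints_constant H k w = exp ((total_weight H w - 1) * ln (fact CARD('n)) -
     (\<Sum>i\<in>I. W i * ln (fact (k i))) + edge_term)"
proof -
  have 1: "rpow (w e / W i) (w e) = exp (w e * ln (w e / W i))" if "e \<in> C i" for e i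
  proof (cases "w e = 0")
    case False
    then have "W i \<noteq> 0" using W_zero[of i, OF _ that] by auto
    then have "0 < w e" "0 < W i" using False w_nonneg[OF C_edges[OF that]] W_nonneg[of i] by simp_all
    then show ?thesis by (simp add: rpow_eq_exp)
  qed (simp add: rpow_def)
  have "joints_constant H k w = exp ((total_weight H w - 1) * ln (fact CARD('n))) *
    (\<Prod>i\<in>I. exp (W i * ln (1 / fact (k i))) * (\<Prod>e\<in>C i. exp (w e * ln (w e / W i))))"
    by (simp add: joints_constant_def rpow_eq_exp 1)
  also have "\<dots> = exp ((total_weight H w - 1) * ln (fact CARD('n)) +
    (\<Sum>i\<in>I. W i * ln (1 / fact (k i)) + (\<Sum>e\<in>C i. w e * ln (w e / W i))))"
    by (simp add: exp_add exp_sum)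
  also have "(\<Sum>i\<in>I. W i * ln (1 / fact (k i)) + (\<Sum>e\<in>C i. w e * ln (w e / W i))) =
    - (\<Sum>i\<in>I. W i * ln (fact (k i))) + edge_term"
  proof -
    have "ln (1 / fact m) = - ln (fact m :: real)" for m by (simp add: ln_div)
    then show ?thesis by (simp only: edge_term_def sum.distrib mult_minus_right sum_negf)
  qed
  finally show ?thesis by simp
qed

text \<open>Because of this identity all multiples of ln (n + 1) cancel in
  \<open>score_sum_bound\<close>.\<close>

lemma sum_weight_card:
  "(\<Sum>e\<in>edges H. w e * real (card (verts H e))) = real CARD('n) * total_weight H w - (\<Sum>i\<in>I. W i * real (k i))"
proof -
  have "(\<Sum>e\<in>C i. w e * real (card (verts H e))) = real CARD('n) * W i - W i * real (k i)" if i: "i \<in> I" for i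
  proof -
    have "k i \<le> CARD('n) - 1" "\<And>e. e \<in> C i \<Longrightarrow> card (verts H e) = CARD('n) - k i"
      using unif i by (auto simp: uniform_chypergraph_def)
    moreover from this have "k i \<le> CARD('n)" by linarith
    ultimately have "card (verts H e) = CARD('n) - k i" "k i \<le> CARD('n)" if "e \<in> C i" for e
      using that by simp_all
    then have "(\<Sum>e\<in>C i. w e * real (card (verts H e))) = (\<Sum>e\<in>C i. w e * (real CARD('n) - real (k i)))"
      by (intro sum.cong) (auto simp: of_nat_diff)
    then show ?thesis by (simp add: subtotal_def right_diff_distrib sum_subtractf sum_distrib_left mult.commute)
  qed
  then show ?thesis
    by (simp add: sum_edges total_eq sum_subtractf sum_distrib_left)
qed

end

section \<open>The upper bound\<close>

context weighted_hypergraph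
begin

lemma joint_tuplesE:
  fixes \<F> :: "nat \<Rightarrow> ('a::field ^ 'n) set multiset"
  assumes "T \<in> joint_tuples H \<F> p"
  obtains A where "invertible_affine A" "A 0 = p" "\<And>e. e \<in> edges H \<Longrightarrow> fst (T e) = A ` coords (- verts H e)"
    "\<And>e. e \<in> edges H \<Longrightarrow> T e \<in> members (\<F> (colour H e))"
  using assms unfolding joint_tuples_def span_axis_eq_coords by (auto simp: PiE_iff)

lemma cov_sum: "1 \<le> (\<Sum>e | e \<in> edges H \<and> j \<in> verts H e. w e)"
  using cov by (simp only: covers_def)

lemma finite_joint_tuples': "finite (joint_tuples H \<F> p)"
  by (rule finite_joint_tuples[OF finite_edges])

lemma card_verts: "i \<in> I \<Longrightarrow> e \<in> C i \<Longrightarrow> card (- verts H e) = k i"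
proof -
  assume i: "i \<in> I" "e \<in> C i"
  then have "card (verts H e) = CARD('n) - k i" "k i \<le> CARD('n) - 1"
    using unif by (auto simp: uniform_chypergraph_def)
  then show ?thesis by (simp add: Compl_eq_Diff_UNIV card_Diff_subset)
qed

text \<open>Stated for arbitrary laws in place of maximising ones, so that it also yields the
  boundedness of the scores.\<close>

lemma score_sum_bound_at:
  fixes \<F> :: "nat \<Rightarrow> ('a::field ^ 'n) set multiset" and n :: nat
  assumes nonempty: "joints H \<F> \<noteq> {}"
    and \<mu>: "\<And>p. p \<in> joints H \<F> \<Longrightarrow> set_pmf (\<mu> p) \<subseteq> joint_tuples H \<F> p"
  shows "ln (\<Sum>p\<in>joints H \<F>. 2 powr tuple_score H w (\<mu> p)) \<le>
    edge_term + (\<Sum>i\<in>I. W i * ln (size (\<F> i))) +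
    (((\<Sum>e\<in>edges H. w e * real (card (verts H e))) - real CARD('n)) * ln (real n + 1) +
     (\<Sum>i\<in>I. W i * ln (real ((n + card (joints H \<F>) + k i) choose k i))) -
     (total_weight H w - 1) * ln (real ((n + CARD('n)) choose CARD('n))))"
proof -
  define J where "J = joints H \<F>"
  define \<eta> where "\<eta> = (\<lambda>p. 2 powr tuple_score H w (\<mu> p))"
  define S where "S = (\<Sum>p\<in>J. \<eta> p)"
  \<comment> \<open>Shares proportional to the powers of the scores: ln \<zeta> p then differs from
    the score, in nats, by the constant ln S.\<close>
  define \<zeta> where "\<zeta> = (\<lambda>p. \<eta> p / S)"
  define K where "K = real ((n + CARD('n)) choose CARD('n))"
  define R where "R = ((\<Sum>e\<in>edges H. w e * real (card (verts H e))) - real CARD('n)) * ln (real n + 1)"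
  define t where "t = total_weight H w"
  have J: "finite J" "J \<noteq> {}"
    using finite_joints[OF finite_edges cov] nonempty by (auto simp: J_def)
  have \<eta>: "0 < \<eta> p" for p by (simp add: \<eta>_def)
  have S: "0 < S" unfolding S_def using J \<eta> by (intro sum_pos) auto
  have \<zeta>: "0 < \<zeta> p" for p using \<eta> S by (simp add: \<zeta>_def)
  have sum_\<zeta>: "(\<Sum>p\<in>J. \<zeta> p) = 1"
    using S by (simp add: \<zeta>_def sum_divide_distrib[symmetric] flip: S_def)
  have K: "0 < K" by (simp add: K_def zero_less_binomial_iff)
  obtain y where y: "point_weights J \<zeta> n (edges H) (verts H) w y"
    using weights_exist[OF J(1) \<zeta> sum_\<zeta> finite_edges w_nonneg cov_sum, of n] by blast
  define bin where "bin = (\<lambda>i. real ((n + card J + k i) choose k i))"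
  have y_nonneg: "0 \<le> y p F" for p F using y by (simp add: point_weights_def)
  have y_main: "(t - 1) * ln (\<zeta> (A 0) * K) - R \<le> (\<Sum>e\<in>edges H. w e * ln (y (A 0) (A ` coords (- verts H e))))"
    if "invertible_affine A" "A 0 \<in> J" for A
  proof -
    have "(t - 1) * ln (\<zeta> (A 0) * K) \<le> R + (\<Sum>e\<in>edges H. w e * ln (y (A 0) (A ` coords (- verts H e))))"
      using y that unfolding point_weights_def t_def total_weight_def K_def R_def by blast
    then show ?thesis by linarith
  qed
  \<comment> \<open>The members that can occur in a joint tuple. Copies of a repeated flat count
    separately, in accordance with \<open>size\<close>.\<close>
  define X where "X = (\<lambda>i. {x \<in> members (\<F> i). \<exists>A S. invertible_affine A \<and> card S = k i \<and> fst x = A ` coords S})"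
  define Y where "Y = (\<lambda>p i. \<Sum>x\<in>{x \<in> X i. p \<in> fst x}. y p (fst x))"
  have fin_X: "finite (X i)" for i by (simp add: X_def)
  have T: "T e \<in> {x \<in> X i. p \<in> fst x}" "0 < y p (fst (T e))"
    if p: "p \<in> J" and T: "T \<in> set_pmf (\<mu> p)" and i: "i \<in> I" and e: "e \<in> C i" for p T i e
  proof -
    have "T \<in> joint_tuples H \<F> p" using \<mu> p T by (auto simp: J_def)
    then obtain A where A: "invertible_affine A" "A 0 = p" "fst (T e) = A ` coords (- verts H e)"
      "T e \<in> members (\<F> (colour H e))"
      using joint_tuplesE C_edges[OF e] by metis
    have "colour H e = i" using e by (simp add: colour_class_def)
    moreover have "p \<in> A ` coords (- verts H e)" using A(2) by (metis coords_0 imageI)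
    ultimately show "T e \<in> {x \<in> X i. p \<in> fst x}"
      using A card_verts[OF i e] unfolding X_def by auto
    show "0 < y p (fst (T e))" using y A p C_edges[OF e] unfolding point_weights_def by metis
  qed
  have fin_\<mu>: "finite (set_pmf (\<mu> p))" if "p \<in> J" for p
    using \<mu>[of p] that by (intro finite_subset[OF _ finite_joint_tuples'[of \<F> p]]) (simp add: J_def)
  have label: "set_pmf (label_pmf (\<mu> p) i) \<subseteq> {x \<in> X i. p \<in> fst x}"
    "\<And>x. x \<in> set_pmf (label_pmf (\<mu> p) i) \<Longrightarrow> 0 < y p (fst x)"
    if p: "p \<in> J" and i: "i \<in> I" "0 < W i" for p i
  proof -
    have *: "x \<in> {x \<in> X i. p \<in> fst x} \<and> 0 < y p (fst x)" if "x \<in> set_pmf (label_pmf (\<mu> p) i)" for x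
      using that
    proof (rule set_label_pmf[OF i(2)])
      fix T e assume "T \<in> set_pmf (\<mu> p)" "e \<in> C i" "x = T e"
      then show ?thesis using T[OF p _ i(1)] by blast
    qed
    show "set_pmf (label_pmf (\<mu> p) i) \<subseteq> {x \<in> X i. p \<in> fst x}" using * by blast
    show "0 < y p (fst x)" if "x \<in> set_pmf (label_pmf (\<mu> p) i)" for x using *[OF that] by blast
  qed
  have Y_nonneg: "0 \<le> Y p i" for p i unfolding Y_def by (intro sum_nonneg y_nonneg)
  have Y_pos: "0 < Y p i" if p: "p \<in> J" and i: "i \<in> I" "0 < W i" for p i
  proof -
    obtain x where x: "x \<in> set_pmf (label_pmf (\<mu> p) i)" using set_pmf_not_empty[of "label_pmf (\<mu> p) i"] by blast
    show ?thesis unfolding Y_def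
      using label[OF p i] x y_nonneg fin_X by (intro sum_pos2[of _ x]) auto
  qed
  \<comment> \<open>The geometry gives the power t - 1 of the share; the score, which is ln (\<zeta>
    p) + ln S in nats, raises it to t.\<close>
  have point: "t * ln (\<zeta> p) + ((t - 1) * ln K + ln S - R - edge_term) \<le> (\<Sum>i\<in>I. W i * ln (Y p i))"
    if p: "p \<in> J" for p
  proof -
    let ?ent = "\<lambda>i. \<Sum>x\<in>set_pmf (label_pmf (\<mu> p) i). pmf (label_pmf (\<mu> p) i) x * ln (pmf (label_pmf (\<mu> p) i) x)"
    have "(t - 1) * ln (\<zeta> p * K) - R = (\<Sum>T\<in>set_pmf (\<mu> p). pmf (\<mu> p) T * ((t - 1) * ln (\<zeta> p * K) - R))"
      using sum_pmf_eq_1[OF fin_\<mu>[OF p]] by (simp add: sum_distrib_right[symmetric])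
    also have "\<dots> \<le> (\<Sum>T\<in>set_pmf (\<mu> p). pmf (\<mu> p) T * (\<Sum>e\<in>edges H. w e * ln (y p (fst (T e)))))"
    proof (intro sum_mono mult_left_mono)
      fix T assume "T \<in> set_pmf (\<mu> p)"
      then have "T \<in> joint_tuples H \<F> p" using \<mu> p by (auto simp: J_def)
      then obtain A where A: "invertible_affine A" "A 0 = p"
        "\<And>e. e \<in> edges H \<Longrightarrow> fst (T e) = A ` coords (- verts H e)"
        using joint_tuplesE by metis
      have "(\<Sum>e\<in>edges H. w e * ln (y p (fst (T e)))) = (\<Sum>e\<in>edges H. w e * ln (y p (A ` coords (- verts H e))))"
        by (intro sum.cong) (simp_all add: A(3))
      then show "(t - 1) * ln (\<zeta> p * K) - R \<le> (\<Sum>e\<in>edges H. w e * ln (y p (fst (T e))))"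
        using y_main[OF A(1)] A(2) p by simp
    qed simp
    also have "\<dots> = (\<Sum>i\<in>I. \<Sum>T\<in>set_pmf (\<mu> p). pmf (\<mu> p) T * (\<Sum>e\<in>C i. w e * ln (y p (fst (T e)))))"
      unfolding sum_edges sum_distrib_left by (rule sum.swap)
    \<comment> \<open>Gibbs' inequality on the flats of colour i through p: the law of the random
      flat is compared with the weights of p on these flats.\<close>
    also have "\<dots> \<le> (\<Sum>i\<in>I. W i * (ln (Y p i) + ?ent i))"
    proof (rule sum_mono)
      fix i assume i: "i \<in> I"
      show "(\<Sum>T\<in>set_pmf (\<mu> p). pmf (\<mu> p) T * (\<Sum>e\<in>C i. w e * ln (y p (fst (T e))))) \<le> W i * (ln (Y p i) + ?ent i)"
      proof (cases "W i = 0")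
        case True
        then show ?thesis using W_zero by simp
      next
        case False
        then have Wi: "0 < W i" using W_nonneg[of i] by simp
        let ?X = "{x \<in> X i. p \<in> fst x}" and ?P = "label_pmf (\<mu> p) i"
        have finX: "finite ?X" using fin_X by simp
        have "(\<Sum>T\<in>set_pmf (\<mu> p). pmf (\<mu> p) T * (\<Sum>e\<in>C i. w e * ln (y p (fst (T e))))) =
          W i * (\<Sum>x\<in>?X. pmf ?P x * ln (y p (fst x)))"
          using sum_label_pmf[OF fin_\<mu>[OF p] Wi finX label(1)[OF p i Wi], of "\<lambda>x. ln (y p (fst x))"] by simp
        also have "(\<Sum>x\<in>?X. pmf ?P x * ln (y p (fst x))) \<le> ln (\<Sum>x\<in>?X. y p (fst x)) + (\<Sum>x\<in>?X. pmf ?P x * ln (pmf ?P x))"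
        proof (rule gibbs_inequality[OF finX])
          show "(\<Sum>x\<in>?X. pmf ?P x) = 1" using sum_pmf_eq_1[OF finX label(1)[OF p i Wi]] .
          show "0 < y p (fst x)" if "0 < pmf ?P x" for x
            using that label(2)[OF p i Wi] by (auto simp: set_pmf_eq)
        qed (simp_all add: y_nonneg)
        also have "(\<Sum>x\<in>?X. pmf ?P x * ln (pmf ?P x)) = ?ent i"
          using label(1)[OF p i Wi] finX by (intro sum.mono_neutral_right) (auto simp: set_pmf_eq)
        finally show ?thesis using Wi unfolding Y_def by simp
      qed
    qed
    also have "\<dots> = (\<Sum>i\<in>I. W i * ln (Y p i)) + (edge_term - ln 2 * tuple_score H w (\<mu> p))"
      unfolding tuple_score_nats[OF fin_\<mu>[OF p]] by (simp add: distrib_left sum.distrib)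
    finally have *: "(t - 1) * ln (\<zeta> p * K) - R \<le> \<dots>" .
    have "ln 2 * tuple_score H w (\<mu> p) = ln (\<zeta> p) + ln S"
      using S \<eta>[of p] by (simp add: \<zeta>_def ln_div) (simp add: \<eta>_def ln_powr)
    moreover have "ln (\<zeta> p * K) = ln (\<zeta> p) + ln K" using \<zeta>[of p] K by (simp add: ln_mult)
    ultimately show ?thesis using * by (simp add: algebra_simps)
  qed
  \<comment> \<open>Averaging over p with the weights \<zeta> themselves: \<open>t * ?L\<close> on
    the left meets \<open>W i * ?L\<close> summed over i on the right, and the subtotals add up to
    t.\<close>
  let ?L = "\<Sum>p\<in>J. \<zeta> p * ln (\<zeta> p)" and ?D = "(t - 1) * ln K + ln S - R - edge_term"
  have "t * ?L + ?D = (\<Sum>p\<in>J. \<zeta> p * (t * ln (\<zeta> p) + ?D))"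
  proof -
    have "(\<Sum>p\<in>J. \<zeta> p * (t * ln (\<zeta> p) + ?D)) = (\<Sum>p\<in>J. t * (\<zeta> p * ln (\<zeta> p))) + (\<Sum>p\<in>J. \<zeta> p) * ?D"
      by (simp add: distrib_left sum.distrib sum_distrib_right mult.left_commute)
    then show ?thesis by (simp add: sum_\<zeta> sum_distrib_left)
  qed
  also have "\<dots> \<le> (\<Sum>p\<in>J. \<zeta> p * (\<Sum>i\<in>I. W i * ln (Y p i)))"
    using \<zeta> point by (intro sum_mono mult_left_mono) (auto simp: less_imp_le)
  also have "\<dots> = (\<Sum>i\<in>I. W i * (\<Sum>p\<in>J. \<zeta> p * ln (Y p i)))"
    unfolding sum_distrib_left by (subst sum.swap) (simp add: mult.left_commute)
  also have "\<dots> \<le> (\<Sum>i\<in>I. W i * (ln (size (\<F> i)) + ln (bin i) + ?L))"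
  proof (rule sum_mono)
    fix i assume i: "i \<in> I"
    show "W i * (\<Sum>p\<in>J. \<zeta> p * ln (Y p i)) \<le> W i * (ln (size (\<F> i)) + ln (bin i) + ?L)"
    proof (cases "W i = 0")
      case False
      then have Wi: "0 < W i" using W_nonneg[of i] by simp
      have "(\<Sum>p\<in>J. \<zeta> p * ln (Y p i)) \<le> ln (\<Sum>p\<in>J. Y p i) + ?L"
        using J \<zeta> sum_\<zeta> Y_nonneg Y_pos[OF _ i Wi] by (intro gibbs_inequality) (auto simp: less_imp_le)
      moreover have "ln (\<Sum>p\<in>J. Y p i) \<le> ln (size (\<F> i)) + ln (bin i)"
      proof -
        \<comment> \<open>Double counting: on each single flat the weights of the joints add up to
          at most \<open>bin i\<close>.\<close>
        have "(\<Sum>p\<in>J. Y p i) = (\<Sum>p\<in>J. \<Sum>x\<in>X i. if p \<in> fst x then y p (fst x) else 0)"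
          unfolding Y_def using fin_X by (intro sum.cong refl sum.inter_filter) auto
        also have "\<dots> = (\<Sum>x\<in>X i. \<Sum>p\<in>J. if p \<in> fst x then y p (fst x) else 0)" by (rule sum.swap)
        also have "\<dots> = (\<Sum>x\<in>X i. \<Sum>p\<in>J \<inter> fst x. y p (fst x))"
          using J(1) by (simp add: sum.inter_restrict)
        also have "\<dots> \<le> (\<Sum>x\<in>X i. bin i)"
        proof (rule sum_mono)
          fix x assume "x \<in> X i"
          then obtain A S where "invertible_affine A" "card S = k i" "fst x = A ` coords S"
            by (auto simp: X_def)
          then show "(\<Sum>p\<in>J \<inter> fst x. y p (fst x)) \<le> bin i"
            using y unfolding point_weights_def bin_def by metis
        qed
        also have "\<dots> \<le> real (size (\<F> i)) * bin i"
        proof -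
          have "card (X i) \<le> card (members (\<F> i))" by (rule card_mono) (auto simp: X_def)
          then show ?thesis by (simp add: bin_def card_members mult_right_mono del: of_nat_mult)
        qed
        finally have le: "(\<Sum>p\<in>J. Y p i) \<le> real (size (\<F> i)) * bin i" .
        have pos: "0 < (\<Sum>p\<in>J. Y p i)" using J Y_pos[OF _ i Wi] by (intro sum_pos) auto
        have "bin i > 0" by (simp add: bin_def zero_less_binomial_iff)
        moreover from this have "real (size (\<F> i)) > 0" using le pos by (smt (verit) mult_nonpos_nonneg)
        ultimately show ?thesis using ln_mono[OF le pos] by (simp only: ln_mult_pos)
      qed
      ultimately show ?thesis using Wi by simp
    qed simp
  qed
  also have "\<dots> = (\<Sum>i\<in>I. W i * ln (size (\<F> i))) + (\<Sum>i\<in>I. W i * ln (bin i)) + t * ?L"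
    by (simp add: t_def total_eq distrib_left sum.distrib sum_distrib_right)
  finally show ?thesis
    by (simp add: S_def \<eta>_def J_def t_def K_def R_def bin_def)
qed

text \<open>The degree n tends to infinity for a fixed configuration, so the number of joints in the
  binomial coefficients disappears.\<close>

lemma score_sum_bound:
  fixes \<F> :: "nat \<Rightarrow> ('a::field ^ 'n) set multiset"
  assumes \<mu>: "\<And>p. p \<in> joints H \<F> \<Longrightarrow> set_pmf (\<mu> p) \<subseteq> joint_tuples H \<F> p"
  shows "(\<Sum>p\<in>joints H \<F>. 2 powr tuple_score H w (\<mu> p)) \<le>
    joints_constant H k w * (\<Prod>i\<in>I. rpow (real (size (\<F> i))) (W i))"
proof (cases "joints H \<F> = {}")
  case True
  have "0 \<le> rpow x a" for x a :: real by (simp add: rpow_def)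
  then show ?thesis unfolding True joints_constant_eq_exp by (simp add: prod_nonneg)
next
  case False
  let ?S = "\<Sum>p\<in>joints H \<F>. 2 powr tuple_score H w (\<mu> p)" and ?d = "CARD('n)" and ?J = "joints H \<F>"
  define t where "t = total_weight H w"
  have S: "0 < ?S" using False finite_joints[OF finite_edges cov] by (intro sum_pos) auto
  have size_pos: "0 < real (size (\<F> i))" if i: "i \<in> I" for i
  proof -
    obtain p where "p \<in> ?J" using False by blast
    then obtain T where T: "T \<in> joint_tuples H \<F> p" by (auto simp: joints_def)
    obtain e where e: "e \<in> C i" using C_nonempty[OF i] by blast
    then have "T e \<in> members (\<F> i)" using T by (auto simp: joint_tuples_def colour_class_def)
    then have "0 < card (members (\<F> i))" by (auto simp: card_gt_0_iff)
    then show ?thesis by (simp add: card_members)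
  qed
  have bound: "ln ?S - edge_term - (\<Sum>i\<in>I. W i * ln (size (\<F> i))) \<le>
    (\<Sum>i\<in>I. W i * ln_defect (card ?J) (k i) n) - (t - 1) * ln_defect 0 ?d n" for n
  proof -
    have eq: "(\<Sum>i\<in>I. W i * (real (k i) * ln (real n + 1))) = (\<Sum>i\<in>I. W i * real (k i)) * ln (real n + 1)"
      by (simp add: sum_distrib_right mult.assoc)
    have "((\<Sum>e\<in>edges H. w e * real (card (verts H e))) - real ?d) * ln (real n + 1) +
     (\<Sum>i\<in>I. W i * ln (real ((n + card ?J + k i) choose k i))) -
     (t - 1) * ln (real ((n + ?d) choose ?d)) =
     (\<Sum>i\<in>I. W i * ln_defect (card ?J) (k i) n) - (t - 1) * ln_defect 0 ?d n"
      unfolding sum_weight_card t_def[symmetric] ln_defect_def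
      by (simp only: right_diff_distrib left_diff_distrib sum_subtractf eq) (simp add: algebra_simps)
    then show ?thesis using score_sum_bound_at[where \<mu> = \<mu>, OF False \<mu>, of n] by (simp add: t_def)
  qed
  have "(\<lambda>n. (\<Sum>i\<in>I. W i * ln_defect (card ?J) (k i) n) - (t - 1) * ln_defect 0 ?d n) \<longlonglongrightarrow>
    (\<Sum>i\<in>I. W i * - ln (fact (k i))) - (t - 1) * - ln (fact ?d)"
    by (intro tendsto_intros ln_defect_limit)
  then have "ln ?S - edge_term - (\<Sum>i\<in>I. W i * ln (size (\<F> i))) \<le>
    (\<Sum>i\<in>I. W i * - ln (fact (k i))) - (t - 1) * - ln (fact ?d)"
    using bound by (intro LIMSEQ_le_const) auto
  then have "ln ?S \<le> ((t - 1) * ln (fact ?d) - (\<Sum>i\<in>I. W i * ln (fact (k i))) + edge_term) + (\<Sum>i\<in>I. W i * ln (size (\<F> i)))"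
    by (simp add: sum_negf)
  then have "?S \<le> exp (((t - 1) * ln (fact ?d) - (\<Sum>i\<in>I. W i * ln (fact (k i))) + edge_term) + (\<Sum>i\<in>I. W i * ln (size (\<F> i))))"
    by (subst exp_ln[OF S, symmetric]) (simp only: exp_le_cancel_iff)
  also have "\<dots> = joints_constant H k w * (\<Prod>i\<in>I. rpow (real (size (\<F> i))) (W i))"
    using size_pos by (simp add: exp_add exp_sum joints_constant_eq_exp t_def rpow_eq_exp)
  finally show ?thesis .
qed

lemma rpow_nonneg: "0 \<le> rpow x a"
  by (simp add: rpow_def)

text \<open>The other joints contribute positive terms, so the bound on the total also bounds the
  score of each single law at p.\<close>

lemma bdd_above_scores:
  fixes \<F> :: "nat \<Rightarrow> ('a::field ^ 'n) set multiset"
  assumes p: "p \<in> joints H \<F>"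
  shows "bdd_above (tuple_score H w ` {\<mu>. set_pmf \<mu> \<subseteq> joint_tuples H \<F> p})"
proof -
  let ?B = "joints_constant H k w * (\<Prod>i\<in>I. rpow (real (size (\<F> i))) (W i))"
  have "\<exists>\<mu>. set_pmf \<mu> \<subseteq> joint_tuples H \<F> q" if q: "q \<in> joints H \<F>" for q
  proof -
    obtain T where "T \<in> joint_tuples H \<F> q" using q by (auto simp: joints_def)
    then show ?thesis by (intro exI[of _ "return_pmf T"]) simp
  qed
  then obtain \<nu> where \<nu>: "\<And>q. q \<in> joints H \<F> \<Longrightarrow> set_pmf (\<nu> q) \<subseteq> joint_tuples H \<F> q" by metis
  have "tuple_score H w \<mu> \<le> log 2 ?B" if \<mu>: "set_pmf \<mu> \<subseteq> joint_tuples H \<F> p" for \<mu>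
  proof -
    have "2 powr tuple_score H w \<mu> \<le> (\<Sum>q\<in>joints H \<F>. 2 powr tuple_score H w ((\<nu>(p := \<mu>)) q))"
      using p finite_joints[OF finite_edges cov, of \<F>]
        member_le_sum[of p "joints H \<F>" "\<lambda>q. 2 powr tuple_score H w ((\<nu>(p := \<mu>)) q)"] by simp
    also have "\<dots> \<le> ?B" by (rule score_sum_bound) (use \<mu> \<nu> in auto)
    finally have "2 powr tuple_score H w \<mu> \<le> ?B" .
    then show ?thesis by (simp add: le_log_iff order_less_le_trans[of 0 "2 powr tuple_score H w \<mu>"])
  qed
  then show ?thesis by (intro bdd_aboveI2[of _ _ "log 2 ?B"]) auto
qed

text \<open>Laws with scores within \<epsilon> of the supremum suffice, as the factor 2^\<epsilon>
  tends to 1.\<close>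

lemma multiplicity_sum_bound:
  fixes \<F> :: "nat \<Rightarrow> ('a::field ^ 'n) set multiset"
  shows "(\<Sum>p\<in>joints H \<F>. multiplicity_at H w \<F> p) \<le>
    joints_constant H k w * (\<Prod>i\<in>I. rpow (real (size (\<F> i))) (W i))" (is "?M \<le> ?B")
proof -
  let ?X = "\<lambda>p. {\<mu>. set_pmf \<mu> \<subseteq> joint_tuples H \<F> p}"
  let ?s = "\<lambda>p. SUP \<mu>\<in>?X p. tuple_score H w \<mu>"
  have le: "?M \<le> 2 powr \<epsilon> * ?B" if \<epsilon>: "0 < \<epsilon>" for \<epsilon>
  proof -
    have "\<exists>\<mu>. set_pmf \<mu> \<subseteq> joint_tuples H \<F> p \<and>
      ?s p - \<epsilon> < tuple_score H w \<mu>"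
      if p: "p \<in> joints H \<F>" for p
    proof -
      obtain T where "T \<in> joint_tuples H \<F> p" using p by (auto simp: joints_def)
      then have "return_pmf T \<in> ?X p" by simp
      then have "?X p \<noteq> {}" by blast
      then have "\<exists>\<mu>\<in>?X p.
        ?s p - \<epsilon> < tuple_score H w \<mu>"
        using less_cSUP_iff[OF _ bdd_above_scores[OF p]] \<epsilon> by (metis diff_less_eq less_add_same_cancel1)
      then show ?thesis by blast
    qed
    then obtain \<mu> where \<mu>: "\<And>p. p \<in> joints H \<F> \<Longrightarrow> set_pmf (\<mu> p) \<subseteq> joint_tuples H \<F> p"
      "\<And>p. p \<in> joints H \<F> \<Longrightarrow>
        ?s p - \<epsilon> < tuple_score H w (\<mu> p)"
      by metis
    have "?M \<le> (\<Sum>p\<in>joints H \<F>. 2 powr \<epsilon> * 2 powr tuple_score H w (\<mu> p))"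
    proof (rule sum_mono)
      fix p assume "p \<in> joints H \<F>"
      from \<mu>(2)[OF this] show "multiplicity_at H w \<F> p \<le> 2 powr \<epsilon> * 2 powr tuple_score H w (\<mu> p)"
        unfolding multiplicity_at_def powr_add[symmetric] by (intro powr_mono) auto
    qed
    also have "\<dots> = 2 powr \<epsilon> * (\<Sum>p\<in>joints H \<F>. 2 powr tuple_score H w (\<mu> p))"
      by (rule sum_distrib_left[symmetric])
    also have "\<dots> \<le> 2 powr \<epsilon> * ?B"
      by (intro mult_left_mono score_sum_bound \<mu>) auto
    finally show ?thesis .
  qed
  have "(\<lambda>n. 2 powr (1 / real (Suc n)) * ?B) \<longlonglongrightarrow> 2 powr 0 * ?B"
    by (intro tendsto_intros LIMSEQ_inverse_real_of_nat[unfolded inverse_eq_divide]) auto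
  then show ?thesis using le by (intro LIMSEQ_le_const[where x = "?B"]) auto
qed

end

section \<open>Hyperplanes in general position\<close>

text \<open>A point \<open>x\<close> is identified with the monic polynomial \<open>t\<^sup>d - \<Sum>\<^sub>j x\<^sub>j t\<^bsup>index j\<^esup>\<close>; it lies on the hyperplane
  with parameter \<open>s\<close> iff \<open>s\<close> is a root.\<close>

definition moment :: "'a::field ^ 'n::finite \<Rightarrow> 'a \<Rightarrow> 'a" where
  "moment x s = (\<Sum>j\<in>UNIV. x $ j * s ^ index j)"

text \<open>The point whose polynomial is the product of the t - s for s in B; hence the minus
  sign.\<close>

definition root_point :: "'a::field set \<Rightarrow> 'a ^ 'n::finite" where
  "root_point B = (\<chi> j. - coeff (\<Prod>s\<in>B. [:- s, 1:]) (index j))"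

definition moment_flat :: "'a::field set \<Rightarrow> ('a ^ 'n::finite) set" where
  "moment_flat D = {x. \<forall>s\<in>D. moment x s = s ^ CARD('n)}"

lemma poly_root_prod:
  fixes B :: "'a::field set"
  assumes "finite B"
  shows "poly (\<Prod>s\<in>B. [:- s, 1:]) t = (\<Prod>s\<in>B. t - s)" "degree (\<Prod>s\<in>B. [:- s, 1:]) = card B"
    "coeff (\<Prod>s\<in>B. [:- s, 1:]) (card B) = 1"
proof -
  let ?p = "\<Prod>s\<in>B. [:- s, 1:]"
  show "poly ?p t = (\<Prod>s\<in>B. t - s)" by (simp add: poly_prod)
  have "degree ?p = (\<Sum>s\<in>B. degree [:- s, 1:])"
    by (rule degree_prod_eq_sum_degree) simp
  then show deg: "degree ?p = card B" by simp
  have "lead_coeff ?p = (\<Prod>s\<in>B. lead_coeff [:- s, 1:])" by (rule lead_coeff_prod)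
  then show "coeff ?p (card B) = 1" by (simp add: deg)
qed

lemma sum_index: "(\<Sum>j\<in>UNIV. f (index (j :: 'n::finite))) = (\<Sum>i<CARD('n). f i)"
  using bij_index by (rule sum.reindex_bij_betw)

lemma moment_root_point:
  fixes B :: "'a::field set"
  assumes B: "finite B" "card B = CARD('n::finite)"
  shows "moment (root_point B :: 'a ^ 'n) t = t ^ CARD('n) - (\<Prod>s\<in>B. t - s)"
proof -
  let ?p = "\<Prod>s\<in>B. [:- s, 1:]"
  have "(\<Prod>s\<in>B. t - s) = poly ?p t" using poly_root_prod(1)[OF B(1)] by simp
  also have "\<dots> = (\<Sum>i\<le>CARD('n). coeff ?p i * t ^ i)"
    using poly_root_prod(2)[OF B(1)] B by (simp add: poly_altdef)
  also have "\<dots> = (\<Sum>i<CARD('n). coeff ?p i * t ^ i) + t ^ CARD('n)"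
    using poly_root_prod(3)[OF B(1)] B by (simp add: lessThan_Suc_atMost[symmetric])
  also have "(\<Sum>i<CARD('n). coeff ?p i * t ^ i) = - moment (root_point B :: 'a ^ 'n) t"
    unfolding moment_def root_point_def
    by (simp add: sum_index[of "\<lambda>i. coeff ?p i * t ^ i", where 'n = 'n] sum_negf)
  finally show ?thesis by simp
qed

lemma root_point_in_moment_flat:
  fixes B :: "'a::field set"
  assumes B: "finite B" "card B = CARD('n::finite)"
  shows "(root_point B :: 'a ^ 'n) \<in> moment_flat D \<longleftrightarrow> D \<subseteq> B"
  using B by (auto simp: moment_flat_def moment_root_point prod_zero_iff)

lemma inj_root_point:
  "inj_on (root_point :: 'a::field set \<Rightarrow> 'a ^ 'n::finite) {B. finite B \<and> card B = CARD('n)}"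
proof (rule inj_onI)
  fix B B' :: "'a set"
  assume B: "B \<in> {B. finite B \<and> card B = CARD('n)}" "B' \<in> {B. finite B \<and> card B = CARD('n)}"
    and eq: "(root_point B :: 'a ^ 'n) = root_point B'"
  have "D \<subseteq> B \<longleftrightarrow> D \<subseteq> B'" for D
    using root_point_in_moment_flat[of B D, where 'n = 'n] root_point_in_moment_flat[of B' D, where 'n = 'n] B eq
    by simp
  then show "B = B'" by blast
qed

text \<open>Completing D by parameters outside D' gives a point on the flat of D that lies on all
  hyperplanes of D' only if D' is contained in D. An infinite field provides enough
  parameters.\<close>

lemma moment_flat_inj:
  fixes D D' :: "'a::field set"
  assumes inf: "infinite (UNIV :: 'a set)" and D: "finite D" "finite D'" "card D = card D'" "card D \<le> CARD('n::finite)"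
    and eq: "(moment_flat D :: ('a ^ 'n) set) = moment_flat D'"
  shows "D = D'"
proof -
  have "infinite (- (D \<union> D'))" using inf D by (simp add: Compl_eq_Diff_UNIV)
  then obtain R where R: "R \<subseteq> - (D \<union> D')" "finite R" "card R = CARD('n) - card D"
    using infinite_arbitrarily_large by blast
  have "card (D \<union> R) = CARD('n)" using D R by (subst card_Un_disjoint) auto
  then have "(root_point (D \<union> R) :: 'a ^ 'n) \<in> moment_flat X \<longleftrightarrow> X \<subseteq> D \<union> R" for X
    using D R by (intro root_point_in_moment_flat) auto
  then have "D' \<subseteq> D \<union> R" using eq by blast
  then have "D' \<subseteq> D" using R by blast
  then show ?thesis using D card_subset_eq by metis
qed

lemma moment_add: "moment (x + y) s = moment x s + moment y s"
  by (simp add: moment_def distrib_right sum.distrib)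

text \<open>The i-th coordinate of a point is its value in the equation of the hyperplane with
  parameter \<open>\<sigma> i\<close>. The Vandermonde matrix M of B is injective because a
  polynomial of degree less than d with d roots is 0, and its inverse is the linear part of the
  chart.\<close>

lemma moment_frame:
  fixes \<sigma> :: "'n::finite \<Rightarrow> 'a::field"
  assumes \<sigma>: "bij_betw \<sigma> UNIV B"
  obtains A :: "'a ^ 'n \<Rightarrow> 'a ^ 'n" where "invertible_affine A" "A 0 = root_point B"
    "\<And>S. A ` coords (- S) = moment_flat (\<sigma> ` S)"
proof -
  have B: "finite B" "card B = CARD('n)" using \<sigma> bij_betw_finite bij_betw_same_card by fastforce+
  define M :: "'a ^ 'n ^ 'n" where "M = (\<chi> i. \<chi> j. \<sigma> i ^ index j)"
  have M: "(M *v x) $ i = moment x (\<sigma> i)" for x i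
    by (simp add: M_def matrix_vector_mult_def moment_def mult.commute)
  have "x = 0" if x: "M *v x = 0" for x
  proof -
    define q where "q = (\<Sum>j\<in>UNIV. monom (x $ j) (index j))"
    have q: "poly q s = moment x s" for s by (simp add: q_def poly_sum poly_monom moment_def)
    have "moment x s = 0" if s: "s \<in> B" for s
    proof -
      obtain i where "s = \<sigma> i" using \<sigma> s by (auto simp: bij_betw_def)
      then show ?thesis using M[of x i] x by simp
    qed
    then have sub: "B \<subseteq> {s. poly q s = 0}" using q by auto
    have idx: "index (j :: 'n) < CARD('n)" for j
      using bij_betw_apply[OF bij_index, of j] by simp
    have deg: "coeff q i = 0" if "i \<ge> CARD('n)" for i
      unfolding q_def coeff_sum
    proof (intro sum.neutral ballI)
      fix j :: 'n
      show "coeff (monom (x $ j) (index j)) i = 0" using that idx[of j] by simp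
    qed
    have "q = 0"
    proof (rule ccontr)
      assume "q \<noteq> 0"
      then have "card B \<le> card {s. poly q s = 0}" using sub poly_roots_finite by (intro card_mono)
      also have "\<dots> \<le> degree q" using \<open>q \<noteq> 0\<close> by (rule card_poly_roots_bound)
      also have "degree q < CARD('n)" using deg[of "degree q"] \<open>q \<noteq> 0\<close> by (meson leading_coeff_0_iff not_le)
      finally show False using B by simp
    qed
    have "x $ j = coeff q (index j)" for j
    proof -
      have "coeff q (index j) = (\<Sum>i\<in>UNIV. if i = j then x $ i else 0)"
        unfolding q_def coeff_sum using inj_index by (intro sum.cong) (auto simp: inj_def)
      then show ?thesis by simp
    qed
    then show ?thesis using \<open>q = 0\<close> by (simp add: vec_eq_iff)
  qed
  then obtain N where "N ** M = mat 1" using iffD2[OF matrix_left_invertible_ker[of M]] by metis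
  then have N: "N ** M = mat 1" "M ** N = mat 1" by (simp_all only: matrix_left_right_inverse)
  define A where "A = (\<lambda>x. N *v x + root_point B)"
  have "invertible N" using N by (auto simp: invertible_def)
  then have "invertible_affine A" unfolding invertible_affine_def A_def by blast
  moreover have "A 0 = root_point B" by (simp add: A_def)
  moreover have "A ` coords (- S) = moment_flat (\<sigma> ` S)" for S
  proof -
    have root: "moment (root_point B :: 'a ^ 'n) (\<sigma> i) = \<sigma> i ^ CARD('n)" for i
    proof -
      have "\<sigma> i \<in> B" using \<sigma> by (auto simp: bij_betw_def)
      then have "(\<Prod>s\<in>B. \<sigma> i - s) = 0" using B by (intro prod_zero) auto
      then show ?thesis using B by (simp add: moment_root_point)
    qed
    show ?thesis
    proof (intro subset_antisym subsetI)
      fix x assume "x \<in> A ` coords (- S)"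
      then obtain z where z: "z \<in> coords (- S)" "x = A z" by blast
      have "moment x (\<sigma> i) = \<sigma> i ^ CARD('n)" if "i \<in> S" for i
      proof -
        have "moment (N *v z) (\<sigma> i) = (M *v (N *v z)) $ i" by (rule M[symmetric])
        also have "\<dots> = z $ i" by (simp add: matrix_vector_mul_assoc N)
        also have "\<dots> = 0" using z that by (simp add: coords_def)
        finally show ?thesis by (simp add: z A_def moment_add root)
      qed
      then show "x \<in> moment_flat (\<sigma> ` S)" by (auto simp: moment_flat_def)
    next
      fix x :: "'a ^ 'n" assume x: "x \<in> moment_flat (\<sigma> ` S)"
      let ?z = "M *v (x - root_point B)"
      have "A ?z = x" by (simp add: A_def matrix_vector_mul_assoc N)
      moreover have "?z \<in> coords (- S)"
        unfolding coords_def
      proof (intro CollectI allI impI)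
        fix i assume "i \<notin> - S"
        then have "moment x (\<sigma> i) = \<sigma> i ^ CARD('n)" using x by (auto simp: moment_flat_def)
        then show "?z $ i = 0" by (simp add: matrix_vector_mult_diff_distrib M root)
      qed
      ultimately show "x \<in> A ` coords (- S)" by (metis image_eqI)
    qed
  qed
  ultimately show ?thesis using that by blast
qed

lemma flat_frame:
  fixes A :: "'a::field ^ 'n::finite \<Rightarrow> 'a ^ 'n"
  assumes "invertible_affine A"
  shows "flat (card S) (A ` coords S)"
proof -
  obtain M b where M: "invertible M" "A = (\<lambda>x. M *v x + b)" using assms by (auto simp: invertible_affine_def)
  obtain M' where M': "M' ** M = mat 1" using M(1) by (auto simp: invertible_def)
  have lin: "Vector_Spaces.linear (*s) (*s) ((*v) M)" by (rule matrix_vector_mul_linear_gen)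
  have inj: "inj ((*v) M)"
  proof (rule injI)
    fix x y assume "M *v x = M *v y"
    then have "M' *v (M *v x) = M' *v (M *v y)" by simp
    then show "x = y" by (simp add: matrix_vector_mul_assoc M')
  qed
  have sub: "vec.subspace (coords S :: ('a ^ 'n) set)"
    by (auto simp: vec.subspace_def coords_def)
  have "vec.dim (coords S :: ('a ^ 'n) set) = card S"
    unfolding coords_def by (rule dim_substandard_cart)
  then have "vec.dim ((*v) M ` coords S) = card S"
    using vec.dim_image_eq[OF lin, of "coords S"] inj inj_on_subset by auto
  moreover have "vec.subspace ((*v) M ` coords S)"
    using lin sub by (rule vec.linear_subspace_image)
  moreover have "A ` coords S = (+) b ` ((*v) M ` coords S)"
    by (auto simp: M add.commute image_image)
  ultimately show ?thesis unfolding flat_def by blast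
qed

section \<open>Sharpness\<close>

lemma finite_bijections: "finite B \<Longrightarrow> finite {\<sigma> :: 'n::finite \<Rightarrow> 'b. bij_betw \<sigma> UNIV B}"
  by (rule finite_subset[of _ "UNIV \<rightarrow>\<^sub>E B"]) (auto simp: bij_betw_def finite_PiE)

definition bijections :: "'b set \<Rightarrow> 'n set \<Rightarrow> 'b set \<Rightarrow> ('n \<Rightarrow> 'b) set" where
  "bijections B V D = {\<sigma>. bij_betw \<sigma> UNIV B \<and> \<sigma> ` V = D}"

text \<open>A permutation \<pi> of B carrying D to D' acts on the bijections by composition.\<close>

lemma card_bijections_image:
  fixes B :: "'b set" and V :: "'n::finite set"
  assumes B: "finite B" and D: "D \<subseteq> B" "D' \<subseteq> B" "card D = card D'"
  shows "card (bijections B V D) \<le> card (bijections B V D')"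
proof -
  have fin: "finite D" "finite D'" using B D finite_subset by auto
  obtain f where f: "bij_betw f D D'" using finite_same_card_bij[OF fin D(3)] by blast
  have "card (B - D) = card (B - D')" using D fin by (simp add: card_Diff_subset)
  then obtain g where g: "bij_betw g (B - D) (B - D')"
    using finite_same_card_bij[of "B - D" "B - D'"] B by blast
  define \<pi> where "\<pi> = (\<lambda>x. if x \<in> D then f x else g x)"
  have \<pi>D: "bij_betw \<pi> D D'" using f by (rule bij_betw_cong[THEN iffD1, rotated]) (simp add: \<pi>_def)
  have \<pi>B: "bij_betw \<pi> (B - D) (B - D')" using g by (rule bij_betw_cong[THEN iffD1, rotated]) (simp add: \<pi>_def)
  have "bij_betw \<pi> (D \<union> (B - D)) (D' \<union> (B - D'))"
    using \<pi>D \<pi>B by (rule bij_betw_combine) auto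
  then have \<pi>: "bij_betw \<pi> B B" using D by (simp add: Un_absorb1)
  have fin_bij: "finite {\<sigma> :: 'n \<Rightarrow> 'b. bij_betw \<sigma> UNIV B}" using B by (simp add: finite_bijections)
  show ?thesis
  proof (rule card_inj_on_le[where f = "\<lambda>\<sigma>. \<pi> \<circ> \<sigma>"])
    show "inj_on (\<lambda>\<sigma>. \<pi> \<circ> \<sigma>) (bijections B V D)"
    proof (rule inj_onI)
      fix \<sigma> \<tau> :: "'n \<Rightarrow> 'b"
      assume *: "\<sigma> \<in> bijections B V D" "\<tau> \<in> bijections B V D" "\<pi> \<circ> \<sigma> = \<pi> \<circ> \<tau>"
      show "\<sigma> = \<tau>"
      proof
        fix j
        have "\<sigma> j \<in> B" "\<tau> j \<in> B" "\<pi> (\<sigma> j) = \<pi> (\<tau> j)" using * by (auto simp: bijections_def bij_betw_def fun_eq_iff)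
        then show "\<sigma> j = \<tau> j" using \<pi> by (auto simp: bij_betw_def inj_on_def)
      qed
    qed
    show "(\<lambda>\<sigma>. \<pi> \<circ> \<sigma>) ` bijections B V D \<subseteq> bijections B V D'"
      using \<pi> \<pi>D by (auto intro: bij_betw_trans simp: bijections_def image_comp[symmetric] bij_betw_def[of \<pi> D])
    show "finite (bijections B V D')"
      by (rule finite_subset[OF _ fin_bij]) (auto simp: bijections_def)
  qed
qed

text \<open>By symmetry all possible images of V are equally frequent among the bijections.\<close>

lemma card_bijections_image_eq:
  fixes B :: "'b set" and V :: "'n::finite set"
  assumes B: "finite B" "card B = CARD('n)" and D: "D \<subseteq> B" "card D = card V"
  shows "card (bijections B V D) * (CARD('n) choose card V) = card {\<sigma> :: 'n \<Rightarrow> 'b. bij_betw \<sigma> UNIV B}"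
proof -
  let ?\<Sigma> = "{\<sigma> :: 'n \<Rightarrow> 'b. bij_betw \<sigma> UNIV B}" and ?\<D> = "{D. D \<subseteq> B \<and> card D = card V}"
  have fin_bij: "finite ?\<Sigma>" using B by (simp add: finite_bijections)
  have "?\<Sigma> = (\<Union>D\<in>?\<D>. bijections B V D)"
    by (auto simp: bijections_def bij_betw_def inj_on_subset card_image)
  then have "card ?\<Sigma> = (\<Sum>D\<in>?\<D>. card (bijections B V D))"
  proof (rule ssubst, intro card_UN_disjoint)
    show "\<forall>D\<in>?\<D>. finite (bijections B V D)"
      by (intro ballI finite_subset[OF _ fin_bij]) (auto simp: bijections_def)
  qed (use B in \<open>auto simp: bijections_def\<close>)
  also have "\<dots> = (\<Sum>D'\<in>?\<D>. card (bijections B V D))"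
    using D by (intro sum.cong refl antisym card_bijections_image[OF B(1)]) auto
  also have "\<dots> = card ?\<D> * card (bijections B V D)" by simp
  also have "card ?\<D> = CARD('n) choose card V" using n_subsets[OF B(1), of "card V"] B by simp
  finally show ?thesis by simp
qed

section \<open>The configuration of intersections of hyperplanes and its multiplicities\<close>

context weighted_hypergraph
begin

definition moment_family :: "'a::field set \<Rightarrow> nat \<Rightarrow> ('a ^ 'n) set multiset" where
  "moment_family P i = mset_set (moment_flat ` {D. D \<subseteq> P \<and> card D = CARD('n) - k i})"

text \<open>Each flat of \<open>moment_family\<close> has multiplicity one, so 0 is its only
  label.\<close>

definition moment_tuple :: "('n \<Rightarrow> 'a::field) \<Rightarrow> 'e \<Rightarrow> ('a ^ 'n) set \<times> nat" where
  "moment_tuple \<sigma> = (\<lambda>e\<in>edges H. (moment_flat (\<sigma> ` verts H e), 0))"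

definition moment_pmf :: "'a::field set \<Rightarrow> ('e \<Rightarrow> ('a ^ 'n) set \<times> nat) pmf" where
  "moment_pmf B = map_pmf moment_tuple (pmf_of_set {\<sigma> :: 'n \<Rightarrow> 'a. bij_betw \<sigma> UNIV B})"

lemma k_less: "i \<in> I \<Longrightarrow> 1 \<le> k i \<and> k i < CARD('n)"
  using unif unfolding uniform_chypergraph_def
  by (metis One_nat_def Suc_pred le_imp_less_Suc zero_less_card_finite)

lemma card_verts': "i \<in> I \<Longrightarrow> e \<in> C i \<Longrightarrow> card (verts H e) = CARD('n) - k i"
  using unif by (auto simp: uniform_chypergraph_def)

lemma flats_configuration_moment_family:
  fixes P :: "'a::field set"
  assumes P: "finite P" "CARD('n) \<le> card P"
  shows "flats_configuration H k (moment_family P)"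
  unfolding flats_configuration_def
proof (intro ballI)
  fix i S assume i: "i \<in> {1..ncolours H}" and S: "S \<in># moment_family P i"
  have "S \<in> moment_flat ` {D. D \<subseteq> P \<and> card D = CARD('n) - k i}"
    using S P by (simp add: moment_family_def)
  then obtain D where D: "D \<subseteq> P" "card D = CARD('n) - k i" "S = moment_flat D" by blast
  have finD: "finite D" using D P finite_subset by blast
  have "k i \<le> card (P - D)" using D P finD k_less[OF i] by (simp add: card_Diff_subset)
  \<comment> \<open>D is completed to d parameters because \<open>moment_frame\<close> supplies
    charts at points where d hyperplanes meet.\<close>
  then obtain R where R: "R \<subseteq> P - D" "card R = k i" using obtain_subset_with_card_n by metis
  have finR: "finite R" using R P by (meson finite_Diff finite_subset)
  have cardB: "card (D \<union> R) = CARD('n)"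
    using D R finD finR k_less[OF i] by (subst card_Un_disjoint) auto
  then obtain \<sigma> where \<sigma>: "bij_betw \<sigma> (UNIV :: 'n set) (D \<union> R)"
    using finite_same_card_bij[of "UNIV :: 'n set" "D \<union> R"] finD finR by auto
  obtain A :: "'a ^ 'n \<Rightarrow> 'a ^ 'n" where A: "invertible_affine A" "\<And>S. A ` coords (- S) = moment_flat (\<sigma> ` S)"
    using moment_frame[OF \<sigma>] by metis
  let ?V = "\<sigma> -` D"
  have "\<sigma> ` ?V = D" using \<sigma> by (auto simp: bij_betw_def)
  moreover from this have "card ?V = card D"
    using \<sigma> by (metis bij_betw_def card_image inj_on_subset subset_UNIV)
  then have "card (- ?V) = k i" using D k_less[OF i] by (simp add: Compl_eq_Diff_UNIV card_Diff_subset)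
  ultimately show "flat (k i) S" using flat_frame[OF A(1), of "- ?V"] A(2)[of ?V] D(3) by simp
qed

lemma moment_tuple_joint:
  fixes P :: "'a::field set"
  assumes P: "finite P" and B: "B \<subseteq> P" and \<sigma>: "bij_betw \<sigma> (UNIV :: 'n set) B"
  shows "moment_tuple \<sigma> \<in> joint_tuples H (moment_family P) (root_point B)"
proof -
  have "moment_tuple \<sigma> e \<in> members (moment_family P (colour H e))" if e: "e \<in> edges H" for e
  proof -
    have i: "colour H e \<in> I" "e \<in> C (colour H e)"
      using unif e by (auto simp: uniform_chypergraph_def colour_class_def)
    have "card (\<sigma> ` verts H e) = CARD('n) - k (colour H e)"
      using card_verts'[OF i] \<sigma> by (metis bij_betw_def card_image inj_on_subset subset_UNIV)
    moreover have "\<sigma> ` verts H e \<subseteq> P" using \<sigma> B by (auto simp: bij_betw_def)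
    ultimately show ?thesis using e P
      by (auto simp: moment_tuple_def members_def moment_family_def)
  qed
  moreover obtain A :: "'a ^ 'n \<Rightarrow> 'a ^ 'n" where A: "invertible_affine A" "A 0 = root_point B"
    "\<And>S. A ` coords (- S) = moment_flat (\<sigma> ` S)"
    using moment_frame[OF \<sigma>] by metis
  ultimately show ?thesis
    unfolding joint_tuples_def span_axis_eq_coords by (auto simp: moment_tuple_def intro!: exI[of _ A])
qed

text \<open>For each edge of colour i, a random assignment of the hyperplanes makes the flat uniform
  on the binom d (d - k i) intersections through the joint. Mixing over the random edge leaves this
  law unchanged, so its entropy is the logarithm of that number.\<close>

lemma moment_score:
  fixes B :: "'a::field set"
  assumes inf: "infinite (UNIV :: 'a set)" and B: "finite B" "card B = CARD('n)"
  shows "ln 2 * tuple_score H w (moment_pmf B) = edge_term + (\<Sum>i\<in>I. W i * ln (real (CARD('n) choose (CARD('n) - k i))))"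
proof -
  let ?\<Sigma> = "{\<sigma> :: 'n \<Rightarrow> 'a. bij_betw \<sigma> UNIV B}" and ?\<mu> = "moment_pmf B"
  have fin: "finite ?\<Sigma>" using B by (simp add: finite_bijections)
  have ne: "?\<Sigma> \<noteq> {}" using finite_same_card_bij[of "UNIV :: 'n set" B] B by auto
  have card_pos: "0 < real (card ?\<Sigma>)" using fin ne by (simp add: card_gt_0_iff)
  have set_\<mu>: "set_pmf ?\<mu> = moment_tuple ` ?\<Sigma>" using fin ne by (simp add: moment_pmf_def)
  then have fin_\<mu>: "finite (set_pmf ?\<mu>)" using fin by simp
  have "W i * (\<Sum>x\<in>set_pmf (label_pmf ?\<mu> i). pmf (label_pmf ?\<mu> i) x * ln (pmf (label_pmf ?\<mu> i) x)) =
    - (W i * ln (real (CARD('n) choose (CARD('n) - k i))))" if i: "i \<in> I" for i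
  proof (cases "W i = 0")
    case False
    then have Wi: "0 < W i" using W_nonneg[of i] by simp
    let ?P = "label_pmf ?\<mu> i" and ?c = "real (CARD('n) choose (CARD('n) - k i))"
    have c: "0 < ?c" by (simp add: zero_less_binomial_iff)
    have finP: "finite (set_pmf ?P)" by (rule finite_set_label[OF fin_\<mu> Wi])
    have "pmf ?P x = 1 / ?c" if x: "x \<in> set_pmf ?P" for x
    proof -
      obtain T e where T: "T \<in> set_pmf ?\<mu>" "e \<in> C i" "x = T e" using set_label_pmf[OF Wi x] .
      then obtain \<sigma> where \<sigma>: "\<sigma> \<in> ?\<Sigma>" "T = moment_tuple \<sigma>" using set_\<mu> by blast
      define D where "D = \<sigma> ` verts H e"
      have x_eq: "x = (moment_flat D, 0)" using T \<sigma> C_edges by (simp add: moment_tuple_def D_def)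
      have D: "D \<subseteq> B" "card D = CARD('n) - k i"
      proof -
        show "D \<subseteq> B" using \<sigma> by (auto simp: D_def bij_betw_def)
        have "inj_on \<sigma> (verts H e)" using \<sigma> by (auto simp: bij_betw_def intro: inj_on_subset)
        then show "card D = CARD('n) - k i" using card_verts'[OF i T(2)] by (simp add: D_def card_image)
      qed
      \<comment> \<open>Equal flats come from equal sets of parameters, so counting assignments that
        yield a given flat reduces to counting bijections with a prescribed image.\<close>
      have iff: "moment_tuple \<tau> e' = x \<longleftrightarrow> \<tau> ` verts H e' = D" if \<tau>: "\<tau> \<in> ?\<Sigma>" and e': "e' \<in> C i" for \<tau> e'
      proof -
        have "inj_on \<tau> (verts H e')" using \<tau> by (auto simp: bij_betw_def intro: inj_on_subset)
        then have "card (\<tau> ` verts H e') = card D" using card_verts'[OF i e'] D by (simp add: card_image)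
        moreover have "finite D" using D B finite_subset by blast
        ultimately have "(moment_flat (\<tau> ` verts H e') :: ('a ^ 'n) set) = moment_flat D \<longleftrightarrow> \<tau> ` verts H e' = D"
          using moment_flat_inj[OF inf, of "\<tau> ` verts H e'" D, where 'n = 'n] D by auto
        then show ?thesis using C_edges[OF e'] by (simp add: moment_tuple_def x_eq)
      qed
      have "W i * pmf ?P x = W i * (\<Sum>x'\<in>set_pmf ?P. pmf ?P x' * of_bool (x' = x))"
        using finP x by simp
      also have "\<dots> = (\<Sum>T\<in>set_pmf ?\<mu>. pmf ?\<mu> T * (\<Sum>e\<in>C i. w e * of_bool (T e = x)))"
        by (rule sum_label_pmf[OF fin_\<mu> Wi finP]) simp
      also have "\<dots> = measure_pmf.expectation ?\<mu> (\<lambda>T. \<Sum>e\<in>C i. w e * of_bool (T e = x))"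
        by (subst integral_measure_pmf[OF fin_\<mu>]) auto
      also have "\<dots> = measure_pmf.expectation (pmf_of_set ?\<Sigma>) (\<lambda>\<tau>. \<Sum>e\<in>C i. w e * of_bool (moment_tuple \<tau> e = x))"
        by (simp add: moment_pmf_def)
      also have "\<dots> = (\<Sum>\<tau>\<in>?\<Sigma>. \<Sum>e\<in>C i. w e * of_bool (moment_tuple \<tau> e = x)) / card ?\<Sigma>"
        using fin ne by (rule integral_pmf_of_set[rotated])
      also have "(\<Sum>\<tau>\<in>?\<Sigma>. \<Sum>e\<in>C i. w e * of_bool (moment_tuple \<tau> e = x)) =
          (\<Sum>e\<in>C i. \<Sum>\<tau>\<in>?\<Sigma>. w e * of_bool (moment_tuple \<tau> e = x))" by (rule sum.swap)
      also have "\<dots> = (\<Sum>e\<in>C i. w e * (card ?\<Sigma> / ?c))"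
      proof (rule sum.cong[OF refl])
        fix e' assume e': "e' \<in> C i"
        have "(\<Sum>\<tau>\<in>?\<Sigma>. w e' * of_bool (moment_tuple \<tau> e' = x)) = (\<Sum>\<tau>\<in>?\<Sigma>. if \<tau> ` verts H e' = D then w e' else 0)"
          using iff[OF _ e'] by (intro sum.cong) auto
        also have "\<dots> = w e' * card {\<tau> \<in> ?\<Sigma>. \<tau> ` verts H e' = D}"
          using fin by (simp add: sum.inter_filter[symmetric])
        also have "card {\<tau> \<in> ?\<Sigma>. \<tau> ` verts H e' = D} = card ?\<Sigma> / ?c"
        proof -
          have "card {\<tau> \<in> ?\<Sigma>. \<tau> ` verts H e' = D} * (CARD('n) choose (CARD('n) - k i)) = card ?\<Sigma>"
            using card_bijections_image_eq[OF B D(1), of "verts H e'"] card_verts'[OF i e'] D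
            by (simp add: bijections_def)
          then show ?thesis using c by (simp add: field_simps flip: of_nat_mult)
        qed
        finally show "(\<Sum>\<tau>\<in>?\<Sigma>. w e' * of_bool (moment_tuple \<tau> e' = x)) = w e' * (card ?\<Sigma> / ?c)" .
      qed
      also have "\<dots> = W i * (card ?\<Sigma> / ?c)" by (simp only: subtotal_def sum_distrib_right)
      finally show ?thesis using Wi card_pos c by (simp add: field_simps)
    qed
    then have "(\<Sum>x\<in>set_pmf ?P. pmf ?P x * ln (pmf ?P x)) = (\<Sum>x\<in>set_pmf ?P. pmf ?P x) * ln (1 / ?c)"
      unfolding sum_distrib_right by (intro sum.cong) simp_all
    also have "\<dots> = - ln ?c" using sum_pmf_eq_1[OF finP order_refl] c by (simp add: ln_div)
    finally show ?thesis by simp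
  qed simp
  then show ?thesis unfolding tuple_score_nats[OF fin_\<mu>] by (simp add: sum_negf)
qed

lemma rpow_mono: "0 \<le> x \<Longrightarrow> x \<le> y \<Longrightarrow> 0 \<le> a \<Longrightarrow> rpow x a \<le> rpow y a"
  by (simp add: rpow_def powr_mono2)

text \<open>The test configuration has m = n + d hyperplanes: binom m d joints of multiplicity at
  least \<open>exp s\<close>, and at most binom m (d - k i) flats of colour i.\<close>

lemma sharp_at:
  assumes inf: "infinite (UNIV :: 'a::field set)"
    and bound: "\<And>\<F> :: nat \<Rightarrow> ('a ^ 'n) set multiset. flats_configuration H k \<F> \<Longrightarrow>
      (\<Sum>p\<in>joints H \<F>. multiplicity_at H w \<F> p) \<le> c * (\<Prod>i\<in>I. rpow (real (size (\<F> i))) (W i))"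
  shows "0 < c"
    and "ln (real ((n + CARD('n)) choose CARD('n))) + edge_term + (\<Sum>i\<in>I. W i * ln (real (CARD('n) choose (CARD('n) - k i))))
      \<le> ln c + (\<Sum>i\<in>I. W i * ln (real ((n + CARD('n)) choose (CARD('n) - k i))))"
proof -
  let ?d = "CARD('n)" and ?M = "n + CARD('n)"
  obtain P :: "'a set" where P: "finite P" "card P = ?M"
    using infinite_arbitrarily_large[OF inf] by blast
  let ?F = "moment_family P :: nat \<Rightarrow> ('a ^ 'n) set multiset"
  let ?R = "\<Prod>i\<in>I. rpow (real (size (?F i))) (W i)" and ?L = "\<Sum>i\<in>I. W i * ln (real (?M choose (?d - k i)))"
  let ?\<B> = "{B. B \<subseteq> P \<and> card B = ?d}"
  define s where "s = edge_term + (\<Sum>i\<in>I. W i * ln (real (?d choose (?d - k i))))"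
  have sub: "root_point ` ?\<B> \<subseteq> joints H ?F" and mult: "\<And>B. B \<in> ?\<B> \<Longrightarrow> exp s \<le> multiplicity_at H w ?F (root_point B)"
  proof -
    have joint: "root_point B \<in> joints H ?F \<and> exp s \<le> multiplicity_at H w ?F (root_point B)" if B: "B \<in> ?\<B>" for B
    proof -
      have finB: "finite B" using B P finite_subset by auto
      have ne: "{\<sigma> :: 'n \<Rightarrow> 'a. bij_betw \<sigma> UNIV B} \<noteq> {}"
        using finite_same_card_bij[of "UNIV :: 'n set" B] B finB by auto
      have fin: "finite {\<sigma> :: 'n \<Rightarrow> 'a. bij_betw \<sigma> UNIV B}" using finB by (rule finite_bijections)
      have tuples: "set_pmf (moment_pmf B) \<subseteq> joint_tuples H ?F (root_point B)"
        using moment_tuple_joint[OF P(1), of B] B fin ne by (auto simp: moment_pmf_def)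
      then have J: "root_point B \<in> joints H ?F"
        using set_pmf_not_empty[of "moment_pmf B"] by (auto simp: joints_def)
      have "tuple_score H w (moment_pmf B) \<le> (SUP \<mu>\<in>{\<mu>. set_pmf \<mu> \<subseteq> joint_tuples H ?F (root_point B)}. tuple_score H w \<mu>)"
        by (rule cSUP_upper[OF _ bdd_above_scores[OF J]]) (use tuples in simp)
      then have "2 powr tuple_score H w (moment_pmf B) \<le> multiplicity_at H w ?F (root_point B)"
        unfolding multiplicity_at_def by (intro powr_mono) auto
      moreover have "2 powr tuple_score H w (moment_pmf B) = exp s"
        using moment_score[OF inf finB] B by (simp add: powr_def s_def mult.commute)
      ultimately show ?thesis using J by simp
    qed
    then show "root_point ` ?\<B> \<subseteq> joints H ?F" by blast
    show "\<And>B. B \<in> ?\<B> \<Longrightarrow> exp s \<le> multiplicity_at H w ?F (root_point B)" using joint by blast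
  qed
  have inj: "inj_on (root_point :: 'a set \<Rightarrow> 'a ^ 'n) ?\<B>"
    by (rule inj_on_subset[OF inj_root_point]) (use P finite_subset in auto)
  have "real (?M choose ?d) * exp s = (\<Sum>B\<in>?\<B>. exp s)"
    using n_subsets[OF P(1), of ?d] P(2) by simp
  also have "\<dots> \<le> (\<Sum>B\<in>?\<B>. multiplicity_at H w ?F (root_point B))"
    using mult by (rule sum_mono)
  also have "\<dots> = (\<Sum>p\<in>root_point ` ?\<B>. multiplicity_at H w ?F p)"
    by (simp add: sum.reindex[OF inj])
  also have "\<dots> \<le> (\<Sum>p\<in>joints H ?F. multiplicity_at H w ?F p)"
    using sub finite_joints[OF finite_edges cov] by (intro sum_mono2) (auto simp: multiplicity_at_def)
  also have "\<dots> \<le> c * ?R"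
    by (rule bound, rule flats_configuration_moment_family) (use P in auto)
  finally have le: "real (?M choose ?d) * exp s \<le> c * ?R" .
  have pos: "0 < real (?M choose ?d)" by (simp add: zero_less_binomial_iff)
  then have "0 < c * ?R"
    using le by (intro order_less_le_trans[OF _ le]) simp
  moreover have "0 \<le> ?R" by (intro prod_nonneg) (simp add: rpow_nonneg)
  ultimately show c: "0 < c" by (simp add: zero_less_mult_iff)
  have binpos: "0 < real (?M choose (?d - k i))" for i by (simp add: zero_less_binomial_iff)
  \<comment> \<open>An upper bound on the sizes suffices, as c is already known to be
    positive.\<close>
  have "size (?F i) \<le> ?M choose (?d - k i)" for i
  proof -
    have "finite {D. D \<subseteq> P \<and> card D = ?d - k i}" using P by simp
    then have "size (?F i) \<le> card {D. D \<subseteq> P \<and> card D = ?d - k i}"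
      by (simp add: moment_family_def card_image_le)
    then show ?thesis using n_subsets[OF P(1)] P(2) by simp
  qed
  then have "?R \<le> (\<Prod>i\<in>I. rpow (real (?M choose (?d - k i))) (W i))"
    by (intro prod_mono conjI rpow_nonneg rpow_mono W_nonneg) auto
  then have "c * ?R \<le> c * exp ?L"
    using c binpos by (simp add: rpow_eq_exp exp_sum)
  with le have "real (?M choose ?d) * exp s \<le> c * exp ?L" by linarith
  then have "ln (real (?M choose ?d) * exp s) \<le> ln (c * exp ?L)"
    using pos by (intro ln_mono) auto
  then show "ln (real (?M choose ?d)) + edge_term + (\<Sum>i\<in>I. W i * ln (real (?d choose (?d - k i))))
      \<le> ln c + ?L"
    using pos c by (simp add: ln_mult_pos s_def)
qed

text \<open>An exact cover makes both sides of the comparison in \<open>sharp_at\<close> grow like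
  n^d, so the limit compares the constants.\<close>

lemma constant_sharp:
  assumes inf: "infinite (UNIV :: 'a::field set)"
    and exact: "\<And>j. (\<Sum>e | e \<in> edges H \<and> j \<in> verts H e. w e) = 1"
    and bound: "\<And>\<F> :: nat \<Rightarrow> ('a ^ 'n) set multiset. flats_configuration H k \<F> \<Longrightarrow>
      (\<Sum>p\<in>joints H \<F>. multiplicity_at H w \<F> p) \<le> c * (\<Prod>i\<in>I. rpow (real (size (\<F> i))) (W i))"
  shows "joints_constant H k w \<le> c"
proof -
  let ?d = "CARD('n)"
  \<comment> \<open>Double counting of the weighted incidences between vertices and edges.\<close>
  have weight: "(\<Sum>i\<in>I. W i * real (?d - k i)) = real ?d"
  proof -
    have "(\<Sum>i\<in>I. W i * real (?d - k i)) = (\<Sum>i\<in>I. \<Sum>e\<in>C i. w e * real (card (verts H e)))"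
      by (intro sum.cong refl) (simp add: subtotal_def sum_distrib_right card_verts')
    also have "\<dots> = (\<Sum>e\<in>edges H. \<Sum>j\<in>UNIV. if j \<in> verts H e then w e else 0)"
      by (simp add: sum_edges sum.If_cases mult.commute)
    also have "\<dots> = (\<Sum>j\<in>UNIV. \<Sum>e\<in>edges H. if j \<in> verts H e then w e else 0)" by (rule sum.swap)
    also have "\<dots> = (\<Sum>j\<in>(UNIV :: 'n set). 1)"
      by (rule sum.cong[OF refl]) (simp add: sum.inter_filter[OF finite_edges, symmetric] exact)
    finally show ?thesis by simp
  qed
  let ?b = "edge_term + (\<Sum>i\<in>I. W i * ln (real (?d choose (?d - k i))))"
  have "ln_defect 0 ?d n - (\<Sum>i\<in>I. W i * ln_defect (k i) (?d - k i) n) \<le> ln c - ?b" for n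
  proof -
    have eq: "(\<Sum>i\<in>I. W i * ln_defect (k i) (?d - k i) n) =
      (\<Sum>i\<in>I. W i * ln (real ((n + ?d) choose (?d - k i)))) - real ?d * ln (real n + 1)"
    proof -
      have "(\<Sum>i\<in>I. W i * ln_defect (k i) (?d - k i) n) =
        (\<Sum>i\<in>I. W i * ln (real ((n + ?d) choose (?d - k i))) - W i * real (?d - k i) * ln (real n + 1))"
        using k_less by (intro sum.cong refl) (auto simp: ln_defect_def right_diff_distrib less_imp_le)
      also have "\<dots> = (\<Sum>i\<in>I. W i * ln (real ((n + ?d) choose (?d - k i)))) -
        (\<Sum>i\<in>I. W i * real (?d - k i)) * ln (real n + 1)"
        by (simp only: sum_subtractf sum_distrib_right)
      finally show ?thesis unfolding weight .
    qed
    show ?thesis using sharp_at(2)[OF inf bound, of n] unfolding eq by (simp add: ln_defect_def)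
  qed
  moreover have "(\<lambda>n. ln_defect 0 ?d n - (\<Sum>i\<in>I. W i * ln_defect (k i) (?d - k i) n)) \<longlonglongrightarrow>
    - ln (fact ?d) - (\<Sum>i\<in>I. W i * - ln (fact (?d - k i)))"
    by (intro tendsto_intros ln_defect_limit)
  ultimately have "- ln (fact ?d) - (\<Sum>i\<in>I. W i * - ln (fact (?d - k i))) \<le> ln c - ?b"
    by (intro LIMSEQ_le_const2) auto
  \<comment> \<open>The product of binom d (d - k) and (d - k)! is d! / k!, which turns the limits
    for the configuration into the terms of \<open>joints_constant\<close>.\<close>
  moreover have "(\<Sum>i\<in>I. W i * ln (real (?d choose (?d - k i)))) - (\<Sum>i\<in>I. W i * - ln (fact (?d - k i))) =
    total_weight H w * ln (fact ?d) - (\<Sum>i\<in>I. W i * ln (fact (k i)))"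
  proof -
    have "ln (real (?d choose (?d - k i))) + ln (fact (?d - k i)) = ln (fact ?d) - ln (fact (k i))" if i: "i \<in> I" for i
    proof -
      have "fact (?d - k i) * fact (k i) * (?d choose (?d - k i)) = fact ?d"
        using binomial_fact_lemma[of "?d - k i" ?d] k_less[OF i] by simp
      then have "real (fact (?d - k i)) * real (fact (k i)) * real (?d choose (?d - k i)) = real (fact ?d)"
        by (simp only: of_nat_mult[symmetric])
      then have eq: "(fact ?d :: real) = fact (?d - k i) * fact (k i) * real (?d choose (?d - k i))"
        by (simp add: of_nat_fact)
      have "0 < real (?d choose (?d - k i))" by (simp add: zero_less_binomial_iff)
      then show ?thesis unfolding eq by (simp add: ln_mult_pos)
    qed
    then have "(\<Sum>i\<in>I. W i * (ln (real (?d choose (?d - k i))) + ln (fact (?d - k i)))) =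
      (\<Sum>i\<in>I. W i * (ln (fact ?d) - ln (fact (k i))))" by (intro sum.cong) simp_all
    then show ?thesis
      by (simp add: distrib_left right_diff_distrib sum.distrib sum_subtractf total_eq sum_distrib_right sum_negf)
  qed
  ultimately have "(total_weight H w - 1) * ln (fact ?d) - (\<Sum>i\<in>I. W i * ln (fact (k i))) + edge_term \<le> ln c"
    by (simp add: left_diff_distrib)
  then have "joints_constant H k w \<le> exp (ln c)"
    unfolding joints_constant_eq_exp by simp
  also have "\<dots> = c" using sharp_at(1)[OF inf bound] by simp
  finally show ?thesis .
qed

end

theorem theorem1p15:
  fixes H :: "('e, 'n::finite) chypergraph"
    and k :: "nat \<Rightarrow> nat"
    and w :: "'e \<Rightarrow> real"
  assumes "uniform_chypergraph H k"
    and "covers H w"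
  shows
    "(\<forall>\<F> :: nat \<Rightarrow> ('a::field ^ 'n) set multiset. flats_configuration H k \<F> \<longrightarrow>
        (\<Sum>p\<in>joints H \<F>. multiplicity_at H w \<F> p)
          \<le> joints_constant H k w * (\<Prod>i=1..ncolours H. rpow (real (size (\<F> i))) (subtotal H w i)))
     \<and>
     (infinite (UNIV :: 'a set) \<and> (\<forall>j. (\<Sum>e | e \<in> edges H \<and> j \<in> verts H e. w e) = 1) \<longrightarrow>
        (\<forall>C :: real.
           (\<forall>\<F> :: nat \<Rightarrow> ('a ^ 'n) set multiset. flats_configuration H k \<F> \<longrightarrow>
              (\<Sum>p\<in>joints H \<F>. multiplicity_at H w \<F> p)
                \<le> C * (\<Prod>i=1..ncolours H. rpow (real (size (\<F> i))) (subtotal H w i)))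
           \<longrightarrow> joints_constant H k w \<le> C))"
proof -
  interpret weighted_hypergraph H k w by unfold_locales (rule assms)+
  show ?thesis using multiplicity_sum_bound constant_sharp[where ?'a = 'a] by blast
qed

end
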